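(* Let $m\ge1$, let $k_2,\dots,k_m\geq 2$ be integers, let $P(z)\in\mathbb{K}[z]$ be a polynomial of degree $d\geq 2$, and let $Y=\{y_1y_2^{k_2}\cdots y_m^{k_m}=P(z)\}\subset\mathbb{K}^{m+1}$. Then: 1) $\mathrm{ML}(Y)=\mathbb{K}[y_2,\dots,y_m]$. 2) Every locally nilpotent derivation of $\mathbb{K}[Y]$ has the form $h(y_2,\dots,y_m)\widehat{\partial}$ with $h\in\mathbb{K}[y_2,\dots,y_m]$, where $\widehat{\partial}$ is the canonical locally nilpotent derivation of $Y$. 3) For every subgroup $\Lambda\cong(\mathbb{K}^\times,\cdot)$ of $\mathrm{Aut}(Y)$, every $\varphi\in\Lambda$ and every $j\geq2$, there exists $\lambda\in\mathbb{K}\setminus\{0\}$ such that $\varphi^*(y_j)=\lambda y_j$. 4) For every $\psi\in\mathrm{Aut}(\mathbb{K}[Y])$ and every $j\geq2$ there exist $\lambda_j\in\mathbb{K}\setminus\{0\}$ and $p\in\{2,\dots,m\}$ such that $\psi(y_j)=\lambda_jy_p$.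
   Context: $\mathbb{K}$ is an algebraically closed field of characteristic zero. A derivation $\partial$ of a commutative $\mathbb{K}$-algebra $A$ is locally nilpotent (LND) if for every $a\in A$ there is $n$ with $\partial^n(a)=0$. The Makar-Limanov invariant $\mathrm{ML}(Y)\subset\mathbb{K}[Y]$ is the intersection of the kernels of all LNDs of $\mathbb{K}[Y]$. The canonical LND $\widehat{\partial}$ of $\mathbb{K}[Y]$ is given by $\widehat{\partial}(y_1)=P'(z)$, $\widehat{\partial}(z)=y_2^{k_2}\cdots y_m^{k_m}$, $\widehat{\partial}(y_j)=0$ for $j\geq2$. For $\varphi\in\mathrm{Aut}(Y)$, $\varphi^*$ is the induced automorphism of $\mathbb{K}[Y]$. A subgroup of $\mathrm{Aut}(Y)$ isomorphic to $(\mathbb{K}^\times,\cdot)$ means one given by an effective algebraic action of the multiplicative group on $Y$ (so that it corresponds to a $\mathbb{Z}$-grading of $\mathbb{K}[Y]$). *)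

theory Defs
  imports
    "HOL-Algebra.QuotRing"
    "HOL-Algebra.Module"
    "HOL-Algebra.Bij"
    "HOL-Computational_Algebra.Polynomial"
begin

section \<open>Affine space and regular functions\<close>

text \<open>
  Points of the affine space of dimension \<open>m + 1\<close> are extensional families indexed by
  \<open>{0..m}\<close>: index \<open>0\<close> is the coordinate \<open>z\<close>, and index \<open>j\<close> with \<open>1 \<le> j \<le> m\<close> is \<open>y\<^sub>j\<close>.
\<close>

definition affine_space :: "nat \<Rightarrow> (nat \<Rightarrow> 'k) set" where
  "affine_space m = ({0..m} \<rightarrow>\<^sub>E UNIV)"

definition poly_function :: "nat set \<Rightarrow> ((nat \<Rightarrow> 'k::field) \<Rightarrow> 'k) \<Rightarrow> bool" where
  "poly_function I F \<longleftrightarrow>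
     (\<exists>(S :: (nat \<Rightarrow> nat) set) c. finite S \<and>
        F = (\<lambda>x. \<Sum>\<alpha>\<in>S. c \<alpha> * (\<Prod>i\<in>I. x i ^ \<alpha> i)))"

text \<open>
  The subalgebra \<open>K[x\<^sub>i : i \<in> I]\<close> of the algebra of functions on \<open>Y\<close>. Functions on \<open>Y\<close> are
  extensional, so that equality of regular functions is equality on \<open>Y\<close>.
\<close>

definition poly_functions_on :: "(nat \<Rightarrow> 'k::field) set \<Rightarrow> nat set \<Rightarrow> ((nat \<Rightarrow> 'k) \<Rightarrow> 'k) set" where
  "poly_functions_on Y I = {restrict F Y | F. poly_function I F}"

definition coord :: "(nat \<Rightarrow> 'k) set \<Rightarrow> nat \<Rightarrow> (nat \<Rightarrow> 'k) \<Rightarrow> 'k" where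
  "coord Y j = (\<lambda>x\<in>Y. x j)"

text \<open>The algebra \<open>K[Y]\<close> of regular functions on a closed subset \<open>Y\<close> of \<open>affine_space m\<close>.\<close>

definition coord_ring ::
    "nat \<Rightarrow> (nat \<Rightarrow> 'k::field) set \<Rightarrow> ('k, (nat \<Rightarrow> 'k) \<Rightarrow> 'k) module" where
  "coord_ring m Y =
     \<lparr>carrier = poly_functions_on Y {0..m},
      monoid.mult = (\<lambda>f g. \<lambda>x\<in>Y. f x * g x),
      one = (\<lambda>x\<in>Y. 1),
      zero = (\<lambda>x\<in>Y. 0),
      add = (\<lambda>f g. \<lambda>x\<in>Y. f x + g x),
      module.smult = (\<lambda>c f. \<lambda>x\<in>Y. c * f x)\<rparr>"


section \<open>Derivations and automorphisms of algebras\<close>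

text \<open>The scalars of an algebra are all elements of the type \<open>'k\<close>, which is a field in all uses.\<close>

definition derivation :: "('k, 'a) module \<Rightarrow> ('a \<Rightarrow> 'a) \<Rightarrow> bool" where
  "derivation A D \<longleftrightarrow>
     D \<in> carrier A \<rightarrow> carrier A \<and>
     (\<forall>a\<in>carrier A. \<forall>b\<in>carrier A. D (a \<oplus>\<^bsub>A\<^esub> b) = D a \<oplus>\<^bsub>A\<^esub> D b) \<and>
     (\<forall>c. \<forall>a\<in>carrier A. D (c \<odot>\<^bsub>A\<^esub> a) = c \<odot>\<^bsub>A\<^esub> D a) \<and>
     (\<forall>a\<in>carrier A. \<forall>b\<in>carrier A.
        D (a \<otimes>\<^bsub>A\<^esub> b) = (D a \<otimes>\<^bsub>A\<^esub> b) \<oplus>\<^bsub>A\<^esub> (a \<otimes>\<^bsub>A\<^esub> D b))"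

definition lnd :: "('k, 'a) module \<Rightarrow> ('a \<Rightarrow> 'a) \<Rightarrow> bool" where
  "lnd A D \<longleftrightarrow> derivation A D \<and> (\<forall>a\<in>carrier A. \<exists>n. (D ^^ n) a = \<zero>\<^bsub>A\<^esub>)"

definition makar_limanov :: "('k, 'a) module \<Rightarrow> 'a set" where
  "makar_limanov A = {a \<in> carrier A. \<forall>D. lnd A D \<longrightarrow> D a = \<zero>\<^bsub>A\<^esub>}"

definition algebra_auts :: "('k, 'a) module \<Rightarrow> ('a \<Rightarrow> 'a) set" where
  "algebra_auts A =
     {\<psi> \<in> ring_iso A A. \<forall>c. \<forall>a\<in>carrier A. \<psi> (c \<odot>\<^bsub>A\<^esub> a) = c \<odot>\<^bsub>A\<^esub> \<psi> a}"


section \<open>Automorphisms of varieties and actions of the multiplicative group\<close>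

definition endomorphism :: "nat \<Rightarrow> (nat \<Rightarrow> 'k::field) set \<Rightarrow> ((nat \<Rightarrow> 'k) \<Rightarrow> (nat \<Rightarrow> 'k)) \<Rightarrow> bool" where
  "endomorphism m Y \<phi> \<longleftrightarrow>
     \<phi> \<in> Y \<rightarrow>\<^sub>E Y \<and> (\<forall>i\<in>{0..m}. (\<lambda>x\<in>Y. \<phi> x i) \<in> carrier (coord_ring m Y))"

definition aut_group :: "nat \<Rightarrow> (nat \<Rightarrow> 'k::field) set \<Rightarrow> ((nat \<Rightarrow> 'k) \<Rightarrow> (nat \<Rightarrow> 'k)) monoid" where
  "aut_group m Y = (BijGroup Y)
     \<lparr>carrier := {\<phi> \<in> Bij Y. endomorphism m Y \<phi> \<and> endomorphism m Y (restrict (inv_into Y \<phi>) Y)}\<rparr>"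

definition pullback ::
    "(nat \<Rightarrow> 'k) set \<Rightarrow> ((nat \<Rightarrow> 'k) \<Rightarrow> (nat \<Rightarrow> 'k)) \<Rightarrow> ((nat \<Rightarrow> 'k) \<Rightarrow> 'k) \<Rightarrow> (nat \<Rightarrow> 'k) \<Rightarrow> 'k" where
  "pullback Y \<phi> f = compose Y f \<phi>"

definition Gm :: "'k::field monoid" where
  "Gm = \<lparr>carrier = {t. t \<noteq> 0}, monoid.mult = (*), one = 1\<rparr>"

text \<open>
  The map \<open>(t, x) \<mapsto> \<alpha> t x\<close> is a morphism of varieties from \<open>Gm \<times> Y\<close> to \<open>Y\<close>: the regular functions
  on \<open>Gm \<times> Y\<close> are the elements of \<open>K[t, t\<^sup>-\<^sup>1] \<otimes> K[Y]\<close>, that is, Laurent polynomials in \<open>t\<close> with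
  coefficients in \<open>K[Y]\<close>.
\<close>

definition algebraic_family ::
    "nat \<Rightarrow> (nat \<Rightarrow> 'k::field) set \<Rightarrow> ('k \<Rightarrow> (nat \<Rightarrow> 'k) \<Rightarrow> (nat \<Rightarrow> 'k)) \<Rightarrow> bool" where
  "algebraic_family m Y \<alpha> \<longleftrightarrow>
     (\<forall>i\<in>{0..m}. \<exists>(N :: int set) f. finite N \<and> (\<forall>n\<in>N. f n \<in> carrier (coord_ring m Y)) \<and>
        (\<forall>t\<in>carrier Gm. \<forall>x\<in>Y. \<alpha> t x i = (\<Sum>n\<in>N. t powi n * f n x)))"

text \<open>
  The group isomorphism \<open>\<alpha>\<close> amounts to an action of \<open>Gm\<close> on \<open>Y\<close> by automorphisms, with image
  \<open>\<Lambda>\<close>; its injectivity says that this action is effective.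
\<close>

definition Gm_subgroup ::
    "nat \<Rightarrow> (nat \<Rightarrow> 'k::field) set \<Rightarrow> ((nat \<Rightarrow> 'k) \<Rightarrow> (nat \<Rightarrow> 'k)) set \<Rightarrow> bool" where
  "Gm_subgroup m Y \<Lambda> \<longleftrightarrow>
     subgroup \<Lambda> (aut_group m Y) \<and>
     (\<exists>\<alpha>. \<alpha> \<in> iso Gm ((aut_group m Y)\<lparr>carrier := \<Lambda>\<rparr>) \<and> algebraic_family m Y \<alpha>)"


section \<open>The hypersurface and its canonical locally nilpotent derivation\<close>

definition hypersurface :: "nat \<Rightarrow> (nat \<Rightarrow> nat) \<Rightarrow> 'k::field poly \<Rightarrow> (nat \<Rightarrow> 'k) set" where
  "hypersurface m k P =
     {x \<in> affine_space m. x 1 * (\<Prod>j\<in>{2..m}. x j ^ k j) = poly P (x 0)}"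

text \<open>
  A derivation of \<open>K[Y]\<close> is determined by its values on the generators \<open>z, y\<^sub>1, \<dots>, y\<^sub>m\<close>, so at most
  one derivation, up to its values outside the carrier, satisfies the following.
\<close>

definition canonical_lnd ::
    "nat \<Rightarrow> (nat \<Rightarrow> nat) \<Rightarrow> 'k::field poly \<Rightarrow>
     (((nat \<Rightarrow> 'k) \<Rightarrow> 'k) \<Rightarrow> ((nat \<Rightarrow> 'k) \<Rightarrow> 'k)) \<Rightarrow> bool" where
  "canonical_lnd m k P \<delta> \<longleftrightarrow>
     (let Y = hypersurface m k P in
        lnd (coord_ring m Y) \<delta> \<and>
        \<delta> (coord Y 1) = (\<lambda>x\<in>Y. poly (pderiv P) (x 0)) \<and>
        \<delta> (coord Y 0) = (\<lambda>x\<in>Y. \<Prod>j\<in>{2..m}. x j ^ k j) \<and>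
        (\<forall>j\<in>{2..m}. \<delta> (coord Y j) = \<zero>\<^bsub>coord_ring m Y\<^esub>))"

end

theory Submission
  imports Defs "HOL-Library.Poly_Mapping"
begin

text \<open>
  Write \<open>M\<close> for the monomial \<open>y\<^sub>2\<^bsup>k 2\<^esup> \<cdots> y\<^sub>m\<^bsup>k m\<^esup>\<close> and \<open>d\<close> for the degree of \<open>P\<close>. Where \<open>M\<close> is nonzero, \<open>y\<^sub>1\<close> is
  \<open>P(z) / M\<close>, so a regular function expands to a Laurent polynomial in \<open>z, y\<^sub>2, \<dots>, y\<^sub>m\<close>. Order the
  exponents lexicographically with \<open>z\<close> first. The monomials \<open>y\<^sub>1\<^bsup>q\<^esup> z\<^bsup>i\<^esup> y\<^sub>2\<^bsup>b 2\<^esup> \<cdots> y\<^sub>m\<^bsup>b m\<^esup>\<close> with \<open>i < d\<close>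
  span the coordinate ring and have distinct leading exponents. So they are a basis
  (\<open>normal_form\<close>), the expansion is injective, and the leading exponents of regular functions form an
  explicit semigroup, \<open>basis_expos\<close>.

  Let \<open>D\<close> be a nonzero locally nilpotent derivation, and let \<open>e\<close> be the largest amount by which it
  raises the leading exponent of a generator. On leading terms \<open>D\<close> acts as a homogeneous derivation of
  degree \<open>e\<close>: it multiplies the monomial of exponent \<open>u\<close> by a number that is additive in \<open>u\<close> and shifts
  \<open>u\<close> by \<open>e\<close> (\<open>tracks_carrier\<close>). Nilpotency makes these numbers natural multiples of a fixed one, and
  the shifted exponents have to stay in the semigroup (\<open>lnd_weight\<close>). If \<open>d\<close> and all \<open>k j\<close> are at least
  \<open>2\<close>, integer arithmetic shows that this is possible only if the exponent of \<open>z\<close> in \<open>e\<close> is negative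
  (\<open>basis_expos_shift_negative\<close>). So \<open>D\<close> lowers the degree in \<open>z\<close>. Consequently \<open>D y\<^sub>j = 0\<close> for \<open>j \<ge> 2\<close>,
  the function \<open>D z\<close> depends on \<open>y\<^sub>2, \<dots>, y\<^sub>m\<close> only, and the top coefficient of
  \<open>D y\<^sub>1 = P'(z) * D z / M\<close> shows that \<open>M\<close> divides \<open>D z\<close>. Thus \<open>D\<close> is a multiple of the canonical
  derivation (\<open>lnd_eq_multiple_of_delta\<close>), whose kernel is the Makar-Limanov invariant.

  An automorphism \<open>\<psi>\<close> of the coordinate ring conjugates the canonical derivation into a multiple of
  itself. Hence it preserves the kernel, and it takes \<open>M\<close> to a divisor of \<open>M\<close> because \<open>M\<close> generates the
  ideal of those values of the canonical derivation that lie in its kernel (\<open>aut_M_divides_M\<close>). So \<open>\<psi> y\<^sub>j\<close>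
  divides a monomial and is a monomial itself; as the same holds for the inverse of \<open>\<psi>\<close>, it has degree
  \<open>1\<close> (\<open>aut_coord_y\<close>). The resulting permutation of the \<open>y\<^sub>j\<close> is trivial for the action of a
  multiplicative group, since that group is divisible (\<open>Gm_subgroup_coord_y\<close>).
\<close>

section \<open>Laurent polynomials and their leading exponents\<close>

type_synonym exponent = "nat \<Rightarrow>\<^sub>0 int"
type_synonym 'k laurent = "exponent \<Rightarrow>\<^sub>0 'k"

abbreviation lmon :: "exponent \<Rightarrow> 'k::zero \<Rightarrow> 'k laurent" where
  "lmon \<equiv> Poly_Mapping.single"

abbreviation coef :: "'k::zero laurent \<Rightarrow> exponent \<Rightarrow> 'k" where
  "coef \<equiv> Poly_Mapping.lookup"

abbreviation expo :: "exponent \<Rightarrow> nat \<Rightarrow> int" where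
  "expo \<equiv> Poly_Mapping.lookup"

abbreviation unit_expo :: "nat \<Rightarrow> exponent" where
  "unit_expo i \<equiv> Poly_Mapping.single i 1"

text \<open>
  The library rewrites \<open>single 0 c\<close> to a number, for keys of any type. That is wanted for constant
  Laurent polynomials, but not for the exponents of powers of the variable of index \<open>0\<close>.
\<close>

declare single_one [simp del] single_of_nat [simp del] single_of_int [simp del]
  single_numeral [simp del]

lemma lmon_0_1 [simp]: "lmon 0 1 = (1 :: 'k::zero_neq_one laurent)"
  by (rule single_one)

lemma single_eq_single_iff: "Poly_Mapping.single i a = Poly_Mapping.single i b \<longleftrightarrow> a = b"
  by (metis lookup_single_eq)

lemma lmon_nonzero: "c \<noteq> 0 \<Longrightarrow> lmon u c \<noteq> 0"
  by (metis lookup_single_eq lookup_zero)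

lemma laurent_eq_sum_mono: "p = (\<Sum>u\<in>Poly_Mapping.keys p. lmon u (coef p u))"
proof (rule poly_mapping_eqI)
  fix w
  have "coef (\<Sum>u\<in>Poly_Mapping.keys p. lmon u (coef p u)) w
      = (\<Sum>u\<in>Poly_Mapping.keys p. if u = w then coef p u else 0)"
    by (simp add: lookup_sum lookup_single when_def)
  also have "\<dots> = coef p w"
    by (simp add: in_keys_iff)
  finally show "coef p w = coef (\<Sum>u\<in>Poly_Mapping.keys p. lmon u (coef p u)) w" ..
qed

lemma laurent_induct [case_names mono add]:
  assumes "\<And>u c. Q (lmon u c)" and "\<And>p q. Q p \<Longrightarrow> Q q \<Longrightarrow> Q (p + q)"
  shows "Q (p :: 'k::comm_monoid_add laurent)"
proof -
  have "Q (\<Sum>u\<in>U. lmon u (coef p u))" if "finite U" for U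
    using that
  proof (induction U rule: finite_induct)
    case empty
    show ?case using assms(1)[of 0 0] by simp
  next
    case (insert u U)
    then show ?case using assms by simp
  qed
  then show ?thesis by (metis laurent_eq_sum_mono finite_keys)
qed

lemma coef_mono_mult:
  fixes q :: "'k::comm_ring_1 laurent"
  shows "coef (lmon u c * q) w = c * coef q (w - u)"
proof (induction q rule: laurent_induct)
  case (mono v b)
  show ?case by (auto simp: mult_single lookup_single when_def algebra_simps)
next
  case (add p q)
  then show ?case by (simp add: distrib_left lookup_add)
qed

lemma coef_mult:
  fixes p q :: "'k::comm_ring_1 laurent"
  shows "coef (p * q) w = (\<Sum>u\<in>Poly_Mapping.keys p. coef p u * coef q (w - u))"
proof -
  have "p * q = (\<Sum>u\<in>Poly_Mapping.keys p. lmon u (coef p u) * q)"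
    by (metis laurent_eq_sum_mono sum_distrib_right)
  then show ?thesis by (simp add: lookup_sum coef_mono_mult)
qed

text \<open>
  This is how the product of leading (or of trailing) coefficients is computed: the exponents
  \<open>u\<close> and \<open>v\<close> are extremal, so no other pair of exponents can add up to \<open>u + v\<close>.
\<close>

lemma coef_mult_unique:
  fixes p q :: "'k::comm_ring_1 laurent"
  assumes "\<And>a b. coef p a \<noteq> 0 \<Longrightarrow> coef q b \<noteq> 0 \<Longrightarrow> a + b = u + v \<Longrightarrow> a = u"
  shows "coef (p * q) (u + v) = coef p u * coef q v"
proof -
  have "coef (p * q) (u + v) = (\<Sum>a\<in>Poly_Mapping.keys p. if a = u then coef p u * coef q v else 0)"
    unfolding coef_mult
  proof (rule sum.cong)
    fix a assume a: "a \<in> Poly_Mapping.keys p"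
    show "coef p a * coef q (u + v - a) = (if a = u then coef p u * coef q v else 0)"
    proof (cases "a = u")
      case False
      then have "coef q (u + v - a) = 0"
        using assms[of a "u + v - a"] a by (auto simp: in_keys_iff)
      then show ?thesis using False by simp
    qed simp
  qed simp
  then show ?thesis by (simp add: in_keys_iff)
qed

text \<open>
  The leading exponent of a nonzero Laurent polynomial is its largest one. Working with upper
  bounds of the exponents instead, and with the coefficient at the bound, treats zero and sums with
  cancelling leading terms without case distinctions.
\<close>

definition expo_bound :: "'k::zero laurent \<Rightarrow> exponent \<Rightarrow> bool" where
  "expo_bound p u \<longleftrightarrow> (\<forall>w. coef p w \<noteq> 0 \<longrightarrow> w \<le> u)"

lemma expo_bound_zero [simp]: "expo_bound 0 u"
  by (simp add: expo_bound_def)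

lemma expo_bound_mono: "u \<le> w \<Longrightarrow> expo_bound (lmon u c) w"
  by (auto simp: expo_bound_def lookup_single when_def split: if_splits)

lemma expo_bound_add: "expo_bound p u \<Longrightarrow> expo_bound q u \<Longrightarrow> expo_bound (p + q) u"
  for p q :: "'k::comm_ring_1 laurent"
  unfolding expo_bound_def by (auto simp: lookup_add) (metis add.left_neutral)

lemma expo_bound_sum:
  "(\<And>i. i \<in> I \<Longrightarrow> expo_bound (f i) u) \<Longrightarrow> expo_bound (\<Sum>i\<in>I. f i) u"
  for f :: "'i \<Rightarrow> 'k::comm_ring_1 laurent"
  by (induction I rule: infinite_finite_induct) (auto intro: expo_bound_add)

lemma expo_bound_weaken: "expo_bound p u \<Longrightarrow> u \<le> w \<Longrightarrow> expo_bound p w"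
  unfolding expo_bound_def by (meson order_trans)

lemma expo_bound_coef_zero: "expo_bound p u \<Longrightarrow> u < w \<Longrightarrow> coef p w = 0"
  unfolding expo_bound_def by (meson leD)

lemma expo_bound_mult:
  fixes p q :: "'k::comm_ring_1 laurent"
  assumes "expo_bound p u" and "expo_bound q v"
  shows "expo_bound (p * q) (u + v)"
  unfolding expo_bound_def
proof (intro allI impI)
  fix w assume "coef (p * q) w \<noteq> 0"
  then obtain a b where "w = a + b" "a \<in> Poly_Mapping.keys p" "b \<in> Poly_Mapping.keys q"
    using keys_mult[of p q] by (auto simp: in_keys_iff)
  then show "w \<le> u + v"
    using assms by (auto simp: expo_bound_def in_keys_iff intro: add_mono)
qed

lemma coef_mult_top:
  fixes p q :: "'k::comm_ring_1 laurent"
  assumes "expo_bound p u" and "expo_bound q v"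
  shows "coef (p * q) (u + v) = coef p u * coef q v"
proof (rule coef_mult_unique)
  fix a b assume "coef p a \<noteq> 0" "coef q b \<noteq> 0" and eq: "a + b = u + v"
  then have "a \<le> u" "b \<le> v" using assms by (auto simp: expo_bound_def)
  then show "a = u" using eq by (metis add_less_le_mono less_irrefl order_le_less)
qed

text \<open>
  The largest and the smallest exponent of a product are the sums of those of the factors, so
  they cannot coincide unless both factors have a single exponent.
\<close>

lemma mono_eq_mult_imp_mono:
  fixes p q :: "'k::field laurent"
  assumes pq: "p * q = lmon u c" and c: "c \<noteq> 0"
  shows "\<exists>v a. a \<noteq> 0 \<and> p = lmon v a"
proof -
  have "p \<noteq> 0" "q \<noteq> 0"
    using pq c by (metis mult_zero_left mult_zero_right lookup_single_eq lookup_zero)+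
  then have ne: "Poly_Mapping.keys p \<noteq> {}" "Poly_Mapping.keys q \<noteq> {}" by auto
  define A a B b where "A = Max (Poly_Mapping.keys p)" and "a = Min (Poly_Mapping.keys p)"
    and "B = Max (Poly_Mapping.keys q)" and "b = Min (Poly_Mapping.keys q)"
  have mem: "A \<in> Poly_Mapping.keys p" "a \<in> Poly_Mapping.keys p"
      "B \<in> Poly_Mapping.keys q" "b \<in> Poly_Mapping.keys q"
    unfolding A_def a_def B_def b_def using ne by auto
  have bds: "a \<le> w" "w \<le> A" if "coef p w \<noteq> 0" for w
    using that unfolding A_def a_def by (auto simp: in_keys_iff)
  have bds': "b \<le> w" "w \<le> B" if "coef q w \<noteq> 0" for w
    using that unfolding B_def b_def by (auto simp: in_keys_iff)
  have "coef (p * q) (A + B) = coef p A * coef q B"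
    by (rule coef_mult_top) (use bds bds' in \<open>auto simp: expo_bound_def\<close>)
  then have 1: "A + B = u"
    using mem unfolding pq by (auto simp: lookup_single when_def in_keys_iff split: if_splits)
  have "coef (p * q) (a + b) = coef p a * coef q b"
  proof (rule coef_mult_unique)
    fix x y assume xy: "coef p x \<noteq> 0" "coef q y \<noteq> 0" and eq: "x + y = a + b"
    then have "a \<le> x" "b \<le> y" using bds bds' by auto
    then show "x = a" using eq by (metis add_less_le_mono less_irrefl order_le_less)
  qed
  then have 2: "a + b = u"
    using mem unfolding pq by (auto simp: lookup_single when_def in_keys_iff split: if_splits)
  have "a \<le> A" "b \<le> B" using bds bds' mem by (auto simp: in_keys_iff)
  with 1 2 have "A = a" by (metis add_less_le_mono less_irrefl order_le_less)
  then have "coef p w \<noteq> 0 \<longleftrightarrow> w = A" for w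
    using bds[of w] mem by (auto simp: in_keys_iff)
  then have "p = lmon A (coef p A)"
    by (intro poly_mapping_eqI) (metis lookup_single_eq lookup_single_not_eq)
  then show ?thesis using mem by (metis in_keys_iff)
qed

lemma single_0_mono:
  assumes "a \<le> b"
  shows "Poly_Mapping.single 0 a \<le> (Poly_Mapping.single 0 b :: exponent)"
proof -
  have "(0::exponent) \<le> Poly_Mapping.single 0 (b - a)"
    using assms by transfer (auto simp: less_fun_def when_def fun_eq_iff intro!: exI[of _ 0])
  then show ?thesis by (simp add: single_diff)
qed

text \<open>
  The exponent of the variable of index \<open>0\<close> is the most significant one for the lexicographic
  order, so bounds of exponents bound the degree in that variable.
\<close>

lemma expo_le_imp_le_0: "u \<le> w \<Longrightarrow> expo u 0 \<le> expo w 0"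
proof (transfer, unfold less_fun_def, elim disjE)
  fix f g :: "nat \<Rightarrow> int"
  assume "\<exists>k. f k < g k \<and> (\<forall>k'<k. f k' = g k')"
  then show "f 0 \<le> g 0" by (metis gr0I order.strict_implies_order order_refl)
qed auto

section \<open>Evaluation on a torus\<close>

definition eval_expo :: "(nat \<Rightarrow> 'k::field) \<Rightarrow> exponent \<Rightarrow> 'k" where
  "eval_expo t u = (\<Prod>i\<in>Poly_Mapping.keys u. t i powi expo u i)"

definition eval_laurent :: "(nat \<Rightarrow> 'k::field) \<Rightarrow> 'k laurent \<Rightarrow> 'k" where
  "eval_laurent t p = (\<Sum>u\<in>Poly_Mapping.keys p. coef p u * eval_expo t u)"

lemma eval_expo_superset:
  assumes "finite J" and "Poly_Mapping.keys u \<subseteq> J"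
  shows "eval_expo t u = (\<Prod>i\<in>J. t i powi expo u i)"
  unfolding eval_expo_def
  by (rule prod.mono_neutral_left) (use assms in \<open>auto simp: in_keys_iff\<close>)

lemma eval_expo_0 [simp]: "eval_expo t 0 = 1"
  by (simp add: eval_expo_def)

lemma eval_expo_single [simp]: "eval_expo t (Poly_Mapping.single i n) = t i powi n"
  by (simp add: eval_expo_def)

lemma eval_expo_add:
  assumes "\<And>i. t i \<noteq> 0"
  shows "eval_expo t (u + v) = eval_expo t u * eval_expo t v"
proof -
  let ?J = "Poly_Mapping.keys u \<union> Poly_Mapping.keys v"
  have "eval_expo t w = (\<Prod>i\<in>?J. t i powi expo w i)" if "w \<in> {u, v, u + v}" for w
    by (rule eval_expo_superset) (use that keys_add[of u v] in auto)
  then show ?thesis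
    by (simp add: lookup_add power_int_add assms prod.distrib)
qed

lemma eval_expo_mult_point: "eval_expo (\<lambda>i. s i * t i) u = eval_expo s u * eval_expo t u"
  by (simp add: eval_expo_def power_int_mult_distrib prod.distrib)

lemma eval_laurent_superset:
  assumes "finite U" and "Poly_Mapping.keys p \<subseteq> U"
  shows "eval_laurent t p = (\<Sum>u\<in>U. coef p u * eval_expo t u)"
  unfolding eval_laurent_def
  by (rule sum.mono_neutral_left) (use assms in \<open>auto simp: in_keys_iff\<close>)

lemma eval_laurent_mono [simp]: "eval_laurent t (lmon u c) = c * eval_expo t u"
  by (cases "c = 0") (simp_all add: eval_laurent_def)

lemma eval_laurent_0 [simp]: "eval_laurent t 0 = 0"
  by (simp add: eval_laurent_def)

lemma eval_laurent_add: "eval_laurent t (p + q) = eval_laurent t p + eval_laurent t q"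
  unfolding eval_laurent_def
  by (subst setsum_keys_plus_distrib) (auto simp: distrib_right)

lemma eval_laurent_sum: "eval_laurent t (\<Sum>i\<in>I. f i) = (\<Sum>i\<in>I. eval_laurent t (f i))"
  by (induction I rule: infinite_finite_induct)
    (simp_all add: eval_laurent_add)

lemma eval_laurent_mult:
  assumes "\<And>i. t i \<noteq> 0"
  shows "eval_laurent t (p * q) = eval_laurent t p * eval_laurent t q"
proof (induction p rule: laurent_induct)
  case (mono u c)
  show ?case
    by (induction q rule: laurent_induct)
      (simp_all add: mult_single eval_expo_add assms distrib_left eval_laurent_add)
next
  case (add p p')
  then show ?case by (simp add: distrib_right eval_laurent_add)
qed

lemma power_int_2_inject:
  assumes "(2::'k::field_char_0) powi a = 2 powi b"
  shows "a = b"
proof -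
  have *: "b \<le> a" if eq: "(2::'k) powi a = 2 powi b" for a b :: int
  proof (rule ccontr)
    assume "\<not> b \<le> a"
    then have "(2::'k) powi b = 2 powi a * 2 ^ nat (b - a)"
      by (subst power_int_add[symmetric, of _ _ "int (nat (b - a))", unfolded power_int_of_nat]) auto
    then have "(2::'k) ^ nat (b - a) = 1" using eq by simp
    then have "of_nat (2 ^ nat (b - a)) = (of_nat 1 :: 'k)" by simp
    then have "2 ^ nat (b - a) = (1::nat)" unfolding of_nat_eq_iff .
    then show False using \<open>\<not> b \<le> a\<close> by simp
  qed
  show ?thesis using *[OF assms] *[OF assms[symmetric]] by simp
qed

text \<open>
  Different monomials are different characters of a torus, and characters are linearly
  independent (Dedekind): multiplying by a point at which two of the occurring characters differ
  and subtracting a multiple of the original relation gives a shorter relation.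
\<close>

lemma eval_laurent_eq_0_imp_eq_0:
  fixes p :: "'k::field_char_0 laurent"
  assumes "\<And>t. (\<forall>i. t i \<noteq> 0) \<Longrightarrow> eval_laurent t p = 0"
  shows "p = 0"
  using assms
proof (induction "card (Poly_Mapping.keys p)" arbitrary: p rule: less_induct)
  case less
  show ?case
  proof (rule ccontr)
    assume "p \<noteq> 0"
    then have "Poly_Mapping.keys p \<noteq> {}" by auto
    then obtain u where u: "u \<in> Poly_Mapping.keys p" by blast
    show False
    proof (cases "Poly_Mapping.keys p = {u}")
      case True
      have "eval_laurent (\<lambda>_. 1) p = coef p u" by (simp add: eval_laurent_def True eval_expo_def)
      then show False using less.prems[of "\<lambda>_. 1"] u by (auto simp: in_keys_iff)
    next
      case False
      then obtain w where w: "w \<in> Poly_Mapping.keys p" "w \<noteq> u" using u by blast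
      then obtain i where i: "expo w i \<noteq> expo u i" by (metis poly_mapping_eqI)
      define s :: "nat \<Rightarrow> 'k" where "s j = (if j = i then 2 else 1)" for j
      have s_nz: "s j \<noteq> 0" for j by (simp add: s_def)
      have eval_s: "eval_expo s v = 2 powi expo v i" for v
      proof -
        have "eval_expo s v = (\<Prod>j\<in>Poly_Mapping.keys v. if j = i then 2 powi expo v i else 1)"
          unfolding eval_expo_def by (rule prod.cong) (auto simp: s_def)
        then show ?thesis by (simp add: in_keys_iff)
      qed
      define p' where "p' = Poly_Mapping.mapp (\<lambda>v a. (eval_expo s v - eval_expo s u) * a) p"
      have coef_p': "coef p' v = (eval_expo s v - eval_expo s u) * coef p v" for v
        by (simp add: p'_def lookup_mapp when_def in_keys_iff)
      have sub: "Poly_Mapping.keys p' \<subseteq> Poly_Mapping.keys p" "u \<notin> Poly_Mapping.keys p'"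
        by (auto simp: in_keys_iff coef_p')
      have "p' = 0"
      proof (rule less.hyps)
        show "card (Poly_Mapping.keys p') < card (Poly_Mapping.keys p)"
          using sub u by (intro psubset_card_mono) auto
        fix t :: "nat \<Rightarrow> 'k" assume t: "\<forall>j. t j \<noteq> 0"
        have "eval_laurent t p'
            = (\<Sum>v\<in>Poly_Mapping.keys p. (eval_expo s v - eval_expo s u) * coef p v * eval_expo t v)"
          by (subst eval_laurent_superset[OF _ sub(1)]) (simp_all add: coef_p')
        also have "\<dots> = (\<Sum>v\<in>Poly_Mapping.keys p. coef p v * eval_expo (\<lambda>j. s j * t j) v
             - eval_expo s u * (coef p v * eval_expo t v))"
          by (rule sum.cong) (auto simp: eval_expo_mult_point algebra_simps)
        also have "\<dots> = eval_laurent (\<lambda>j. s j * t j) p - eval_expo s u * eval_laurent t p"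
          unfolding eval_laurent_def by (simp add: sum_subtractf sum_distrib_left)
        also have "\<dots> = 0" using less.prems t s_nz by simp
        finally show "eval_laurent t p' = 0" .
      qed
      then have "eval_expo s w = eval_expo s u"
        using coef_p'[of w] w by (simp add: in_keys_iff)
      then show False using power_int_2_inject i by (auto simp: eval_s)
    qed
  qed
qed

section \<open>Monomial multiples of the derivative in one variable\<close>

text \<open>
  This is \<open>M \<partial>/\<partial>z\<close>, where \<open>z\<close> is the variable of index \<open>0\<close> and \<open>M\<close> the monomial of exponent \<open>s\<close>.
\<close>

definition zderiv :: "exponent \<Rightarrow> 'k::comm_ring_1 laurent \<Rightarrow> 'k laurent" where
  "zderiv s p = (\<Sum>u\<in>Poly_Mapping.keys p. lmon (u + s - unit_expo 0) (of_int (expo u 0) * coef p u))"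

lemma coef_zderiv:
  "coef (zderiv s p) w = of_int (expo (w - s + unit_expo 0) 0) * coef p (w - s + unit_expo 0)"
proof -
  have "u + s - unit_expo 0 = w \<longleftrightarrow> u = w - s + unit_expo 0" for u
    by (auto simp: algebra_simps)
  then have "coef (zderiv s p) w = (\<Sum>u\<in>Poly_Mapping.keys p.
      if u = w - s + unit_expo 0 then of_int (expo u 0) * coef p u else 0)"
    by (simp add: zderiv_def lookup_sum lookup_single when_def)
  then show ?thesis by (simp add: in_keys_iff)
qed

lemma zderiv_add: "zderiv s (p + q) = zderiv s p + zderiv s q"
  by (rule poly_mapping_eqI) (simp add: coef_zderiv lookup_add distrib_left)

lemma zderiv_mono: "zderiv s (lmon u c) = lmon (u + s - unit_expo 0) (of_int (expo u 0) * c)"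
  by (cases "c = 0") (simp_all add: zderiv_def)

lemma zderiv_mult: "zderiv s (p * q) = zderiv s p * q + p * zderiv s q"
proof (induction p rule: laurent_induct)
  case (mono u c)
  show ?case
  proof (induction q rule: laurent_induct)
    case (mono v b)
    show ?case
      by (simp add: zderiv_mono mult_single lookup_add distrib_right single_add[symmetric]
          algebra_simps)
  next
    case (add q q')
    then show ?case by (simp add: zderiv_add distrib_left)
  qed
next
  case (add p p')
  then show ?case by (simp add: zderiv_add distrib_right)
qed

lemma zderiv_const [simp]: "zderiv s (lmon 0 c) = 0"
  by (simp add: zderiv_mono)

lemma zderiv_sum: "zderiv s (\<Sum>i\<in>I. f i) = (\<Sum>i\<in>I. zderiv s (f i))"
  using zderiv_const[of s 0]
  by (induction I rule: infinite_finite_induct) (simp_all add: zderiv_add)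

lemma zderiv_eq_0_imp: "zderiv s p = 0 \<Longrightarrow> coef p u \<noteq> 0 \<Longrightarrow> expo u 0 = 0"
  for p :: "'k::field_char_0 laurent"
  using coef_zderiv[of s p "u + s - unit_expo 0"] by simp

section \<open>Rings of polynomial functions\<close>

lemma poly_function_monomial: "poly_function J (\<lambda>x. c * (\<Prod>i\<in>J. x i ^ \<alpha> i))"
  unfolding poly_function_def by (rule exI[of _ "{\<alpha>}"], rule exI[of _ "\<lambda>_. c"]) simp

lemma poly_function_const: "poly_function J (\<lambda>x. c)"
  using poly_function_monomial[of J c "\<lambda>_. 0"] by simp

lemma poly_function_add:
  assumes "poly_function J F" and "poly_function J G"
  shows "poly_function J (\<lambda>x. F x + G x)"
proof -
  obtain S c where S: "finite S" "F = (\<lambda>x. \<Sum>\<alpha>\<in>S. c \<alpha> * (\<Prod>i\<in>J. x i ^ \<alpha> i))"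
    using assms(1) unfolding poly_function_def by blast
  obtain T b where T: "finite T" "G = (\<lambda>x. \<Sum>\<alpha>\<in>T. b \<alpha> * (\<Prod>i\<in>J. x i ^ \<alpha> i))"
    using assms(2) unfolding poly_function_def by blast
  let ?c = "\<lambda>\<alpha>. (if \<alpha> \<in> S then c \<alpha> else 0) + (if \<alpha> \<in> T then b \<alpha> else 0)"
  have "(\<Sum>\<alpha>\<in>S. c \<alpha> * (\<Prod>i\<in>J. x i ^ \<alpha> i)) + (\<Sum>\<alpha>\<in>T. b \<alpha> * (\<Prod>i\<in>J. x i ^ \<alpha> i))
      = (\<Sum>\<alpha>\<in>S \<union> T. ?c \<alpha> * (\<Prod>i\<in>J. x i ^ \<alpha> i))" for x :: "nat \<Rightarrow> 'a"
  proof -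
    have "(\<Sum>\<alpha>\<in>S. c \<alpha> * (\<Prod>i\<in>J. x i ^ \<alpha> i))
        = (\<Sum>\<alpha>\<in>S \<union> T. (if \<alpha> \<in> S then c \<alpha> else 0) * (\<Prod>i\<in>J. x i ^ \<alpha> i))"
      by (rule sum.mono_neutral_cong_left) (use S T in auto)
    moreover have "(\<Sum>\<alpha>\<in>T. b \<alpha> * (\<Prod>i\<in>J. x i ^ \<alpha> i))
        = (\<Sum>\<alpha>\<in>S \<union> T. (if \<alpha> \<in> T then b \<alpha> else 0) * (\<Prod>i\<in>J. x i ^ \<alpha> i))"
      by (rule sum.mono_neutral_cong_left) (use S T in auto)
    ultimately show ?thesis by (simp add: distrib_right sum.distrib)
  qed
  then show ?thesis
    unfolding poly_function_def S(2) T(2) using S(1) T(1)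
    by (intro exI[of _ "S \<union> T"] exI[of _ ?c]) auto
qed

lemma poly_function_sum:
  "(\<And>a. a \<in> I \<Longrightarrow> poly_function J (F a)) \<Longrightarrow> poly_function J (\<lambda>x. \<Sum>a\<in>I. F a x)"
  by (induction I rule: infinite_finite_induct)
    (simp_all add: poly_function_const poly_function_add)

lemma prod_power_Suc:
  fixes x :: "nat \<Rightarrow> 'k::comm_monoid_mult"
  assumes "finite J" "j \<in> J"
  shows "x j * (\<Prod>i\<in>J. x i ^ b i) = (\<Prod>i\<in>J. x i ^ (b(j := Suc (b j))) i)"
proof -
  have "(\<Prod>i\<in>J - {j}. x i ^ (b(j := Suc (b j))) i) = (\<Prod>i\<in>J - {j}. x i ^ b i)"
    by (rule prod.cong) auto
  then show ?thesis using assms by (simp add: prod.remove[of J j] mult.assoc)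
qed

lemma poly_function_coord_mult:
  assumes "finite J" and "j \<in> J" and "poly_function J F"
  shows "poly_function J (\<lambda>x. x j * F x)"
proof -
  obtain S c where S: "finite S" "F = (\<lambda>x. \<Sum>\<alpha>\<in>S. c \<alpha> * (\<Prod>i\<in>J. x i ^ \<alpha> i))"
    using assms(3) unfolding poly_function_def by blast
  have "x j * F x = (\<Sum>\<alpha>\<in>S. c \<alpha> * (\<Prod>i\<in>J. x i ^ (\<alpha>(j := Suc (\<alpha> j))) i))" for x
    unfolding S(2) sum_distrib_left
    by (simp only: prod_power_Suc[OF assms(1,2), symmetric] mult.left_commute)
  then show ?thesis
    by (simp only:) (intro poly_function_sum poly_function_monomial)
qed

text \<open>
  Polynomial functions are built from constants by sums and by products with a single coordinate.
  Products with coordinates rather than arbitrary products keep the induction steps elementary: the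
  other factor is a generator.
\<close>

lemma poly_function_induct [consumes 2, case_names const add coord_mult]:
  assumes "poly_function J F" and fin: "finite J"
    and const: "\<And>c. Q (\<lambda>x. c)"
    and add: "\<And>F G. poly_function J F \<Longrightarrow> poly_function J G \<Longrightarrow> Q F \<Longrightarrow> Q G \<Longrightarrow> Q (\<lambda>x. F x + G x)"
    and coord: "\<And>j F. j \<in> J \<Longrightarrow> poly_function J F \<Longrightarrow> Q F \<Longrightarrow> Q (\<lambda>x. x j * F x)"
  shows "Q F"
proof -
  let ?Q = "\<lambda>F. poly_function J F \<and> Q F"
  have coord': "?Q (\<lambda>x. x j * F x)" if "j \<in> J" "?Q F" for j F
    using that coord poly_function_coord_mult[OF fin] by blast
  have pow: "?Q (\<lambda>x. x j ^ n * F x)" if "j \<in> J" "?Q F" for j n F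
  proof (induction n)
    case 0
    then show ?case using that by simp
  next
    case (Suc n)
    from coord'[OF that(1) this] show ?case by (simp add: mult.assoc)
  qed
  have mon: "?Q (\<lambda>x. c * (\<Prod>i\<in>J'. x i ^ \<alpha> i))" if "finite J'" "J' \<subseteq> J" for J' c \<alpha>
    using that
  proof (induction J' rule: finite_induct)
    case empty
    then show ?case by (simp add: const poly_function_const)
  next
    case (insert j J')
    then have "?Q (\<lambda>x. x j ^ \<alpha> j * (c * (\<Prod>i\<in>J'. x i ^ \<alpha> i)))"
      by (intro pow) auto
    then show ?case using insert by (simp add: mult.left_commute)
  qed
  have sum: "?Q (\<lambda>x. \<Sum>a\<in>I. G a x)"
    if "finite I" "\<And>a. a \<in> I \<Longrightarrow> ?Q (G a)" for I and G :: "(nat \<Rightarrow> nat) \<Rightarrow> _"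
    using that
    by (induction I rule: finite_induct)
      (simp_all add: const add poly_function_const poly_function_add)
  obtain S c where S: "finite S" "F = (\<lambda>x. \<Sum>\<alpha>\<in>S. c \<alpha> * (\<Prod>i\<in>J. x i ^ \<alpha> i))"
    using assms(1) unfolding poly_function_def by blast
  have "?Q F"
    unfolding S(2) by (rule sum[OF S(1)]) (rule mon[OF fin order_refl])
  then show ?thesis ..
qed

lemma poly_function_mult:
  assumes "poly_function J F" and "poly_function J G" and fin: "finite J"
  shows "poly_function J (\<lambda>x. F x * G x)"
proof -
  have scale: "poly_function J (\<lambda>x. c * G x)" for c
    using assms(2) fin
  proof (induction G rule: poly_function_induct)
    case (const b)
    show ?case by (rule poly_function_const)
  next
    case (add F G)
    then show ?case by (simp add: distrib_left poly_function_add)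
  next
    case (coord_mult j F)
    then have "poly_function J (\<lambda>x. x j * (c * F x))"
      by (intro poly_function_coord_mult fin)
    then show ?case by (simp add: mult.left_commute)
  qed
  show ?thesis using assms(1) fin
  proof (induction F rule: poly_function_induct)
    case (const b)
    show ?case by (rule scale)
  next
    case (add F G)
    then show ?case by (simp add: distrib_right poly_function_add)
  next
    case (coord_mult j F)
    then have "poly_function J (\<lambda>x. x j * (F x * G x))"
      by (intro poly_function_coord_mult fin)
    then show ?case by (simp add: mult.assoc)
  qed
qed

lemma poly_functions_on_const: "(\<lambda>x\<in>Y. c) \<in> poly_functions_on Y J"
  unfolding poly_functions_on_def using poly_function_const by blast

lemma poly_functions_on_add:
  assumes "f \<in> poly_functions_on Y J" and "g \<in> poly_functions_on Y J"
  shows "(\<lambda>x\<in>Y. f x + g x) \<in> poly_functions_on Y J"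
proof -
  obtain F G where "poly_function J F" "f = restrict F Y" "poly_function J G" "g = restrict G Y"
    using assms unfolding poly_functions_on_def by blast
  then have "poly_function J (\<lambda>x. F x + G x)" "(\<lambda>x\<in>Y. f x + g x) = restrict (\<lambda>x. F x + G x) Y"
    by (auto simp: poly_function_add restrict_def)
  then show ?thesis unfolding poly_functions_on_def by blast
qed

lemma poly_functions_on_mult:
  assumes "finite J" "f \<in> poly_functions_on Y J" and "g \<in> poly_functions_on Y J"
  shows "(\<lambda>x\<in>Y. f x * g x) \<in> poly_functions_on Y J"
proof -
  obtain F G where "poly_function J F" "f = restrict F Y" "poly_function J G" "g = restrict G Y"
    using assms unfolding poly_functions_on_def by blast
  then have "poly_function J (\<lambda>x. F x * G x)" "(\<lambda>x\<in>Y. f x * g x) = restrict (\<lambda>x. F x * G x) Y"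
    using assms(1) by (auto simp: poly_function_mult restrict_def)
  then show ?thesis unfolding poly_functions_on_def by blast
qed

lemma poly_functions_on_coord:
  assumes "finite J" and "j \<in> J"
  shows "coord Y j \<in> poly_functions_on Y J"
  unfolding poly_functions_on_def coord_def
  using poly_function_coord_mult[OF assms poly_function_const[of J 1]] by auto

lemma poly_functions_on_extensional: "f \<in> poly_functions_on Y J \<Longrightarrow> f = restrict f Y"
  unfolding poly_functions_on_def by auto

lemma poly_functions_on_sum:
  "(\<And>a. a \<in> I \<Longrightarrow> f a \<in> poly_functions_on Y J) \<Longrightarrow> (\<lambda>x\<in>Y. \<Sum>a\<in>I. f a x) \<in> poly_functions_on Y J"
proof (induction I rule: infinite_finite_induct)
  case (insert a I)
  then have "(\<lambda>x\<in>Y. f a x + (\<lambda>x\<in>Y. \<Sum>a\<in>I. f a x) x) \<in> poly_functions_on Y J"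
    by (intro poly_functions_on_add) blast+
  moreover have "(\<lambda>x\<in>Y. f a x + (\<lambda>x\<in>Y. \<Sum>a\<in>I. f a x) x) = (\<lambda>x\<in>Y. \<Sum>a\<in>insert a I. f a x)"
    by (rule restrict_ext) (use insert.hyps in simp)
  ultimately show ?case by (simp only:)
qed (simp_all add: poly_functions_on_const)

lemma poly_functions_on_monomial:
  "(\<lambda>x\<in>Y. c * (\<Prod>i\<in>J. x i ^ \<alpha> i)) \<in> poly_functions_on Y J"
  unfolding poly_functions_on_def using poly_function_monomial by blast

lemma poly_functions_on_mono:
  assumes "finite J'" and "J \<subseteq> J'"
  shows "poly_functions_on Y J \<subseteq> poly_functions_on Y J'"
proof -
  have "poly_function J' F" if "poly_function J F" for F
    using that finite_subset[OF assms(2,1)]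
  proof (induction F rule: poly_function_induct)
    case (coord_mult j F)
    then show ?case using assms by (intro poly_function_coord_mult) auto
  qed (auto intro: poly_function_const poly_function_add)
  then show ?thesis unfolding poly_functions_on_def by blast
qed

lemma poly_functions_on_induct [consumes 2, case_names const add coord_mult]:
  assumes "f \<in> poly_functions_on Y J" and "finite J"
    and "\<And>c. Q (\<lambda>x\<in>Y. c)"
    and "\<And>f g. f \<in> poly_functions_on Y J \<Longrightarrow> g \<in> poly_functions_on Y J \<Longrightarrow> Q f \<Longrightarrow> Q g
        \<Longrightarrow> Q (\<lambda>x\<in>Y. f x + g x)"
    and "\<And>j f. j \<in> J \<Longrightarrow> f \<in> poly_functions_on Y J \<Longrightarrow> Q f \<Longrightarrow> Q (\<lambda>x\<in>Y. coord Y j x * f x)"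
  shows "Q f"
proof -
  obtain F where F: "poly_function J F" "f = restrict F Y"
    using assms(1) unfolding poly_functions_on_def by blast
  from F(1) assms(2) have "Q (restrict F Y)"
  proof (induction F rule: poly_function_induct)
    case (const c)
    show ?case by (rule assms(3))
  next
    case (add F G)
    have "Q (\<lambda>x\<in>Y. restrict F Y x + restrict G Y x)"
      using add unfolding poly_functions_on_def by (intro assms(4)[unfolded poly_functions_on_def]) blast+
    moreover have "(\<lambda>x\<in>Y. restrict F Y x + restrict G Y x) = (\<lambda>x\<in>Y. F x + G x)"
      by (rule restrict_ext) simp
    ultimately show ?case by (simp only:)
  next
    case (coord_mult j F)
    have "Q (\<lambda>x\<in>Y. coord Y j x * restrict F Y x)"
      using coord_mult unfolding poly_functions_on_def
      by (intro assms(5)[unfolded poly_functions_on_def]) blast+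
    moreover have "(\<lambda>x\<in>Y. coord Y j x * restrict F Y x) = (\<lambda>x\<in>Y. x j * F x)"
      by (rule restrict_ext) (simp add: coord_def)
    ultimately show ?case by (simp only:)
  qed
  then show ?thesis using F(2) by simp
qed

lemma coord_ring_simps:
  "carrier (coord_ring m Y) = poly_functions_on Y {0..m}"
  "f \<otimes>\<^bsub>coord_ring m Y\<^esub> g = (\<lambda>x\<in>Y. f x * g x)"
  "f \<oplus>\<^bsub>coord_ring m Y\<^esub> g = (\<lambda>x\<in>Y. f x + g x)"
  "c \<odot>\<^bsub>coord_ring m Y\<^esub> f = (\<lambda>x\<in>Y. c * f x)"
  "\<one>\<^bsub>coord_ring m Y\<^esub> = (\<lambda>x\<in>Y. 1)"
  "\<zero>\<^bsub>coord_ring m Y\<^esub> = (\<lambda>x\<in>Y. 0)"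
  by (simp_all add: coord_ring_def)

section \<open>The Laurent expansion of a regular function\<close>

lemma expo_bound_power:
  fixes p :: "'k::comm_ring_1 laurent"
  assumes "expo_bound p u"
  shows "expo_bound (p ^ n) (frag_cmul (int n) u) \<and> coef (p ^ n) (frag_cmul (int n) u) = coef p u ^ n"
proof (induction n)
  case 0
  then show ?case using expo_bound_mono[of 0 0 "1::'k"] by simp
next
  case (Suc n)
  have *: "frag_cmul (int (Suc n)) u = u + frag_cmul (int n) u"
    by (simp add: frag_cmul_distrib)
  show ?case unfolding * power_Suc using Suc assms
    by (simp add: expo_bound_mult coef_mult_top)
qed

lemma eval_laurent_power:
  assumes "\<And>i. t i \<noteq> 0"
  shows "eval_laurent t (p ^ n) = eval_laurent t p ^ n"
proof (induction n)
  case 0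
  then show ?case using eval_laurent_mono[of t 0 1] by simp
qed (simp add: eval_laurent_mult assms)

locale danielewski =
  fixes m :: nat and k :: "nat \<Rightarrow> nat" and P :: "'k::field_char_0 poly"
  assumes m_ge_1: "1 \<le> m"
    and k_ge_2: "j \<in> {2..m} \<Longrightarrow> 2 \<le> k j"
    and degree_ge_2: "2 \<le> degree P"
begin

abbreviation Y :: "(nat \<Rightarrow> 'k) set" where
  "Y \<equiv> hypersurface m k P"

abbreviation A :: "('k, (nat \<Rightarrow> 'k) \<Rightarrow> 'k) module" where
  "A \<equiv> coord_ring m Y"

abbreviation monomial_M :: "(nat \<Rightarrow> 'k) \<Rightarrow> 'k" where
  "monomial_M x \<equiv> \<Prod>j\<in>{2..m}. x j ^ k j"

lemma lead_coeff_nonzero: "lead_coeff P \<noteq> 0"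
  using degree_ge_2 by auto

lemma Y_eq: "x \<in> Y \<Longrightarrow> x 1 * monomial_M x = poly P (x 0)"
  by (simp add: hypersurface_def)

lemma carrier_const [simp]: "(\<lambda>x\<in>Y. c) \<in> carrier A"
  by (simp add: coord_ring_simps poly_functions_on_const)

lemma carrier_coord [simp]: "j \<le> m \<Longrightarrow> coord Y j \<in> carrier A"
  by (simp add: coord_ring_simps poly_functions_on_coord)

lemma carrier_add [simp]: "f \<in> carrier A \<Longrightarrow> g \<in> carrier A \<Longrightarrow> f \<oplus>\<^bsub>A\<^esub> g \<in> carrier A"
  by (simp add: coord_ring_simps poly_functions_on_add)

lemma carrier_mult [simp]: "f \<in> carrier A \<Longrightarrow> g \<in> carrier A \<Longrightarrow> f \<otimes>\<^bsub>A\<^esub> g \<in> carrier A"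
  by (simp add: coord_ring_simps poly_functions_on_mult)

lemma smult_eq_mult: "c \<odot>\<^bsub>A\<^esub> f = (\<lambda>x\<in>Y. c) \<otimes>\<^bsub>A\<^esub> f"
  by (auto simp: coord_ring_simps restrict_def)

lemma carrier_smult [simp]: "f \<in> carrier A \<Longrightarrow> c \<odot>\<^bsub>A\<^esub> f \<in> carrier A"
  by (simp add: smult_eq_mult)

lemma carrier_zero [simp]: "\<zero>\<^bsub>A\<^esub> \<in> carrier A"
  by (simp add: coord_ring_simps poly_functions_on_const)

lemma carrier_poly_functions: "J \<subseteq> {0..m} \<Longrightarrow> f \<in> poly_functions_on Y J \<Longrightarrow> f \<in> carrier A"
  using poly_functions_on_mono[of "{0..m}" J Y] by (auto simp: coord_ring_simps)

lemma carrier_eqI: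
  assumes "f \<in> carrier A" and "g \<in> carrier A" and "\<And>x. x \<in> Y \<Longrightarrow> f x = g x"
  shows "f = g"
proof -
  have "f = restrict f Y" "g = restrict g Y"
    using assms poly_functions_on_extensional by (auto simp: coord_ring_simps)
  then show ?thesis using assms(3) by (metis restrict_ext)
qed

lemma carrier_induct [consumes 1, case_names const add coord_mult]:
  assumes "f \<in> carrier A"
    and "\<And>c. Q (\<lambda>x\<in>Y. c)"
    and "\<And>f g. f \<in> carrier A \<Longrightarrow> g \<in> carrier A \<Longrightarrow> Q f \<Longrightarrow> Q g \<Longrightarrow> Q (f \<oplus>\<^bsub>A\<^esub> g)"
    and "\<And>j f. j \<le> m \<Longrightarrow> f \<in> carrier A \<Longrightarrow> Q f \<Longrightarrow> Q (coord Y j \<otimes>\<^bsub>A\<^esub> f)"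
  shows "Q f"
  using assms unfolding coord_ring_simps
  by (intro poly_functions_on_induct[of f Y "{0..m}" Q]) auto

text \<open>
  The exponent of the monomial \<open>M = y\<^sub>2\<^bsup>k 2\<^esup> \<cdots> y\<^sub>m\<^bsup>k m\<^esup>\<close>.
\<close>

definition kap :: exponent where
  "kap = (\<Sum>j\<in>{2..m}. Poly_Mapping.single j (int (k j)))"

lemma expo_kap: "expo kap j = (if j \<in> {2..m} then int (k j) else 0)"
  by (auto simp: kap_def lookup_sum lookup_single when_def)

lemma eval_expo_kap: "eval_expo t kap = monomial_M t"
proof -
  have "eval_expo t kap = (\<Prod>j\<in>{2..m}. t j powi expo kap j)"
    by (rule eval_expo_superset) (auto simp: in_keys_iff expo_kap split: if_splits)
  then show ?thesis by (simp add: expo_kap)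
qed

text \<open>
  On the open subset of \<open>Y\<close> on which all \<open>y\<^sub>j\<close> with \<open>j \<ge> 2\<close> are nonzero, the equation can be solved
  for \<open>y\<^sub>1\<close>, so that \<open>z, y\<^sub>2, \<dots>, y\<^sub>m\<close> are free coordinates. The index \<open>1\<close> carries the
  dependent coordinate, so \<open>t\<close> is read at the other indices only.
\<close>

definition torus_point :: "(nat \<Rightarrow> 'k) \<Rightarrow> nat \<Rightarrow> 'k" where
  "torus_point t = (\<lambda>i\<in>{0..m}. if i = 1 then poly P (t 0) / monomial_M t else t i)"

lemma torus_point_in_Y:
  assumes "\<And>i. t i \<noteq> 0"
  shows "torus_point t \<in> Y"
proof -
  have "monomial_M (torus_point t) = monomial_M t"
    by (rule prod.cong) (auto simp: torus_point_def)
  moreover have "monomial_M t \<noteq> 0" using assms by simp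
  ultimately show ?thesis using m_ge_1
    by (simp add: hypersurface_def affine_space_def) (simp add: torus_point_def)
qed

text \<open>
  The Laurent polynomial to which the coordinate of index \<open>j\<close> expands: \<open>P(z) / M\<close> for \<open>y\<^sub>1\<close>, a variable
  for the others. Variables keep their index, so the variable of index \<open>1\<close> never occurs.
\<close>

definition gen :: "nat \<Rightarrow> 'k laurent" where
  "gen j = (if j = 1 then (\<Sum>i\<le>degree P. lmon (Poly_Mapping.single 0 (int i) - kap) (coeff P i))
     else lmon (unit_expo j) 1)"

lemma eval_laurent_gen:
  assumes t: "\<And>i. t i \<noteq> 0" and "j \<le> m"
  shows "eval_laurent t (gen j) = torus_point t j"
proof (cases "j = 1")
  case True
  have M: "monomial_M t \<noteq> 0" using t by simp
  have "eval_expo t (Poly_Mapping.single 0 (int i) - kap) * monomial_M t = t 0 ^ i" for i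
    using eval_expo_add[of t "Poly_Mapping.single 0 (int i) - kap" kap, OF t]
    by (simp add: eval_expo_kap)
  then have "eval_expo t (Poly_Mapping.single 0 (int i) - kap) = t 0 ^ i / monomial_M t" for i
    using M by (simp add: field_simps)
  then show ?thesis using True \<open>j \<le> m\<close>
    by (simp add: gen_def torus_point_def eval_laurent_sum poly_altdef sum_divide_distrib)
next
  case False
  then show ?thesis using \<open>j \<le> m\<close> by (simp add: gen_def torus_point_def)
qed

text \<open>
  A regular function may have values off the torus that its expansion does not see; that these are
  determined by the expansion is proved only with the normal form.
\<close>

definition expands_to :: "((nat \<Rightarrow> 'k) \<Rightarrow> 'k) \<Rightarrow> 'k laurent \<Rightarrow> bool" where
  "expands_to f p \<longleftrightarrow> (\<forall>t. (\<forall>i. t i \<noteq> 0) \<longrightarrow> f (torus_point t) = eval_laurent t p)"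

definition laurent_of :: "((nat \<Rightarrow> 'k) \<Rightarrow> 'k) \<Rightarrow> 'k laurent" where
  "laurent_of f = (THE p. expands_to f p)"

lemma expands_to_unique: "expands_to f p \<Longrightarrow> expands_to f q \<Longrightarrow> p = q"
proof -
  assume *: "expands_to f p" "expands_to f q"
  have "p + lmon 0 (-1) * q = 0"
  proof (rule eval_laurent_eq_0_imp_eq_0)
    fix t :: "nat \<Rightarrow> 'k" assume "\<forall>i. t i \<noteq> 0"
    then show "eval_laurent t (p + lmon 0 (-1) * q) = 0"
      using * by (simp add: expands_to_def eval_laurent_add eval_laurent_mult)
  qed
  then show "p = q"
    by (simp add: single_uminus add_eq_0_iff2)
qed

lemma laurent_of_eqI: "expands_to f p \<Longrightarrow> laurent_of f = p"
  unfolding laurent_of_def by (rule the_equality) (auto intro: expands_to_unique)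

lemma expands_to_const: "expands_to (\<lambda>x\<in>Y. c) (lmon 0 c)"
  by (simp add: expands_to_def torus_point_in_Y)

lemma expands_to_coord: "j \<le> m \<Longrightarrow> expands_to (coord Y j) (gen j)"
  by (simp add: expands_to_def torus_point_in_Y coord_def eval_laurent_gen)

lemma expands_to_add: "expands_to f p \<Longrightarrow> expands_to g q \<Longrightarrow> expands_to (f \<oplus>\<^bsub>A\<^esub> g) (p + q)"
  by (simp add: expands_to_def torus_point_in_Y coord_ring_simps eval_laurent_add)

lemma expands_to_mult: "expands_to f p \<Longrightarrow> expands_to g q \<Longrightarrow> expands_to (f \<otimes>\<^bsub>A\<^esub> g) (p * q)"
  by (simp add: expands_to_def torus_point_in_Y coord_ring_simps eval_laurent_mult)

lemma expands_to_laurent_of: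
  assumes "f \<in> carrier A"
  shows "expands_to f (laurent_of f)"
proof -
  from assms have "\<exists>p. expands_to f p"
    by (induction f rule: carrier_induct)
      (blast intro: expands_to_const expands_to_add expands_to_mult expands_to_coord)+
  then show ?thesis using laurent_of_eqI by auto
qed

lemma laurent_of_const [simp]: "laurent_of (\<lambda>x\<in>Y. c) = lmon 0 c"
  by (rule laurent_of_eqI) (rule expands_to_const)

lemma laurent_of_zero [simp]: "laurent_of \<zero>\<^bsub>A\<^esub> = 0"
  by (simp add: coord_ring_simps)

lemma laurent_of_coord [simp]: "j \<le> m \<Longrightarrow> laurent_of (coord Y j) = gen j"
  by (rule laurent_of_eqI) (rule expands_to_coord)

lemma laurent_of_add [simp]:
  "f \<in> carrier A \<Longrightarrow> g \<in> carrier A \<Longrightarrow> laurent_of (f \<oplus>\<^bsub>A\<^esub> g) = laurent_of f + laurent_of g"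
  by (intro laurent_of_eqI expands_to_add expands_to_laurent_of)

lemma laurent_of_mult [simp]:
  "f \<in> carrier A \<Longrightarrow> g \<in> carrier A \<Longrightarrow> laurent_of (f \<otimes>\<^bsub>A\<^esub> g) = laurent_of f * laurent_of g"
  by (intro laurent_of_eqI expands_to_mult expands_to_laurent_of)

lemma laurent_of_smult [simp]: "f \<in> carrier A \<Longrightarrow> laurent_of (c \<odot>\<^bsub>A\<^esub> f) = lmon 0 c * laurent_of f"
  by (simp add: smult_eq_mult)

lemma laurent_of_sum:
  "(\<And>a. a \<in> I \<Longrightarrow> f a \<in> carrier A)
    \<Longrightarrow> laurent_of (\<lambda>x\<in>Y. \<Sum>a\<in>I. f a x) = (\<Sum>a\<in>I. laurent_of (f a))"
proof (induction I rule: infinite_finite_induct)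
  case (insert a I)
  have "(\<lambda>x\<in>Y. \<Sum>a\<in>I. f a x) \<in> carrier A"
    unfolding coord_ring_simps
    by (rule poly_functions_on_sum) (use insert.prems in \<open>auto simp: coord_ring_simps\<close>)
  moreover have "(\<lambda>x\<in>Y. \<Sum>a\<in>insert a I. f a x) = f a \<oplus>\<^bsub>A\<^esub> (\<lambda>x\<in>Y. \<Sum>a\<in>I. f a x)"
    using insert.hyps by (auto simp: coord_ring_simps)
  ultimately have "laurent_of (\<lambda>x\<in>Y. \<Sum>a\<in>insert a I. f a x)
      = laurent_of (f a) + laurent_of (\<lambda>x\<in>Y. \<Sum>a\<in>I. f a x)"
    using insert.prems by (simp only: laurent_of_add insertI1)
  moreover have "laurent_of (\<lambda>x\<in>Y. \<Sum>a\<in>I. f a x) = (\<Sum>a\<in>I. laurent_of (f a))"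
    by (rule insert.IH) (use insert.prems in blast)
  ultimately show ?case unfolding sum.insert[OF insert.hyps] by argo
qed simp_all

section \<open>A basis with distinct leading exponents\<close>

text \<open>
  The leading exponents of nonzero regular functions. With \<open>d\<close> the degree of \<open>P\<close> and
  \<open>u 0 = q * d + i\<close>, where \<open>i < d\<close>, the function with leading exponent \<open>u\<close> is
  \<open>y\<^sub>1\<^bsup>q\<^esup> z\<^bsup>i\<^esup> y\<^bsup>b\<^esup>\<close>: the factor \<open>y\<^sub>1\<^bsup>q\<^esup>\<close> contributes \<open>q * d\<close> to the exponent of \<open>z\<close> and
  \<open>- q * k j\<close> to that of \<open>y\<^sub>j\<close>, so \<open>b j = u j + k j * q\<close> has to be nonnegative.
\<close>

definition basis_expos :: "exponent set" where
  "basis_expos = {u. Poly_Mapping.keys u \<subseteq> {0..m} - {1} \<and> 0 \<le> expo u 0 \<and>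
     (\<forall>j\<in>{2..m}. 0 \<le> expo u j + int (k j) * (expo u 0 div int (degree P)))}"

definition basis_fun :: "exponent \<Rightarrow> (nat \<Rightarrow> 'k) \<Rightarrow> 'k" where
  "basis_fun u = (let q = expo u 0 div int (degree P) in
     (\<lambda>x\<in>Y. x 1 ^ nat q * x 0 ^ nat (expo u 0 mod int (degree P)) *
       (\<Prod>j\<in>{2..m}. x j ^ nat (expo u j + int (k j) * q))))"

text \<open>
  The leading exponents of the generators.
\<close>

definition gen_expo :: "nat \<Rightarrow> exponent" where
  "gen_expo j = (if j = 1 then Poly_Mapping.single 0 (int (degree P)) - kap else unit_expo j)"

lemma expo_bound_gen: "expo_bound (gen j) (gen_expo j)"
proof (cases "j = 1")
  case True
  then show ?thesis
    by (auto simp: gen_def gen_expo_def intro!: expo_bound_sum expo_bound_mono single_0_mono)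
next
  case False
  then show ?thesis by (simp add: gen_def gen_expo_def expo_bound_mono)
qed

lemma coef_gen: "coef (gen j) (gen_expo j) = (if j = 1 then lead_coeff P else 1)"
  by (simp add: gen_def gen_expo_def lookup_sum lookup_single when_def single_eq_single_iff)

lemma expo_div_mod:
  "int (degree P) * (expo u 0 div int (degree P)) + expo u 0 mod int (degree P) = expo u 0"
  by (rule mult_div_mod_eq)

lemma basis_fun_carrier: "basis_fun u \<in> carrier A"
proof -
  have "finite {0..m}" by simp
  note mult = poly_function_mult[OF _ _ this]
  have pow: "poly_function {0..m} (\<lambda>x::nat\<Rightarrow>'k. x j ^ n)" if "j \<le> m" for j n
  proof (induction n)
    case 0
    then show ?case by (simp add: poly_function_const)
  next
    case (Suc n)
    then show ?case using that by (simp add: poly_function_coord_mult)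
  qed
  have prod: "poly_function {0..m} (\<lambda>x::nat\<Rightarrow>'k. \<Prod>j\<in>J. x j ^ n j)"
    if "finite J" "J \<subseteq> {0..m}" for J n
    using that
    by (induction J rule: finite_induct) (auto intro!: poly_function_const mult pow)
  show ?thesis
    unfolding basis_fun_def Let_def coord_ring_simps poly_functions_on_def
    using m_ge_1 by (auto intro!: mult pow prod)
qed

lemma laurent_of_basis_fun:
  assumes u: "u \<in> basis_expos"
  defines "q \<equiv> nat (expo u 0 div int (degree P))"
  shows "laurent_of (basis_fun u) = gen 1 ^ q * lmon (u - frag_cmul (int q) (gen_expo 1)) 1"
proof (rule laurent_of_eqI, unfold expands_to_def, intro allI impI)
  fix t :: "nat \<Rightarrow> 'k" assume "\<forall>i. t i \<noteq> 0"
  then have t: "\<And>i. t i \<noteq> 0" by blast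
  let ?d = "int (degree P)"
  let ?w = "u - frag_cmul (int q) (gen_expo 1)"
  have q: "int q = expo u 0 div ?d"
    using u degree_ge_2 by (simp add: q_def basis_expos_def pos_imp_zdiv_nonneg_iff)
  have w0: "expo ?w 0 = expo u 0 mod ?d"
    using expo_div_mod[of u] by (simp add: lookup_minus gen_expo_def expo_kap q algebra_simps)
  have wj: "expo ?w j = expo u j + int (k j) * int q" if "j \<in> {2..m}" for j
    using that by (simp add: lookup_minus gen_expo_def expo_kap lookup_single)
  have keys: "Poly_Mapping.keys ?w \<subseteq> insert 0 {2..m}"
  proof
    fix j assume "j \<in> Poly_Mapping.keys ?w"
    then have "expo ?w j \<noteq> 0" by (simp add: in_keys_iff)
    then have "expo u j \<noteq> 0 \<or> expo (gen_expo 1) j \<noteq> 0" by (auto simp: lookup_minus)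
    moreover have "j \<in> insert 0 {2..m}" if "expo u j \<noteq> 0"
    proof -
      have "j \<in> {0..m} - {1}"
        using that u unfolding basis_expos_def by (auto simp flip: in_keys_iff)
      then show ?thesis by (cases "j = 0") auto
    qed
    ultimately show "j \<in> insert 0 {2..m}"
      by (auto simp: gen_expo_def lookup_minus expo_kap lookup_single when_def split: if_splits)
  qed
  have powi: "x powi n = x ^ nat n" if "0 \<le> n" for x :: 'k and n
    using that by (simp add: power_int_def)
  have "eval_expo t ?w = (\<Prod>j\<in>insert 0 {2..m}. t j powi expo ?w j)"
    by (rule eval_expo_superset) (use keys in auto)
  also have "\<dots> = t 0 ^ nat (expo u 0 mod ?d)
      * (\<Prod>j\<in>{2..m}. t j ^ nat (expo u j + int (k j) * int q))"
  proof -
    have "t 0 powi expo ?w 0 = t 0 ^ nat (expo u 0 mod ?d)"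
      unfolding w0 by (rule powi) (use degree_ge_2 in simp)
    moreover have "(\<Prod>j\<in>{2..m}. t j powi expo ?w j)
        = (\<Prod>j\<in>{2..m}. t j ^ nat (expo u j + int (k j) * int q))"
      by (rule prod.cong) (use u wj powi in \<open>auto simp: basis_expos_def q\<close>)
    ultimately show ?thesis by simp
  qed
  also have "\<dots> = torus_point t 0 ^ nat (expo u 0 mod ?d)
      * (\<Prod>j\<in>{2..m}. torus_point t j ^ nat (expo u j + int (k j) * int q))"
    by (intro arg_cong2[of _ _ _ _ "(*)"] prod.cong) (auto simp: torus_point_def)
  finally have "eval_laurent t (gen 1 ^ q * lmon ?w 1) = torus_point t 1 ^ q * \<dots>"
    by (simp add: eval_laurent_mult t eval_laurent_power eval_laurent_gen m_ge_1 del: One_nat_def)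
  then show "basis_fun u (torus_point t) = eval_laurent t (gen 1 ^ q * lmon ?w 1)"
    unfolding basis_fun_def Let_def q[symmetric] by (simp add: torus_point_in_Y t mult.assoc)
qed

lemma basis_fun_leading:
  assumes "u \<in> basis_expos"
  shows "expo_bound (laurent_of (basis_fun u)) u" and "coef (laurent_of (basis_fun u)) u \<noteq> 0"
proof -
  define q where "q = nat (expo u 0 div int (degree P))"
  let ?v = "frag_cmul (int q) (gen_expo 1)"
  have L: "laurent_of (basis_fun u) = gen 1 ^ q * lmon (u - ?v) 1"
    unfolding q_def by (rule laurent_of_basis_fun) fact
  have p: "expo_bound (gen 1 ^ q) ?v" "coef (gen 1 ^ q) ?v = lead_coeff P ^ q"
    using expo_bound_power[OF expo_bound_gen[of 1], of q] coef_gen[of 1] by auto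
  have m: "expo_bound (lmon (u - ?v) (1::'k)) (u - ?v)" by (simp add: expo_bound_mono)
  show "expo_bound (laurent_of (basis_fun u)) u"
    using expo_bound_mult[OF p(1) m] by (simp add: L)
  show "coef (laurent_of (basis_fun u)) u \<noteq> 0"
  proof -
    have "coef (laurent_of (basis_fun u)) (?v + (u - ?v)) = lead_coeff P ^ q * 1"
      unfolding L coef_mult_top[OF p(1) m] p(2) by simp
    then show ?thesis using lead_coeff_nonzero by simp
  qed
qed

text \<open>
  Below the degree of \<open>P\<close> the variable \<open>y\<^sub>1\<close> does not occur in the basis functions.
\<close>

lemma basis_fun_small:
  assumes "u \<in> basis_expos" and "expo u 0 < int (degree P)"
  shows "laurent_of (basis_fun u) = lmon u 1"
proof -
  have "expo u 0 div int (degree P) = 0"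
    using assms by (simp add: basis_expos_def)
  then show ?thesis using laurent_of_basis_fun[OF assms(1)] by simp
qed

section \<open>Normal forms of regular functions\<close>

definition in_span :: "((nat \<Rightarrow> 'k) \<Rightarrow> 'k) \<Rightarrow> bool" where
  "in_span f \<longleftrightarrow> (\<exists>U a. finite U \<and> U \<subseteq> basis_expos \<and> (\<forall>x\<in>Y. f x = (\<Sum>u\<in>U. a u * basis_fun u x)))"

lemma in_span_cong: "in_span f \<Longrightarrow> (\<And>x. x \<in> Y \<Longrightarrow> g x = f x) \<Longrightarrow> in_span g"
  unfolding in_span_def by simp

lemma in_span_add:
  assumes "in_span f" and "in_span g"
  shows "in_span (\<lambda>x. f x + g x)"
proof -
  obtain U a where U: "finite U" "U \<subseteq> basis_expos"
      "\<And>x. x \<in> Y \<Longrightarrow> f x = (\<Sum>u\<in>U. a u * basis_fun u x)"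
    using assms(1) unfolding in_span_def by blast
  obtain V b where V: "finite V" "V \<subseteq> basis_expos"
      "\<And>x. x \<in> Y \<Longrightarrow> g x = (\<Sum>u\<in>V. b u * basis_fun u x)"
    using assms(2) unfolding in_span_def by blast
  let ?c = "\<lambda>u. (if u \<in> U then a u else 0) + (if u \<in> V then b u else 0)"
  have "f x + g x = (\<Sum>u\<in>U \<union> V. ?c u * basis_fun u x)" if "x \<in> Y" for x
  proof -
    have "(\<Sum>u\<in>U. a u * basis_fun u x) = (\<Sum>u\<in>U \<union> V. (if u \<in> U then a u else 0) * basis_fun u x)"
      by (rule sum.mono_neutral_cong_left) (use U V in auto)
    moreover have "(\<Sum>u\<in>V. b u * basis_fun u x)
        = (\<Sum>u\<in>U \<union> V. (if u \<in> V then b u else 0) * basis_fun u x)"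
      by (rule sum.mono_neutral_cong_left) (use U V in auto)
    ultimately show ?thesis using U(3) V(3) that by (simp add: distrib_right sum.distrib)
  qed
  then show ?thesis
    unfolding in_span_def using U(1,2) V(1,2)
    by (intro exI[of _ "U \<union> V"] exI[of _ ?c]) auto
qed

lemma in_span_scale: "in_span f \<Longrightarrow> in_span (\<lambda>x. c * f x)"
proof -
  assume "in_span f"
  then obtain U a where U: "finite U" "U \<subseteq> basis_expos"
      "\<And>x. x \<in> Y \<Longrightarrow> f x = (\<Sum>u\<in>U. a u * basis_fun u x)"
    unfolding in_span_def by blast
  have "c * f x = (\<Sum>u\<in>U. (c * a u) * basis_fun u x)" if "x \<in> Y" for x
    unfolding U(3)[OF that] sum_distrib_left by (simp only: mult.assoc)
  then show ?thesis
    unfolding in_span_def using U(1,2) by (intro exI[of _ U] exI[of _ "\<lambda>u. c * a u"]) simp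
qed

lemma in_span_sum:
  "(\<And>a. a \<in> I \<Longrightarrow> in_span (f a)) \<Longrightarrow> in_span (\<lambda>x. \<Sum>a\<in>I. f a x)"
proof (induction I rule: infinite_finite_induct)
  case (insert a I)
  then show ?case by (simp add: in_span_add)
qed (auto simp: in_span_def intro!: exI[of _ "{}"])

definition normal_monomial :: "nat \<Rightarrow> nat \<Rightarrow> (nat \<Rightarrow> nat) \<Rightarrow> (nat \<Rightarrow> 'k) \<Rightarrow> 'k" where
  "normal_monomial q i b x = x 1 ^ q * x 0 ^ i * (\<Prod>j\<in>{2..m}. x j ^ b j)"

lemma in_span_normal_monomial:
  assumes i: "i < degree P"
  shows "in_span (normal_monomial q i b)"
proof -
  let ?d = "int (degree P)"
  define u :: exponent where "u = Poly_Mapping.single 0 (?d * int q + int i)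
    + (\<Sum>j\<in>{2..m}. Poly_Mapping.single j (int (b j) - int (k j) * int q))"
  have expo_u: "expo u j = (if j = 0 then ?d * int q + int i
      else if j \<in> {2..m} then int (b j) - int (k j) * int q else 0)" for j
    by (auto simp: u_def lookup_add lookup_sum lookup_single when_def)
  have q: "expo u 0 div ?d = int q" and r: "expo u 0 mod ?d = int i"
    using i by (simp_all add: expo_u)
  have "\<forall>j\<in>{2..m}. 0 \<le> expo u j + int (k j) * int q"
    by (simp add: expo_u)
  moreover have "Poly_Mapping.keys u \<subseteq> {0..m} - {1}"
    by (auto simp: expo_u in_keys_iff split: if_splits)
  moreover have "0 \<le> expo u 0" by (simp add: expo_u)
  ultimately have "u \<in> basis_expos"
    by (simp add: basis_expos_def q)
  moreover have "normal_monomial q i b x = basis_fun u x" if "x \<in> Y" for x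
    unfolding basis_fun_def Let_def q r using that by (simp add: normal_monomial_def expo_u)
  ultimately show ?thesis
    unfolding in_span_def by (intro exI[of _ "{u}"] exI[of _ "\<lambda>_. 1"]) auto
qed

lemma basis_fun_normal_monomial:
  "\<exists>q i b. i < degree P \<and> (\<forall>x\<in>Y. basis_fun u x = normal_monomial q i b x)"
proof -
  have "nat (expo u 0 mod int (degree P)) < degree P"
    using degree_ge_2 by (simp add: nat_less_iff)
  moreover have "basis_fun u x = normal_monomial (nat (expo u 0 div int (degree P)))
      (nat (expo u 0 mod int (degree P)))
      (\<lambda>j. nat (expo u j + int (k j) * (expo u 0 div int (degree P)))) x" if "x \<in> Y" for x
    using that by (simp add: basis_fun_def Let_def normal_monomial_def)
  ultimately show ?thesis by blast
qed

text \<open>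
  The only product of a coordinate and a normal monomial that is not again normal is one that contains
  \<open>z\<^bsup>d\<^esup>\<close>. The equation of \<open>Y\<close>, solved for its top power of \<open>z\<close>, rewrites it as a combination of normal
  monomials.
\<close>

lemma in_span_coord_mult_normal_monomial:
  assumes i: "i < degree P" and j: "j \<le> m"
  shows "in_span (\<lambda>x. x j * normal_monomial q i b x)"
proof -
  consider "j = 1" | "j \<in> {2..m}" | "j = 0" "Suc i < degree P" | "j = 0" "Suc i = degree P"
    using i j by force
  then show ?thesis
  proof cases
    case 1
    show ?thesis
      by (rule in_span_cong[OF in_span_normal_monomial[OF i, of "Suc q" b]])
        (simp add: 1 normal_monomial_def)
  next
    case 2
    show ?thesis
      by (rule in_span_cong[OF in_span_normal_monomial[OF i, of q "b(j := Suc (b j))"]])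
        (unfold normal_monomial_def prod_power_Suc[OF finite_atLeastAtMost 2, symmetric],
          simp add: mult_ac)
  next
    case 3
    show ?thesis
      by (rule in_span_cong[OF in_span_normal_monomial[OF 3(2), of q b]])
        (simp add: 3 normal_monomial_def mult_ac)
  next
    case 4
    \<comment> \<open>Here \<open>z * z\<^bsup>i\<^esup>\<close> is the top power of \<open>z\<close> in \<open>P(z)\<close>, and \<open>M\<close> raises the exponents by \<open>k\<close>.\<close>
    let ?g = "\<lambda>x. inverse (lead_coeff P) * (normal_monomial (Suc q) 0 (\<lambda>j. b j + k j) x
      + (\<Sum>l<degree P. (- coeff P l) * normal_monomial q l b x))"
    have "in_span ?g"
      using degree_ge_2
      by (intro in_span_scale in_span_add in_span_sum in_span_normal_monomial) auto
    moreover have "x j * normal_monomial q i b x = ?g x" if "x \<in> Y" for x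
    proof -
      let ?b = "\<Prod>j\<in>{2..m}. x j ^ b j"
      have "poly P (x 0) = (\<Sum>l<degree P. coeff P l * x 0 ^ l) + lead_coeff P * x 0 ^ degree P"
        unfolding poly_altdef by (simp add: lessThan_Suc_atMost[symmetric])
      then have "lead_coeff P * x 0 ^ degree P
          = x 1 * monomial_M x - (\<Sum>l<degree P. coeff P l * x 0 ^ l)"
        using Y_eq[OF that] by simp
      then have "lead_coeff P * x 0 ^ degree P * (x 1 ^ q * ?b)
          = x 1 * monomial_M x * (x 1 ^ q * ?b) - (\<Sum>l<degree P. coeff P l * x 0 ^ l) * (x 1 ^ q * ?b)"
        by (simp add: left_diff_distrib)
      also have "\<dots> = normal_monomial (Suc q) 0 (\<lambda>j. b j + k j) x
          + (\<Sum>l<degree P. (- coeff P l) * normal_monomial q l b x)"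
        by (simp add: normal_monomial_def power_add prod.distrib sum_distrib_left sum_distrib_right sum_negf mult_ac)
      finally have "lead_coeff P * (x 0 ^ degree P * (x 1 ^ q * ?b)) = \<dots>"
        by (simp only: mult.assoc)
      moreover have "x j * normal_monomial q i b x = x 0 ^ degree P * (x 1 ^ q * ?b)"
        unfolding 4(2)[symmetric] by (simp add: 4(1) normal_monomial_def mult_ac)
      ultimately show ?thesis using lead_coeff_nonzero by (simp add: field_simps)
    qed
    ultimately show ?thesis by (rule in_span_cong)
  qed
qed

lemma in_span_coord_mult:
  assumes "in_span f" and j: "j \<le> m"
  shows "in_span (\<lambda>x. x j * f x)"
proof -
  obtain U a where U: "finite U" "U \<subseteq> basis_expos"
      "\<And>x. x \<in> Y \<Longrightarrow> f x = (\<Sum>u\<in>U. a u * basis_fun u x)"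
    using assms(1) unfolding in_span_def by blast
  have "in_span (\<lambda>x. x j * basis_fun u x)" for u
  proof -
    obtain q i b where i: "i < degree P" and eq: "\<forall>x\<in>Y. basis_fun u x = normal_monomial q i b x"
      using basis_fun_normal_monomial by blast
    show ?thesis
      by (rule in_span_cong[OF in_span_coord_mult_normal_monomial[OF i j, of q b]]) (simp add: eq)
  qed
  then have "in_span (\<lambda>x. a u * (x j * basis_fun u x))" for u
    by (rule in_span_scale)
  then have "in_span (\<lambda>x. \<Sum>u\<in>U. a u * (x j * basis_fun u x))"
    by (rule in_span_sum)
  moreover have "x j * f x = (\<Sum>u\<in>U. a u * (x j * basis_fun u x))" if "x \<in> Y" for x
    unfolding U(3)[OF that] sum_distrib_left by (simp only: mult.left_commute)
  ultimately show ?thesis by (rule in_span_cong)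
qed

lemma carrier_in_span:
  assumes "f \<in> carrier A"
  shows "in_span f"
  using assms
proof (rule carrier_induct)
  fix c
  have "in_span (\<lambda>x. c * normal_monomial 0 0 (\<lambda>_. 0) x)"
    by (rule in_span_scale, rule in_span_normal_monomial) (use degree_ge_2 in simp)
  then show "in_span (\<lambda>x\<in>Y. c)" by (rule in_span_cong) (simp add: normal_monomial_def)
next
  fix f g assume "in_span f" "in_span g"
  then show "in_span (f \<oplus>\<^bsub>A\<^esub> g)"
    by (rule in_span_cong[OF in_span_add]) (simp add: coord_ring_simps)
next
  fix j f assume "in_span f" "j \<le> m"
  then show "in_span (coord Y j \<otimes>\<^bsub>A\<^esub> f)"
    by (rule in_span_cong[OF in_span_coord_mult]) (simp add: coord_ring_simps coord_def)
qed

lemma normal_form: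
  assumes f: "f \<in> carrier A"
  shows "\<exists>U a. finite U \<and> U \<subseteq> basis_expos \<and> (\<forall>u\<in>U. a u \<noteq> 0) \<and>
    f = (\<lambda>x\<in>Y. \<Sum>u\<in>U. a u * basis_fun u x) \<and>
    laurent_of f = (\<Sum>u\<in>U. lmon 0 (a u) * laurent_of (basis_fun u))"
proof -
  obtain V a where V: "finite V" "V \<subseteq> basis_expos"
      "\<And>x. x \<in> Y \<Longrightarrow> f x = (\<Sum>u\<in>V. a u * basis_fun u x)"
    using carrier_in_span[OF f] unfolding in_span_def by blast
  define U where "U = {u \<in> V. a u \<noteq> 0}"
  have "(\<Sum>u\<in>V. a u * basis_fun u x) = (\<Sum>u\<in>U. a u * basis_fun u x)" for x
    by (rule sum.mono_neutral_right) (use V in \<open>auto simp: U_def\<close>)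
  moreover have "f = restrict f Y"
    using f poly_functions_on_extensional by (simp add: coord_ring_simps)
  ultimately have f_eq: "f = (\<lambda>x\<in>Y. \<Sum>u\<in>U. a u * basis_fun u x)"
    using V(3) by (metis (no_types, lifting) restrict_ext)
  have "f = (\<lambda>x\<in>Y. \<Sum>u\<in>U. (a u \<odot>\<^bsub>A\<^esub> basis_fun u) x)"
    unfolding f_eq by (rule restrict_ext) (simp add: coord_ring_simps)
  then have "laurent_of f = (\<Sum>u\<in>U. laurent_of (a u \<odot>\<^bsub>A\<^esub> basis_fun u))"
    by (simp only:) (rule laurent_of_sum, intro carrier_smult basis_fun_carrier)
  also have "\<dots> = (\<Sum>u\<in>U. lmon 0 (a u) * laurent_of (basis_fun u))"
    by (simp add: basis_fun_carrier)
  finally show ?thesis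
    using V f_eq by (intro exI[of _ U] exI[of _ a]) (auto simp: U_def)
qed

text \<open>
  The leading exponents of the basis functions are distinct, so the largest one cannot cancel.
\<close>

lemma normal_form_leading:
  assumes U: "finite U" "U \<subseteq> basis_expos" "\<forall>u\<in>U. a u \<noteq> 0" "U \<noteq> {}"
  defines "p \<equiv> (\<Sum>u\<in>U. lmon 0 (a u) * laurent_of (basis_fun u))"
  shows "expo_bound p (Max U)" and "coef p (Max U) \<noteq> 0"
proof -
  have bd: "expo_bound (lmon 0 (a u) * laurent_of (basis_fun u)) u" if "u \<in> U" for u
    using expo_bound_mult[OF expo_bound_mono[of 0 0 "a u"] basis_fun_leading(1)[of u]] that U(2)
    by auto
  show "expo_bound p (Max U)"
    unfolding p_def by (intro expo_bound_sum expo_bound_weaken[OF bd]) (use U(1) in auto)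
  have "coef p (Max U) = (\<Sum>u\<in>U. if u = Max U then a u * coef (laurent_of (basis_fun u)) u else 0)"
    unfolding p_def lookup_sum
  proof (rule sum.cong)
    fix u assume u: "u \<in> U"
    show "coef (lmon 0 (a u) * laurent_of (basis_fun u)) (Max U)
        = (if u = Max U then a u * coef (laurent_of (basis_fun u)) u else 0)"
    proof (cases "u = Max U")
      case True
      then show ?thesis by (simp add: coef_mono_mult)
    next
      case False
      then have "u < Max U" using u U(1) by (metis Max_ge order_le_less)
      then show ?thesis using expo_bound_coef_zero[OF bd[OF u]] False by simp
    qed
  qed simp
  also have "\<dots> \<noteq> 0"
    using U(1,3) basis_fun_leading(2)[of "Max U"] Max_in[OF U(1,4)] subsetD[OF U(2)] by simp
  finally show "coef p (Max U) \<noteq> 0" .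
qed

text \<open>
  The torus is dense in \<open>Y\<close>. The normal form replaces a geometric argument: a function whose
  expansion vanishes is the empty combination of basis functions.
\<close>

lemma laurent_of_eq_0_imp:
  assumes "f \<in> carrier A" and "laurent_of f = 0"
  shows "f = \<zero>\<^bsub>A\<^esub>"
proof -
  obtain U a where U: "finite U" "U \<subseteq> basis_expos" "\<forall>u\<in>U. a u \<noteq> 0"
    "f = (\<lambda>x\<in>Y. \<Sum>u\<in>U. a u * basis_fun u x)"
    "laurent_of f = (\<Sum>u\<in>U. lmon 0 (a u) * laurent_of (basis_fun u))"
    using normal_form[OF assms(1)] by (elim exE conjE) (rule that)
  have "U = {}" using normal_form_leading(2)[OF U(1-3)] assms(2) U(5) by fastforce
  then show ?thesis using U(4) by (simp add: coord_ring_simps)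
qed

lemma laurent_of_inject:
  assumes f: "f \<in> carrier A" and g: "g \<in> carrier A" and eq: "laurent_of f = laurent_of g"
  shows "f = g"
proof -
  have "laurent_of (f \<oplus>\<^bsub>A\<^esub> ((-1) \<odot>\<^bsub>A\<^esub> g)) = 0"
    using f g eq by (simp add: single_uminus)
  then have zero: "f \<oplus>\<^bsub>A\<^esub> ((-1) \<odot>\<^bsub>A\<^esub> g) = \<zero>\<^bsub>A\<^esub>"
    using f g by (intro laurent_of_eq_0_imp) auto
  show ?thesis
  proof (rule carrier_eqI[OF f g])
    fix x assume "x \<in> Y"
    then show "f x = g x" using fun_cong[OF zero, of x] by (simp add: coord_ring_simps)
  qed
qed

lemma leading_expo_in_basis_expos:
  assumes "f \<in> carrier A" and bd: "expo_bound (laurent_of f) u" and nz: "coef (laurent_of f) u \<noteq> 0"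
  shows "u \<in> basis_expos"
proof -
  obtain U a where U: "finite U" "U \<subseteq> basis_expos" "\<forall>u\<in>U. a u \<noteq> 0"
    "f = (\<lambda>x\<in>Y. \<Sum>u\<in>U. a u * basis_fun u x)"
    "laurent_of f = (\<Sum>u\<in>U. lmon 0 (a u) * laurent_of (basis_fun u))"
    using normal_form[OF assms(1)] by (elim exE conjE) (rule that)
  have "U \<noteq> {}" using nz U(5) by auto
  note lead = normal_form_leading[OF U(1-3) this, folded U(5)]
  have "u = Max U" using bd nz lead unfolding expo_bound_def by (meson order_antisym)
  then show ?thesis using U(2) Max_in[OF U(1) \<open>U \<noteq> {}\<close>] by blast
qed

text \<open>
  If no exponent of \<open>z\<close> reaches the degree of \<open>P\<close> then the normal form does not involve \<open>y\<^sub>1\<close>, and the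
  expansion itself is the normal form. This is how conclusions about a single expansion turn into
  statements about polynomials.
\<close>

lemma small_degree_normal_form:
  assumes f: "f \<in> carrier A"
    and small: "\<And>u. coef (laurent_of f) u \<noteq> 0 \<Longrightarrow> expo u 0 < int (degree P)"
  shows "f = (\<lambda>x\<in>Y. \<Sum>u\<in>Poly_Mapping.keys (laurent_of f). coef (laurent_of f) u * basis_fun u x)"
    and "Poly_Mapping.keys (laurent_of f) \<subseteq> basis_expos"
proof -
  obtain U a where U: "finite U" "U \<subseteq> basis_expos" "\<forall>u\<in>U. a u \<noteq> 0"
    "f = (\<lambda>x\<in>Y. \<Sum>u\<in>U. a u * basis_fun u x)"
    "laurent_of f = (\<Sum>u\<in>U. lmon 0 (a u) * laurent_of (basis_fun u))"
    using normal_form[OF assms(1)] by (elim exE conjE) (rule that)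
  have "expo u 0 < int (degree P)" if "u \<in> U" for u
  proof -
    have "U \<noteq> {}" using that by blast
    then have "expo (Max U) 0 < int (degree P)"
      using normal_form_leading(2)[OF U(1-3)] small U(5) by simp
    moreover have "expo u 0 \<le> expo (Max U) 0"
      using that U(1) by (intro expo_le_imp_le_0) simp
    ultimately show ?thesis by simp
  qed
  then have L: "laurent_of f = (\<Sum>u\<in>U. lmon u (a u))"
    unfolding U(5) by (intro sum.cong) (use U(2) in \<open>auto simp: basis_fun_small mult_single\<close>)
  have coef_f: "coef (laurent_of f) w = (if w \<in> U then a w else 0)" for w
    unfolding L using U(1) by (simp add: lookup_sum lookup_single when_def)
  then have keys: "Poly_Mapping.keys (laurent_of f) = U"
    using U(3) by (auto simp: in_keys_iff split: if_splits)
  show "Poly_Mapping.keys (laurent_of f) \<subseteq> basis_expos" using keys U(2) by simp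
  show "f = (\<lambda>x\<in>Y. \<Sum>u\<in>Poly_Mapping.keys (laurent_of f). coef (laurent_of f) u * basis_fun u x)"
    unfolding keys coef_f by (subst U(4)) (auto intro!: restrict_ext sum.cong)
qed

section \<open>Leading parts of locally nilpotent derivations\<close>

lemma derivation_carrier: "derivation A D \<Longrightarrow> f \<in> carrier A \<Longrightarrow> D f \<in> carrier A"
  unfolding derivation_def by blast

lemma laurent_of_derivation_add:
  assumes "derivation A D" "f \<in> carrier A" "g \<in> carrier A"
  shows "laurent_of (D (f \<oplus>\<^bsub>A\<^esub> g)) = laurent_of (D f) + laurent_of (D g)"
proof -
  have "D (f \<oplus>\<^bsub>A\<^esub> g) = D f \<oplus>\<^bsub>A\<^esub> D g" using assms unfolding derivation_def by blast
  then show ?thesis using assms by (simp add: derivation_carrier)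
qed

lemma laurent_of_derivation_mult:
  assumes "derivation A D" "f \<in> carrier A" "g \<in> carrier A"
  shows "laurent_of (D (f \<otimes>\<^bsub>A\<^esub> g)) = laurent_of (D f) * laurent_of g + laurent_of f * laurent_of (D g)"
proof -
  have "D (f \<otimes>\<^bsub>A\<^esub> g) = (D f \<otimes>\<^bsub>A\<^esub> g) \<oplus>\<^bsub>A\<^esub> (f \<otimes>\<^bsub>A\<^esub> D g)"
    using assms unfolding derivation_def by blast
  then show ?thesis using assms by (simp add: derivation_carrier)
qed

lemma laurent_of_derivation_const:
  assumes D: "derivation A D"
  shows "laurent_of (D (\<lambda>x\<in>Y. c)) = 0"
proof -
  have c_eq: "c \<odot>\<^bsub>A\<^esub> (\<lambda>x\<in>Y. 1) = (\<lambda>x\<in>Y. c)" and one: "(\<lambda>x\<in>Y. 1) \<otimes>\<^bsub>A\<^esub> (\<lambda>x\<in>Y. 1) = (\<lambda>x\<in>Y. 1)"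
    by (auto simp: coord_ring_simps)
  have "laurent_of (D (\<lambda>x\<in>Y. 1)) = laurent_of (D (\<lambda>x\<in>Y. 1)) + laurent_of (D (\<lambda>x\<in>Y. 1))"
    using laurent_of_derivation_mult[OF D carrier_const carrier_const, of 1 1]
    unfolding one by simp
  then have "laurent_of (D (\<lambda>x\<in>Y. 1)) = 0" by simp
  moreover have "D (\<lambda>x\<in>Y. c) = c \<odot>\<^bsub>A\<^esub> D (\<lambda>x\<in>Y. 1)"
    using D unfolding derivation_def c_eq[symmetric] using carrier_const by blast
  ultimately show ?thesis using D by (simp add: derivation_carrier)
qed

lemma laurent_of_monomial:
  "laurent_of (\<lambda>x\<in>Y. \<Prod>j\<in>{2..m}. x j ^ b j)
    = lmon (\<Sum>j\<in>{2..m}. Poly_Mapping.single j (int (b j))) 1"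
proof (rule laurent_of_eqI, unfold expands_to_def, intro allI impI)
  fix t :: "nat \<Rightarrow> 'k" assume t: "\<forall>i. t i \<noteq> 0"
  let ?u = "\<Sum>j\<in>{2..m}. Poly_Mapping.single j (int (b j))"
  have u: "expo ?u i = (if i \<in> {2..m} then int (b i) else 0)" for i
    by (auto simp: lookup_sum lookup_single when_def)
  have "eval_expo t ?u = (\<Prod>j\<in>{2..m}. t j powi expo ?u j)"
    by (rule eval_expo_superset) (auto simp: in_keys_iff u split: if_splits)
  also have "\<dots> = (\<Prod>j\<in>{2..m}. torus_point t j ^ b j)"
    by (rule prod.cong) (auto simp: u torus_point_def)
  finally show "(\<lambda>x\<in>Y. \<Prod>j\<in>{2..m}. x j ^ b j) (torus_point t) = eval_laurent t (lmon ?u 1)"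
    using t by (simp add: torus_point_in_Y)
qed

definition weight :: "(nat \<Rightarrow> 'k) \<Rightarrow> exponent \<Rightarrow> 'k" where
  "weight l u = (\<Sum>i\<in>{0..m} - {1}. of_int (expo u i) * l i)"

lemma weight_0 [simp]: "weight l 0 = 0"
  by (simp add: weight_def)

lemma weight_add: "weight l (u + v) = weight l u + weight l v"
  by (simp add: weight_def lookup_add distrib_right sum.distrib)

lemma weight_single:
  assumes "i \<le> m" "i \<noteq> 1"
  shows "weight l (Poly_Mapping.single i n) = of_int n * l i"
proof -
  have "weight l (Poly_Mapping.single i n) = (\<Sum>j\<in>{0..m} - {1}. if i = j then of_int n * l j else 0)"
    unfolding weight_def by (rule sum.cong) (auto simp: lookup_single)
  then show ?thesis using assms by simp
qed

text \<open>
  On the terms of largest exponent, a derivation \<open>D\<close> that raises exponents by at most \<open>e\<close> acts like the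
  homogeneous derivation that takes the monomial of exponent \<open>u\<close> to \<open>weight l u\<close> times the monomial of
  exponent \<open>u + e\<close>. This predicate says so for one function \<open>f\<close>. As the bound \<open>u\<close> need not be
  attained, the predicate is stable under sums and multiplication by scalars, and by the Leibniz rule
  it is stable under products.
\<close>

definition tracks ::
  "(((nat \<Rightarrow> 'k) \<Rightarrow> 'k) \<Rightarrow> ((nat \<Rightarrow> 'k) \<Rightarrow> 'k)) \<Rightarrow> exponent \<Rightarrow> (nat \<Rightarrow> 'k) \<Rightarrow> exponent \<Rightarrow> ((nat \<Rightarrow> 'k) \<Rightarrow> 'k) \<Rightarrow> bool"
  where
  "tracks D e l u f \<longleftrightarrow> f \<in> carrier A \<and> expo_bound (laurent_of f) u \<and>
     expo_bound (laurent_of (D f)) (u + e) \<and>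
     coef (laurent_of (D f)) (u + e) = weight l u * coef (laurent_of f) u"

lemma tracks_mult:
  assumes D: "derivation A D" and f: "tracks D e l u f" and g: "tracks D e l v g"
  shows "tracks D e l (u + v) (f \<otimes>\<^bsub>A\<^esub> g)"
proof -
  have eqs: "u + v + e = (u + e) + v" "u + v + e = u + (v + e)" by (simp_all add: add_ac)
  note f' = f[unfolded tracks_def] and g' = g[unfolded tracks_def]
  have L: "laurent_of (D (f \<otimes>\<^bsub>A\<^esub> g))
      = laurent_of (D f) * laurent_of g + laurent_of f * laurent_of (D g)"
    using f' g' D by (intro laurent_of_derivation_mult) auto
  have 1: "expo_bound (laurent_of (D f) * laurent_of g) (u + v + e)"
    unfolding eqs(1) using f' g' by (intro expo_bound_mult) auto
  have 2: "expo_bound (laurent_of f * laurent_of (D g)) (u + v + e)"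
    unfolding eqs(2) using f' g' by (intro expo_bound_mult) auto
  have "coef (laurent_of (D f) * laurent_of g) (u + v + e)
      = weight l u * coef (laurent_of f) u * coef (laurent_of g) v"
    unfolding eqs(1) using f' g' by (subst coef_mult_top) auto
  moreover have "coef (laurent_of f * laurent_of (D g)) (u + v + e)
      = weight l v * coef (laurent_of f) u * coef (laurent_of g) v"
    unfolding eqs(2) using f' g' by (subst coef_mult_top) auto
  moreover have "coef (laurent_of f * laurent_of g) (u + v) = coef (laurent_of f) u * coef (laurent_of g) v"
    using f' g' by (intro coef_mult_top) auto
  ultimately show ?thesis
    using f' g' 1 2 unfolding tracks_def L
    by (simp add: expo_bound_mult expo_bound_add lookup_add weight_add algebra_simps)
qed

lemma tracks_add:
  assumes D: "derivation A D" and f: "tracks D e l u f" and g: "tracks D e l u g"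
  shows "tracks D e l u (f \<oplus>\<^bsub>A\<^esub> g)"
  using f g unfolding tracks_def
  by (simp add: laurent_of_derivation_add[OF D] expo_bound_add lookup_add distrib_left)

lemma tracks_const:
  assumes D: "derivation A D"
  shows "tracks D e l 0 (\<lambda>x\<in>Y. c)"
  unfolding tracks_def
  by (simp add: laurent_of_derivation_const[OF D] expo_bound_mono)

lemma tracks_weaken:
  assumes f: "tracks D e l u f" and "u \<le> w"
  shows "tracks D e l w f"
proof (cases "u = w")
  case True
  then show ?thesis using f by simp
next
  case False
  then have "u < w" "u + e < w + e" using assms(2) by auto
  then show ?thesis
    using f expo_bound_coef_zero[of "laurent_of f" u w]
      expo_bound_coef_zero[of "laurent_of (D f)" "u + e" "w + e"]
      expo_bound_weaken[of "laurent_of f" u w] expo_bound_weaken[of "laurent_of (D f)" "u + e" "w + e"]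
    unfolding tracks_def by auto
qed

lemma tracks_smult:
  assumes D: "derivation A D" and f: "tracks D e l u f"
  shows "tracks D e l u (c \<odot>\<^bsub>A\<^esub> f)"
  using tracks_mult[OF D tracks_const[OF D] f, of c] by (simp add: smult_eq_mult)

lemma tracks_sum:
  assumes D: "derivation A D" and "\<And>a. a \<in> I \<Longrightarrow> tracks D e l u (f a)" and "finite I"
  shows "tracks D e l u (\<lambda>x\<in>Y. \<Sum>a\<in>I. f a x)"
proof -
  have zero: "tracks D e l u (\<lambda>x\<in>Y. 0)"
    using laurent_of_derivation_const[OF D] by (simp add: tracks_def)
  from assms(3,2) show ?thesis
  proof (induction I rule: finite_induct)
    case empty
    show ?case using zero by (simp only: sum.empty)
  next
    case (insert a I)
    have "(\<lambda>x\<in>Y. \<Sum>a\<in>insert a I. f a x) = f a \<oplus>\<^bsub>A\<^esub> (\<lambda>x\<in>Y. \<Sum>a\<in>I. f a x)"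
      using insert.hyps by (auto simp: coord_ring_simps)
    moreover have "tracks D e l u (f a)" "tracks D e l u (\<lambda>x\<in>Y. \<Sum>a\<in>I. f a x)"
      using insert.prems insert.IH by blast+
    ultimately show ?case using tracks_add[OF D] by (simp only:)
  qed
qed

lemma tracks_power:
  assumes D: "derivation A D" and f: "tracks D e l u f"
  shows "tracks D e l (frag_cmul (int n) u) (\<lambda>x\<in>Y. f x ^ n)"
proof (induction n)
  case 0
  show ?case using tracks_const[OF D, of e l 1]
    by (simp only: power_0 of_nat_0 frag_cmul_zero)
next
  case (Suc n)
  have "frag_cmul (int (Suc n)) u = u + frag_cmul (int n) u"
    by (simp add: frag_cmul_distrib)
  moreover have "(\<lambda>x\<in>Y. f x ^ Suc n) = f \<otimes>\<^bsub>A\<^esub> (\<lambda>x\<in>Y. f x ^ n)"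
    by (auto simp: coord_ring_simps)
  ultimately show ?case using tracks_mult[OF D f Suc] by (simp only:)
qed

lemma tracks_prod:
  assumes D: "derivation A D" and "finite J" and "\<And>j. j \<in> J \<Longrightarrow> tracks D e l (u j) (f j)"
  shows "tracks D e l (\<Sum>j\<in>J. u j) (\<lambda>x\<in>Y. \<Prod>j\<in>J. f j x)"
  using assms(2,3)
proof (induction J rule: finite_induct)
  case empty
  show ?case using tracks_const[OF D, of e l 1] by (simp only: sum.empty prod.empty)
next
  case (insert j J)
  have "(\<lambda>x\<in>Y. \<Prod>j\<in>insert j J. f j x) = f j \<otimes>\<^bsub>A\<^esub> (\<lambda>x\<in>Y. \<Prod>j\<in>J. f j x)"
    using insert.hyps by (auto simp: coord_ring_simps)
  moreover have "tracks D e l (u j) (f j)" "tracks D e l (\<Sum>j\<in>J. u j) (\<lambda>x\<in>Y. \<Prod>j\<in>J. f j x)"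
    using insert.prems insert.IH by blast+
  ultimately show ?case unfolding sum.insert[OF insert.hyps] using tracks_mult[OF D] by (simp only:)
qed

lemma tracks_monomial:
  assumes D: "derivation A D" and gens: "\<And>j. j \<in> {2..m} \<Longrightarrow> tracks D e l (unit_expo j) (coord Y j)"
  shows "tracks D e l (\<Sum>j\<in>{2..m}. Poly_Mapping.single j (int (b j))) (\<lambda>x\<in>Y. \<Prod>j\<in>{2..m}. x j ^ b j)"
proof -
  have "tracks D e l (\<Sum>j\<in>{2..m}. frag_cmul (int (b j)) (unit_expo j))
      (\<lambda>x\<in>Y. \<Prod>j\<in>{2..m}. (\<lambda>x\<in>Y. coord Y j x ^ b j) x)"
    by (intro tracks_prod tracks_power D gens) auto
  moreover have "(\<lambda>x\<in>Y. \<Prod>j\<in>{2..m}. (\<lambda>x\<in>Y. coord Y j x ^ b j) x) = (\<lambda>x\<in>Y. \<Prod>j\<in>{2..m}. x j ^ b j)"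
    by (rule restrict_ext) (simp add: coord_def)
  moreover have "frag_cmul (int (b j)) (unit_expo j) = Poly_Mapping.single j (int (b j))" for j
    by (rule poly_mapping_eqI) (simp add: lookup_single when_def)
  ultimately show ?thesis by simp
qed

text \<open>
  It suffices that \<open>e\<close> bounds the shift on the generators. The values of the weight at \<open>z\<close> and at
  \<open>y\<^sub>j\<close> with \<open>j \<ge> 2\<close> are prescribed, the one at \<open>y\<^sub>1\<close> is then forced by the equation of \<open>Y\<close>. Products
  give the basis functions, and the normal form gives all functions: the leading exponents that occur
  in it do not exceed the bound \<open>u\<close>.
\<close>

lemma tracks_carrier:
  assumes D: "derivation A D"
    and bound: "\<And>j. j \<le> m \<Longrightarrow> expo_bound (laurent_of (D (coord Y j))) (gen_expo j + e)"
  defines "l \<equiv> \<lambda>i. coef (laurent_of (D (coord Y i))) (gen_expo i + e)"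
  assumes f: "f \<in> carrier A" and u: "expo_bound (laurent_of f) u"
  shows "tracks D e l u f"
proof -
  have var: "tracks D e l (unit_expo j) (coord Y j)" if "j \<le> m" "j \<noteq> 1" for j
    using bound[OF that(1)] that expo_bound_gen[of j] coef_gen[of j]
    unfolding tracks_def by (simp add: weight_single l_def gen_expo_def)
  have var': "tracks D e l (unit_expo j) (coord Y j)" if "j \<in> {2..m}" for j
    using that by (intro var) auto
  have frag: "frag_cmul (int n) (unit_expo i) = Poly_Mapping.single i (int n)" for i n
    by (rule poly_mapping_eqI) (simp add: lookup_single when_def)
  have var0: "tracks D e l (Poly_Mapping.single 0 (int n)) (\<lambda>x\<in>Y. x 0 ^ n)" for n
  proof -
    have "(\<lambda>x\<in>Y. coord Y 0 x ^ n) = (\<lambda>x\<in>Y. x 0 ^ n)"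
      by (rule restrict_ext) (simp add: coord_def)
    then show ?thesis using tracks_power[OF D var[of 0], of n] by (simp add: frag)
  qed
  let ?y = "laurent_of (coord Y 1)" and ?Dy = "laurent_of (D (coord Y 1))"
  let ?dz = "Poly_Mapping.single 0 (int (degree P)) :: exponent"
  \<comment> \<open>The relation between the generators gives the claim for \<open>y\<^sub>1\<close>.\<close>
  have tP: "tracks D e l ?dz (\<lambda>x\<in>Y. \<Sum>i\<le>degree P. (coeff P i \<odot>\<^bsub>A\<^esub> (\<lambda>x\<in>Y. x 0 ^ i)) x)"
    by (intro tracks_sum D tracks_smult tracks_weaken[OF var0] single_0_mono) auto
  have tM: "tracks D e l kap (\<lambda>x\<in>Y. monomial_M x)"
    unfolding kap_def by (rule tracks_monomial[OF D var'])
  have rel: "(\<lambda>x\<in>Y. \<Sum>i\<le>degree P. (coeff P i \<odot>\<^bsub>A\<^esub> (\<lambda>x\<in>Y. x 0 ^ i)) x)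
      = coord Y 1 \<otimes>\<^bsub>A\<^esub> (\<lambda>x\<in>Y. monomial_M x)" (is "?P = _")
  proof (rule ext)
    fix x
    show "?P x = (coord Y 1 \<otimes>\<^bsub>A\<^esub> (\<lambda>x\<in>Y. monomial_M x)) x"
      using Y_eq[of x] by (auto simp: coord_ring_simps coord_def poly_altdef)
  qed
  have M: "laurent_of (\<lambda>x\<in>Y. monomial_M x) = lmon kap 1"
    unfolding kap_def by (rule laurent_of_monomial)
  have one_m: "1 \<le> m" by (rule m_ge_1)
  have y1: "tracks D e l (gen_expo 1) (coord Y 1)"
  proof -
    have dz: "?dz = gen_expo 1 + kap" by (simp add: gen_expo_def)
    have eqs: "gen_expo 1 + kap + e = (gen_expo 1 + e) + kap"
      "gen_expo 1 + kap + e = gen_expo 1 + (kap + e)" by (simp_all add: add_ac)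
    have y: "expo_bound ?y (gen_expo 1)" "coef ?y (gen_expo 1) = lead_coeff P"
      using expo_bound_gen[of 1] coef_gen[of 1] one_m by auto
    note tM' = tM[unfolded tracks_def M]
    have "coef (?Dy * lmon kap 1) (gen_expo 1 + kap + e) = coef ?Dy (gen_expo 1 + e)"
      unfolding eqs(1) using bound[OF one_m] tM'
      by (subst coef_mult_top) auto
    moreover have "coef (?y * laurent_of (D (\<lambda>x\<in>Y. monomial_M x))) (gen_expo 1 + kap + e)
        = lead_coeff P * weight l kap"
      unfolding eqs(2) using y tM' by (subst coef_mult_top) auto
    moreover have "laurent_of (D (coord Y 1 \<otimes>\<^bsub>A\<^esub> (\<lambda>x\<in>Y. monomial_M x)))
        = ?Dy * lmon kap 1 + ?y * laurent_of (D (\<lambda>x\<in>Y. monomial_M x))"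
      unfolding M[symmetric] using tM'[THEN conjunct1]
      by (intro laurent_of_derivation_mult D carrier_coord one_m)
    ultimately have 1: "coef (laurent_of (D (coord Y 1 \<otimes>\<^bsub>A\<^esub> (\<lambda>x\<in>Y. monomial_M x)))) (gen_expo 1 + kap + e)
        = coef ?Dy (gen_expo 1 + e) + lead_coeff P * weight l kap"
      by (simp add: lookup_add)
    have 2: "coef (laurent_of (coord Y 1 \<otimes>\<^bsub>A\<^esub> (\<lambda>x\<in>Y. monomial_M x))) (gen_expo 1 + kap) = lead_coeff P"
    proof -
      have "coef (?y * lmon kap 1) (gen_expo 1 + kap) = lead_coeff P"
        using y tM' by (subst coef_mult_top) auto
      then show ?thesis using tM' one_m by (simp add: M)
    qed
    have "coef ?Dy (gen_expo 1 + e) + lead_coeff P * weight l kap = weight l (gen_expo 1 + kap) * lead_coeff P"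
      using tP[unfolded rel dz] unfolding tracks_def 1 2 by blast
    then have "coef ?Dy (gen_expo 1 + e) = weight l (gen_expo 1) * lead_coeff P"
      by (simp add: weight_add algebra_simps)
    then show ?thesis
      using y bound[OF one_m] one_m unfolding tracks_def by auto
  qed
  have basis: "tracks D e l w (basis_fun w)" if w: "w \<in> basis_expos" for w
  proof -
    define q where "q = nat (expo w 0 div int (degree P))"
    define r where "r = nat (expo w 0 mod int (degree P))"
    define b where "b j = nat (expo w j + int (k j) * (expo w 0 div int (degree P)))" for j
    have q: "int q = expo w 0 div int (degree P)" and r: "int r = expo w 0 mod int (degree P)"
      using w degree_ge_2 by (auto simp: q_def r_def basis_expos_def pos_imp_zdiv_nonneg_iff)
    have b: "int (b j) = expo w j + int (k j) * int q" if "j \<in> {2..m}" for j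
      using that w by (auto simp: b_def q basis_expos_def)
    have "tracks D e l (frag_cmul (int q) (gen_expo 1) + (Poly_Mapping.single 0 (int r)
        + (\<Sum>j\<in>{2..m}. Poly_Mapping.single j (int (b j)))))
        ((\<lambda>x\<in>Y. coord Y 1 x ^ q) \<otimes>\<^bsub>A\<^esub> ((\<lambda>x\<in>Y. x 0 ^ r) \<otimes>\<^bsub>A\<^esub> (\<lambda>x\<in>Y. \<Prod>j\<in>{2..m}. x j ^ b j)))"
      by (intro tracks_mult D tracks_power y1 var0 tracks_monomial var')
    moreover have "frag_cmul (int q) (gen_expo 1) + (Poly_Mapping.single 0 (int r)
        + (\<Sum>j\<in>{2..m}. Poly_Mapping.single j (int (b j)))) = w"
    proof (rule poly_mapping_eqI)
      fix j
      have "expo w j = 0" if "j \<notin> insert 0 {2..m}"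
      proof -
        have "j \<notin> {0..m} - {1}" using that by (cases "j = 1") auto
        then show ?thesis using w by (auto simp: basis_expos_def not_in_keys_iff_lookup_eq_zero)
      qed
      then show "expo (frag_cmul (int q) (gen_expo 1) + (Poly_Mapping.single 0 (int r)
        + (\<Sum>j\<in>{2..m}. Poly_Mapping.single j (int (b j))))) j = expo w j"
        using expo_div_mod[of w]
        by (auto simp: lookup_add lookup_sum lookup_minus gen_expo_def expo_kap lookup_single when_def b q r algebra_simps)
    qed
    moreover have "(\<lambda>x\<in>Y. coord Y 1 x ^ q) \<otimes>\<^bsub>A\<^esub> ((\<lambda>x\<in>Y. x 0 ^ r) \<otimes>\<^bsub>A\<^esub> (\<lambda>x\<in>Y. \<Prod>j\<in>{2..m}. x j ^ b j))
        = basis_fun w"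
      by (auto simp: coord_ring_simps coord_def basis_fun_def Let_def q_def r_def b_def)
    ultimately show ?thesis by simp
  qed
  obtain U a where U: "finite U" "U \<subseteq> basis_expos" "\<forall>u\<in>U. a u \<noteq> 0"
    "f = (\<lambda>x\<in>Y. \<Sum>u\<in>U. a u * basis_fun u x)"
    "laurent_of f = (\<Sum>u\<in>U. lmon 0 (a u) * laurent_of (basis_fun u))"
    using normal_form[OF f] by (elim exE conjE) (rule that)
  have "w \<le> u" if "w \<in> U" for w
  proof -
    have "U \<noteq> {}" using that by blast
    then have "Max U \<le> u"
      using normal_form_leading(2)[OF U(1-3)] u U(5) unfolding expo_bound_def by simp
    then show ?thesis using Max_ge[OF U(1) that] by (rule order_trans[rotated])
  qed
  then have "tracks D e l u (\<lambda>x\<in>Y. \<Sum>w\<in>U. (a w \<odot>\<^bsub>A\<^esub> basis_fun w) x)"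
    using U(1,2) laurent_of_derivation_const[OF D]
    by (cases "U = {}") (simp add: tracks_def, intro tracks_sum D tracks_smult tracks_weaken[OF basis], auto)
  moreover have "f = (\<lambda>x\<in>Y. \<Sum>w\<in>U. (a w \<odot>\<^bsub>A\<^esub> basis_fun w) x)"
    unfolding U(4) by (rule restrict_ext) (simp add: coord_ring_simps)
  ultimately show ?thesis by simp
qed

text \<open>
  Take \<open>f\<close> with leading exponent \<open>u\<close>. The coefficient of the \<open>n\<close>-th iterated derivative of \<open>f\<close> at
  the exponent \<open>u + n * e\<close> is the leading coefficient of \<open>f\<close> times the product of the numbers
  \<open>weight l u + i * weight l e\<close> over \<open>i < n\<close>. Nilpotency makes one of these factors vanish. If the
  factor for \<open>i = 0\<close> does not vanish, then \<open>u + e\<close> is the leading exponent of \<open>D f\<close>.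
\<close>

lemma lnd_weight:
  assumes D: "lnd A D"
    and tr: "\<And>f u. f \<in> carrier A \<Longrightarrow> expo_bound (laurent_of f) u \<Longrightarrow> tracks D e l u f"
    and u: "u \<in> basis_expos"
  shows "\<exists>i::nat. weight l u = - of_nat i * weight l e"
    and "weight l u \<noteq> 0 \<Longrightarrow> u + e \<in> basis_expos"
proof -
  have der: "derivation A D" using D by (simp add: lnd_def)
  let ?f = "basis_fun u"
  have f: "?f \<in> carrier A" "expo_bound (laurent_of ?f) u" "coef (laurent_of ?f) u \<noteq> 0"
    using basis_fun_carrier basis_fun_leading[OF u] by auto
  have iter: "(D ^^ n) ?f \<in> carrier A \<and> expo_bound (laurent_of ((D ^^ n) ?f)) (u + frag_cmul (int n) e) \<and>
      coef (laurent_of ((D ^^ n) ?f)) (u + frag_cmul (int n) e)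
        = (\<Prod>i<n. weight l u + of_nat i * weight l e) * coef (laurent_of ?f) u" for n
  proof (induction n)
    case 0
    then show ?case using f by simp
  next
    case (Suc n)
    have w: "weight l (frag_cmul (int n) e) = of_nat n * weight l e"
      by (simp add: weight_def sum_distrib_left mult.assoc)
    have eq: "u + frag_cmul (int (Suc n)) e = u + frag_cmul (int n) e + e"
      by (simp add: frag_cmul_distrib add_ac)
    from Suc have "tracks D e l (u + frag_cmul (int n) e) ((D ^^ n) ?f)"
      by (intro tr) auto
    then show ?case
      unfolding eq tracks_def using Suc der
      by (simp add: derivation_carrier weight_add w mult_ac)
  qed
  obtain n where "(D ^^ n) ?f = \<zero>\<^bsub>A\<^esub>" using D f(1) unfolding lnd_def by blast
  then have "(\<Prod>i<n. weight l u + of_nat i * weight l e) = 0"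
    using iter[of n] f(3) by simp
  then obtain i where "weight l u + of_nat i * weight l e = 0" by auto
  then show "\<exists>i::nat. weight l u = - of_nat i * weight l e"
    by (intro exI[of _ i]) (simp add: eq_neg_iff_add_eq_0)
  show "u + e \<in> basis_expos" if "weight l u \<noteq> 0"
    by (rule leading_expo_in_basis_expos[of "D ?f"])
      (use tr[OF f(1,2)] that f der in \<open>auto simp: tracks_def derivation_carrier\<close>)
qed

lemma unit_expo_in_basis_expos: "j \<le> m \<Longrightarrow> j \<noteq> 1 \<Longrightarrow> unit_expo j \<in> basis_expos"
  using degree_ge_2 by (auto simp: basis_expos_def lookup_single when_def)

lemma gen_expo_in_basis_expos: "j \<le> m \<Longrightarrow> gen_expo j \<in> basis_expos"
  by (rule leading_expo_in_basis_expos[of "coord Y j"])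
    (use expo_bound_gen coef_gen lead_coeff_nonzero in auto)

text \<open>
  By the first assumption the weights of all leading exponents are \<open>- N * weight l e\<close> with natural
  numbers \<open>N\<close>; write \<open>N\<^sub>0\<close> and \<open>N\<^sub>j\<close> for those of \<open>z\<close> and \<open>y\<^sub>j\<close>. In particular \<open>e\<close> itself is not a leading
  exponent. Suppose that the exponent of \<open>z\<close> in \<open>e\<close> is nonnegative. Some \<open>N\<^sub>j\<close> with \<open>j \<ge> 2\<close> is
  positive, as otherwise \<open>e\<close> would have the wrong sign of weight. Then \<open>e\<close> becomes a leading exponent
  when one adds the exponent of \<open>y\<^sub>j\<close>, so that \<open>y\<^sub>j\<close> is the only variable whose exponent in \<open>e\<close> is too
  small, and it is too small by exactly \<open>1\<close>; and also when one adds the exponent of \<open>z\<close>, so that the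
  exponent of \<open>z\<close> in \<open>e\<close> is \<open>q * d + d - 1\<close>. The weight of \<open>e\<close> now is determined by \<open>N\<^sub>0\<close> and \<open>N\<^sub>j\<close>:
  \<open>q * (d * N\<^sub>0 - k j * N\<^sub>j) + (d - 1) * N\<^sub>0 - N\<^sub>j = -1\<close>. The first bracket is the number that belongs to
  \<open>y\<^sub>1\<close>, hence nonnegative, and \<open>2 \<le> k j\<close>, \<open>2 \<le> d\<close> make the remaining terms nonnegative.
\<close>

lemma basis_expos_shift_negative:
  assumes nat: "\<And>u. u \<in> basis_expos \<Longrightarrow> \<exists>i::nat. weight l u = - of_nat i * weight l e"
    and shift: "\<And>u. u \<in> basis_expos \<Longrightarrow> weight l u \<noteq> 0 \<Longrightarrow> u + e \<in> basis_expos"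
    and nz: "u \<in> basis_expos" "weight l u \<noteq> 0"
  shows "expo e 0 < 0"
proof (rule ccontr)
  assume "\<not> expo e 0 < 0"
  then have e0: "0 \<le> expo e 0" by simp
  let ?d = "int (degree P)"
  let ?I = "{0..m} - {1}"
  have we: "weight l e \<noteq> 0" using nat[OF nz(1)] nz(2) by auto
  \<comment> \<open>The coefficient of \<open>weight l e\<close> in \<open>weight l e\<close> is \<open>1\<close>, which is not \<open>- i\<close> for a natural number \<open>i\<close>.\<close>
  have e_notin: "e \<notin> basis_expos"
  proof
    assume "e \<in> basis_expos"
    then obtain i :: nat where "weight l e = - of_nat i * weight l e" using nat by blast
    then have "weight l e + of_nat i * weight l e = 0"
      unfolding mult_minus_left eq_neg_iff_add_eq_0 .
    then have "of_nat (Suc i) * weight l e = 0" by (simp add: distrib_right)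
    then show False using we by (simp del: of_nat_Suc)
  qed
  have "\<forall>j\<in>?I. \<exists>i::nat. l j = - of_nat i * weight l e"
    using nat[OF unit_expo_in_basis_expos] by (auto simp: weight_single)
  then obtain N :: "nat \<Rightarrow> nat" where N: "\<And>j. j \<in> ?I \<Longrightarrow> l j = - of_nat (N j) * weight l e"
    by metis
  define L where "L u = (\<Sum>i\<in>?I. expo u i * int (N i))" for u :: exponent
  have L: "weight l u = - of_int (L u) * weight l e" for u
    unfolding weight_def[of l u] L_def of_int_sum sum_distrib_right sum_negf[symmetric]
    by (rule sum.cong) (auto simp: N)
  have "weight l e + of_int (L e) * weight l e = 0"
    using L[of e] unfolding mult_minus_left eq_neg_iff_add_eq_0 .
  then have "of_int (L e + 1) * weight l e = 0" by (simp add: distrib_right add.commute)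
  then have Le: "L e = -1" using we by (simp del: of_int_add)
  have I_eq: "?I = insert 0 {2..m}" using m_ge_1 by auto
  have L_eq: "L u = expo u 0 * int (N 0) + (\<Sum>j\<in>{2..m}. expo u j * int (N j))" for u
    unfolding L_def I_eq by simp
  \<comment> \<open>The leading exponent of \<open>y\<^sub>1\<close> belongs to a natural number, too.\<close>
  have y1: "(\<Sum>j\<in>{2..m}. int (k j) * int (N j)) \<le> ?d * int (N 0)"
  proof -
    obtain i :: nat where "weight l (gen_expo 1) = - of_nat i * weight l e"
      using nat[OF gen_expo_in_basis_expos[of 1]] m_ge_1 by blast
    then have "of_int (L (gen_expo 1)) = (of_int (int i) :: 'k)"
      using we unfolding L[of "gen_expo 1"] by simp
    then have "L (gen_expo 1) \<ge> 0" unfolding of_int_eq_iff by simp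
    then show ?thesis
      unfolding L_eq by (simp add: gen_expo_def lookup_minus lookup_single expo_kap sum_negf)
  qed
  have shift': "unit_expo j + e \<in> basis_expos" if "j \<in> ?I" "N j \<noteq> 0" for j
    using shift[OF unit_expo_in_basis_expos[of j]] that we N[OF that(1)] by (auto simp: weight_single)
  have "\<exists>j\<in>{2..m}. N j \<noteq> 0"
  proof (rule ccontr)
    assume "\<not> ?thesis"
    then have "L e = expo e 0 * int (N 0)" unfolding L_eq by simp
    then show False using Le e0 by (smt (verit) mult_nonneg_nonneg of_nat_0_le_iff)
  qed
  then obtain j where j: "j \<in> {2..m}" "N j \<noteq> 0" by blast
  have kN: "int (k j) * int (N j) \<le> ?d * int (N 0)"
    using y1 member_le_sum[OF j(1), of "\<lambda>j. int (k j) * int (N j)"] by simp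
  have k: "2 \<le> int (k j)" using k_ge_2[OF j(1)] by simp
  have "N 0 \<noteq> 0"
  proof
    assume "N 0 = 0"
    then have "int (k j) * int (N j) \<le> 0" using kN by simp
    then show False using k j(2) by (simp add: mult_le_0_iff)
  qed
  then have ze: "unit_expo 0 + e \<in> basis_expos" by (intro shift') auto
  define q where "q = expo e 0 div ?d"
  have supp: "Poly_Mapping.keys e \<subseteq> ?I"
  proof
    fix i assume i: "i \<in> Poly_Mapping.keys e"
    have "i \<in> Poly_Mapping.keys (unit_expo 0 + e)" if "i \<noteq> 0"
      using i that by (simp add: in_keys_iff lookup_add lookup_single)
    then show "i \<in> ?I" using ze by (cases "i = 0") (auto simp: basis_expos_def)
  qed
  then obtain j' where j': "j' \<in> {2..m}" "expo e j' + int (k j') * q < 0"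
    using e_notin e0 unfolding basis_expos_def q_def by force
  have only: "i = j'" if "i \<in> {2..m}" "N i \<noteq> 0" for i
  proof (rule ccontr)
    assume "i \<noteq> j'"
    have "unit_expo i + e \<in> basis_expos" using that by (intro shift') auto
    then have "0 \<le> expo (unit_expo i + e) j' + int (k j') * (expo (unit_expo i + e) 0 div ?d)"
      using j'(1) unfolding basis_expos_def by blast
    moreover have "expo (unit_expo i + e) j' = expo e j'" "expo (unit_expo i + e) 0 = expo e 0"
      using \<open>i \<noteq> j'\<close> that(1) by (auto simp: lookup_add lookup_single)
    ultimately show False using j'(2) by (simp add: q_def)
  qed
  have jj: "j = j'" using only j by blast
  have ej: "expo e j = - int (k j) * q - 1"
  proof -
    have "unit_expo j + e \<in> basis_expos" using j by (intro shift') auto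
    then have "0 \<le> expo (unit_expo j + e) j + int (k j) * (expo (unit_expo j + e) 0 div ?d)"
      using j(1) unfolding basis_expos_def by blast
    moreover have "expo (unit_expo j + e) j = expo e j + 1" "expo (unit_expo j + e) 0 = expo e 0"
      using j(1) by (auto simp: lookup_add lookup_single)
    ultimately show ?thesis using j'(2) by (simp add: q_def jj)
  qed
  have e0_eq: "expo e 0 = q * ?d + ?d - 1"
  proof -
    have "0 \<le> expo (unit_expo 0 + e) j + int (k j) * (expo (unit_expo 0 + e) 0 div ?d)"
      using ze j(1) unfolding basis_expos_def by blast
    moreover have "expo (unit_expo 0 + e) j = expo e j" "expo (unit_expo 0 + e) 0 = expo e 0 + 1"
      using j(1) by (auto simp: lookup_add lookup_single)
    ultimately have "0 < int (k j) * ((expo e 0 + 1) div ?d - q)"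
      using ej by (simp add: algebra_simps)
    then have gt: "q + 1 \<le> (expo e 0 + 1) div ?d" using k by (simp add: zero_less_mult_iff)
    have "(q + 1) * ?d \<le> expo e 0 + 1"
    proof -
      have "(q + 1) * ?d \<le> (expo e 0 + 1) div ?d * ?d"
        using gt by (intro mult_right_mono) auto
      also have "\<dots> \<le> expo e 0 + 1"
        using degree_ge_2 by (simp add: minus_mod_eq_div_mult[symmetric])
      finally show ?thesis .
    qed
    moreover have "expo e 0 = q * ?d + expo e 0 mod ?d" unfolding q_def by simp
    moreover have "expo e 0 mod ?d < ?d" using degree_ge_2 by simp
    moreover have "(q + 1) * ?d = q * ?d + ?d" by (simp add: distrib_right)
    ultimately show ?thesis by linarith
  qed
  have "(\<Sum>i\<in>{2..m}. expo e i * int (N i)) = (\<Sum>i\<in>{j}. expo e i * int (N i))"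
  proof (rule sum.mono_neutral_right)
    show "\<forall>i\<in>{2..m} - {j}. expo e i * int (N i) = 0" using only jj by fastforce
  qed (use j in auto)
  then have "L e = expo e 0 * int (N 0) + expo e j * int (N j)" unfolding L_eq by simp
  then have main: "q * (?d * int (N 0) - int (k j) * int (N j)) + (?d - 1) * int (N 0) - int (N j) = -1"
    unfolding Le e0_eq ej by (simp add: algebra_simps)
  have "0 \<le> q * (?d * int (N 0) - int (k j) * int (N j))"
    using kN e0 degree_ge_2 by (intro mult_nonneg_nonneg) (auto simp: q_def pos_imp_zdiv_nonneg_iff)
  then have 1: "(?d - 1) * int (N 0) + 1 \<le> int (N j)" using main by simp
  have "2 * int (N j) \<le> int (k j) * int (N j)" using k by (intro mult_right_mono) auto
  moreover have "2 * ((?d - 1) * int (N 0) + 1) \<le> 2 * int (N j)" using 1 by simp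
  ultimately have "2 * ((?d - 1) * int (N 0) + 1) \<le> ?d * int (N 0)" using kN by (meson order_trans)
  then have "(?d - 2) * int (N 0) + 2 \<le> 0" by (simp add: algebra_simps)
  moreover have "0 \<le> (?d - 2) * int (N 0)" using degree_ge_2 by (intro mult_nonneg_nonneg) auto
  ultimately show False by linarith
qed

text \<open>
  Let \<open>e\<close> be the largest difference between an exponent of the derivative of a generator and the
  leading exponent of that generator. It is attained, so the weight of some generator is nonzero and
  the exponent of \<open>z\<close> in \<open>e\<close> is negative.
\<close>

lemma lnd_lowers_degree:
  assumes D: "lnd A D" and j: "j \<le> m" and c: "coef (laurent_of (D (coord Y j))) c \<noteq> 0"
  shows "expo c 0 < expo (gen_expo j) 0"
proof -
  have der: "derivation A D" using D by (simp add: lnd_def)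
  define X where "X = (\<Union>i\<in>{0..m}. (\<lambda>w. w - gen_expo i) ` Poly_Mapping.keys (laurent_of (D (coord Y i))))"
  have X: "finite X" "c - gen_expo j \<in> X"
    using j c unfolding X_def by (simp, force simp: in_keys_iff)
  define e where "e = Max X"
  have bound: "expo_bound (laurent_of (D (coord Y i))) (gen_expo i + e)" if "i \<le> m" for i
    unfolding expo_bound_def
  proof (intro allI impI)
    fix w assume "coef (laurent_of (D (coord Y i))) w \<noteq> 0"
    then have "w - gen_expo i \<in> X" using that unfolding X_def by (force simp: in_keys_iff)
    then have "w - gen_expo i \<le> e" using X(1) by (simp add: e_def)
    then show "w \<le> gen_expo i + e" by (simp add: algebra_simps)
  qed
  define l where "l i = coef (laurent_of (D (coord Y i))) (gen_expo i + e)" for i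
  have tr: "tracks D e l u f" if "f \<in> carrier A" "expo_bound (laurent_of f) u" for f u
    using tracks_carrier[OF der bound that] by (simp add: l_def[abs_def])
  have "e \<in> X" unfolding e_def using X by (intro Max_in) auto
  then obtain i where i: "i \<le> m" "coef (laurent_of (D (coord Y i))) (gen_expo i + e) \<noteq> 0"
    unfolding X_def by (auto simp: in_keys_iff)
  have "weight l (gen_expo i) \<noteq> 0"
    using tr[of "coord Y i" "gen_expo i"] i expo_bound_gen[of i] by (auto simp: tracks_def)
  then have "expo e 0 < 0"
    by (intro basis_expos_shift_negative[of l e "gen_expo i"] lnd_weight[OF D tr]
        gen_expo_in_basis_expos i(1))
  moreover have "expo (c - gen_expo j) 0 \<le> expo e 0"
    by (rule expo_le_imp_le_0) (use X in \<open>simp add: e_def\<close>)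
  ultimately show ?thesis by (simp add: lookup_minus)
qed

section \<open>The canonical derivation\<close>

text \<open>
  Although \<open>y\<^sub>1\<close> introduces denominators, these involve only \<open>y\<^sub>2, \<dots>, y\<^sub>m\<close>.
\<close>

lemma expo_nonneg:
  assumes "f \<in> carrier A" and "coef (laurent_of f) w \<noteq> 0"
  shows "0 \<le> expo w 0"
proof -
  have gen: "0 \<le> expo w 0" if "coef (gen j) w \<noteq> 0" for j w
    using that
    by (cases "j = 1")
      (auto simp: gen_def lookup_sum lookup_single when_def lookup_minus expo_kap
        elim!: sum.not_neutral_contains_not_neutral split: if_splits)
  from assms(1) have "\<forall>w. coef (laurent_of f) w \<noteq> 0 \<longrightarrow> 0 \<le> expo w 0"
  proof (induction f rule: carrier_induct)
    case (const c)
    show ?case unfolding laurent_of_const by (auto simp: lookup_single when_def split: if_splits)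
  next
    case (add f g)
    then show ?case by (auto simp: lookup_add) (metis add.left_neutral)
  next
    case (coord_mult j f)
    show ?case
    proof (intro allI impI)
      fix w assume "coef (laurent_of (coord Y j \<otimes>\<^bsub>A\<^esub> f)) w \<noteq> 0"
      then have "w \<in> Poly_Mapping.keys (gen j * laurent_of f)"
        using coord_mult by (simp add: in_keys_iff)
      then obtain a b where "w = a + b" "coef (gen j) a \<noteq> 0" "coef (laurent_of f) b \<noteq> 0"
        using keys_mult[of "gen j" "laurent_of f"] by (auto simp: in_keys_iff)
      then show "0 \<le> expo w 0" using gen coord_mult by (simp add: lookup_add)
    qed
  qed
  then show ?thesis using assms(2) by blast
qed

lemma carrier_poly_z: "(\<lambda>x\<in>Y. poly Q (x 0)) \<in> carrier A"
proof -
  have "poly_function {0..m} (\<lambda>x::nat \<Rightarrow> 'k. poly Q (x 0))"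
    by (induction Q)
      (auto intro!: poly_function_add poly_function_const poly_function_coord_mult)
  then show ?thesis unfolding coord_ring_simps poly_functions_on_def by blast
qed

lemma monomial_in_poly_functions_y: "(\<lambda>x\<in>Y. \<Prod>j\<in>{2..m}. x j ^ b j) \<in> poly_functions_on Y {2..m}"
  using poly_functions_on_monomial[where c = 1 and \<alpha> = b] by simp

lemma carrier_M: "(\<lambda>x\<in>Y. monomial_M x) \<in> carrier A"
  by (rule carrier_poly_functions[OF _ monomial_in_poly_functions_y]) auto

lemma laurent_of_M: "laurent_of (\<lambda>x\<in>Y. monomial_M x) = lmon kap 1"
  unfolding kap_def by (rule laurent_of_monomial)

lemma zderiv_gen_0: "zderiv kap (gen 0) = lmon kap 1"
  by (simp add: gen_def zderiv_mono)

lemma zderiv_gen_ge_2: "2 \<le> j \<Longrightarrow> zderiv kap (gen j) = 0"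
  by (simp add: gen_def zderiv_mono lookup_single)

lemma zderiv_gen_1:
  "zderiv kap (gen 1) = (\<Sum>i\<le>degree P. lmon (Poly_Mapping.single 0 (int i - 1)) (of_nat i * coeff P i))"
proof -
  have "Poly_Mapping.single 0 (int i) - unit_expo 0 = Poly_Mapping.single 0 (int i - 1)" for i
    by (simp add: single_diff)
  then show ?thesis
    by (simp add: gen_def zderiv_sum zderiv_mono lookup_minus expo_kap)
qed

lemma laurent_of_pderiv: "laurent_of (\<lambda>x\<in>Y. poly (pderiv P) (x 0)) = zderiv kap (gen 1)"
proof (rule laurent_of_eqI, unfold expands_to_def, intro allI impI)
  fix t :: "nat \<Rightarrow> 'k" assume t: "\<forall>i. t i \<noteq> 0"
  obtain n where n: "degree P = Suc n" using degree_ge_2 by (cases "degree P") auto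
  have "eval_laurent t (zderiv kap (gen 1))
      = (\<Sum>i\<le>Suc n. of_nat i * coeff P i * t 0 powi (int i - 1))"
    by (simp add: zderiv_gen_1 eval_laurent_sum n del: sum.atMost_Suc One_nat_def)
  also have "\<dots> = (\<Sum>i\<le>n. of_nat (Suc i) * coeff P (Suc i) * t 0 ^ i)"
    unfolding sum.atMost_Suc_shift by (simp del: sum.atMost_Suc)
  also have "\<dots> = poly (pderiv P) (t 0)"
    by (simp add: poly_altdef degree_pderiv n coeff_pderiv)
  finally show "(\<lambda>x\<in>Y. poly (pderiv P) (x 0)) (torus_point t) = eval_laurent t (zderiv kap (gen 1))"
    using t by (simp add: torus_point_in_Y) (simp add: torus_point_def)
qed

text \<open>
  This makes \<open>M \<partial>/\<partial>z\<close> a derivation of the coordinate ring: although \<open>y\<^sub>1 = P(z) / M\<close> has a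
  denominator, the factor \<open>M\<close> cancels it in the derivative \<open>P'(z)\<close> of \<open>y\<^sub>1\<close>.
\<close>

lemma zderiv_laurent_of: "f \<in> carrier A \<Longrightarrow> \<exists>g\<in>carrier A. laurent_of g = zderiv kap (laurent_of f)"
proof (induction f rule: carrier_induct)
  case (const c)
  have "laurent_of \<zero>\<^bsub>A\<^esub> = zderiv kap (laurent_of (\<lambda>x\<in>Y. c))"
    unfolding laurent_of_const by simp
  then show ?case using carrier_zero by blast
next
  case (add f g)
  then obtain f' g' where "f' \<in> carrier A" "g' \<in> carrier A"
    "laurent_of f' = zderiv kap (laurent_of f)" "laurent_of g' = zderiv kap (laurent_of g)" by blast
  then show ?case using add by (intro bexI[of _ "f' \<oplus>\<^bsub>A\<^esub> g'"]) (simp_all add: zderiv_add)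
next
  case (coord_mult j f)
  consider "j = 0" | "j = 1" | "2 \<le> j" by linarith
  then have "\<exists>g\<in>carrier A. laurent_of g = zderiv kap (gen j)"
  proof cases
    case 1
    then show ?thesis using carrier_M laurent_of_M zderiv_gen_0 by metis
  next
    case 2
    then show ?thesis using carrier_poly_z laurent_of_pderiv by metis
  next
    case 3
    then show ?thesis using carrier_zero laurent_of_zero zderiv_gen_ge_2 by metis
  qed
  then obtain g' where g': "g' \<in> carrier A" "laurent_of g' = zderiv kap (gen j)" by blast
  obtain f' where f': "f' \<in> carrier A" "laurent_of f' = zderiv kap (laurent_of f)"
    using coord_mult by blast
  show ?case
    by (intro bexI[of _ "(g' \<otimes>\<^bsub>A\<^esub> f) \<oplus>\<^bsub>A\<^esub> (coord Y j \<otimes>\<^bsub>A\<^esub> f')"])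
      (use f' g' coord_mult in \<open>simp_all add: zderiv_mult\<close>)
qed

definition delta :: "((nat \<Rightarrow> 'k) \<Rightarrow> 'k) \<Rightarrow> (nat \<Rightarrow> 'k) \<Rightarrow> 'k" where
  "delta f = (SOME g. g \<in> carrier A \<and> laurent_of g = zderiv kap (laurent_of f))"

lemma delta_carrier: "f \<in> carrier A \<Longrightarrow> delta f \<in> carrier A"
  and laurent_of_delta: "f \<in> carrier A \<Longrightarrow> laurent_of (delta f) = zderiv kap (laurent_of f)"
proof -
  assume "f \<in> carrier A"
  then have "\<exists>g. g \<in> carrier A \<and> laurent_of g = zderiv kap (laurent_of f)"
    using zderiv_laurent_of by blast
  from someI_ex[OF this]
  show "delta f \<in> carrier A" "laurent_of (delta f) = zderiv kap (laurent_of f)"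
    unfolding delta_def by auto
qed

lemma derivation_delta: "derivation A delta"
  unfolding derivation_def
proof (intro conjI ballI allI)
  show "delta \<in> carrier A \<rightarrow> carrier A" using delta_carrier by blast
next
  fix f g assume "f \<in> carrier A" "g \<in> carrier A"
  then show "delta (f \<oplus>\<^bsub>A\<^esub> g) = delta f \<oplus>\<^bsub>A\<^esub> delta g"
    by (intro laurent_of_inject) (simp_all add: delta_carrier laurent_of_delta zderiv_add)
next
  fix c f assume "f \<in> carrier A"
  then show "delta (c \<odot>\<^bsub>A\<^esub> f) = c \<odot>\<^bsub>A\<^esub> delta f"
    by (intro laurent_of_inject) (simp_all add: delta_carrier laurent_of_delta zderiv_mult)
next
  fix f g assume "f \<in> carrier A" "g \<in> carrier A"
  then show "delta (f \<otimes>\<^bsub>A\<^esub> g) = (delta f \<otimes>\<^bsub>A\<^esub> g) \<oplus>\<^bsub>A\<^esub> (f \<otimes>\<^bsub>A\<^esub> delta g)"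
    by (intro laurent_of_inject) (simp_all add: delta_carrier laurent_of_delta zderiv_mult)
qed

text \<open>
  Every application lowers the degree in \<open>z\<close> by one, since \<open>M\<close> does not involve \<open>z\<close>.
\<close>

lemma zderiv_nilpotent:
  assumes "\<And>w. coef p w \<noteq> 0 \<Longrightarrow> 0 \<le> expo w 0 \<and> expo w 0 < int n"
  shows "(zderiv kap ^^ n) p = 0"
  using assms
proof (induction n arbitrary: p)
  case 0
  then have "coef p w = 0" for w by force
  then show ?case by (simp add: poly_mapping_eqI)
next
  case (Suc n)
  have "(zderiv kap ^^ n) (zderiv kap p) = 0"
  proof (rule Suc.IH)
    fix w assume w: "coef (zderiv kap p) w \<noteq> 0"
    let ?u = "w - kap + unit_expo 0"
    have "expo ?u 0 \<noteq> 0" "coef p ?u \<noteq> 0" using w by (auto simp: coef_zderiv)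
    moreover have "expo ?u 0 = expo w 0 + 1" by (simp add: lookup_add lookup_minus expo_kap)
    ultimately show "0 \<le> expo w 0 \<and> expo w 0 < int n" using Suc.prems[of ?u] by auto
  qed
  then show ?case by (simp add: funpow_swap1)
qed

lemma lnd_delta: "lnd A delta"
  unfolding lnd_def
proof (intro conjI derivation_delta ballI)
  fix f assume f: "f \<in> carrier A"
  let ?K = "Poly_Mapping.keys (laurent_of f)"
  define n where "n = nat (\<Sum>w\<in>?K. \<bar>expo w 0\<bar>) + 1"
  have "0 \<le> expo w 0 \<and> expo w 0 < int n" if "coef (laurent_of f) w \<noteq> 0" for w
  proof -
    have "\<bar>expo w 0\<bar> \<le> (\<Sum>w\<in>?K. \<bar>expo w 0\<bar>)"
      using that by (intro member_le_sum) (auto simp: in_keys_iff)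
    then show ?thesis using expo_nonneg[OF f that] by (auto simp: n_def)
  qed
  then have "(zderiv kap ^^ n) (laurent_of f) = 0" by (rule zderiv_nilpotent)
  moreover have "(delta ^^ i) f \<in> carrier A \<and> laurent_of ((delta ^^ i) f) = (zderiv kap ^^ i) (laurent_of f)" for i
    by (induction i) (auto simp: f delta_carrier laurent_of_delta)
  ultimately show "\<exists>n. (delta ^^ n) f = \<zero>\<^bsub>A\<^esub>"
    by (intro exI[of _ n] laurent_of_eq_0_imp) auto
qed

lemma delta_z: "delta (coord Y 0) = (\<lambda>x\<in>Y. monomial_M x)"
  by (rule laurent_of_inject)
    (simp_all add: delta_carrier laurent_of_delta carrier_M laurent_of_M zderiv_gen_0)

lemma delta_y: "j \<in> {2..m} \<Longrightarrow> delta (coord Y j) = \<zero>\<^bsub>A\<^esub>"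
  by (rule laurent_of_inject) (simp_all add: delta_carrier laurent_of_delta zderiv_gen_ge_2)

lemma delta_y1: "delta (coord Y 1) = (\<lambda>x\<in>Y. poly (pderiv P) (x 0))"
  using m_ge_1
  by (intro laurent_of_inject)
    (simp_all add: delta_carrier laurent_of_delta carrier_poly_z laurent_of_pderiv del: One_nat_def)

lemma canonical_lnd_delta: "canonical_lnd m k P delta"
  unfolding canonical_lnd_def Let_def using lnd_delta delta_y1 delta_z delta_y by simp

section \<open>Locally nilpotent derivations are multiples of the canonical one\<close>

lemma derivation_zero_on_subalgebra:
  assumes D: "derivation A D" and J: "J \<subseteq> {0..m}"
    and zero: "\<And>j. j \<in> J \<Longrightarrow> D (coord Y j) = \<zero>\<^bsub>A\<^esub>"
    and f: "f \<in> poly_functions_on Y J"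
  shows "D f = \<zero>\<^bsub>A\<^esub>"
proof -
  have fin: "finite J" using J by (rule finite_subset) simp
  note carr = carrier_poly_functions[OF J]
  have "laurent_of (D f) = 0" using f fin
  proof (induction f rule: poly_functions_on_induct)
    case (const c)
    show ?case by (rule laurent_of_derivation_const[OF D])
  next
    case (add f g)
    have "laurent_of (D (f \<oplus>\<^bsub>A\<^esub> g)) = 0"
      using laurent_of_derivation_add[OF D carr carr, OF add(1,2)] add(3,4) by simp
    then show ?case unfolding coord_ring_simps .
  next
    case (coord_mult j f)
    have "coord Y j \<in> carrier A" using coord_mult(1) J by auto
    from laurent_of_derivation_mult[OF D this carr[OF coord_mult(2)]]
    have "laurent_of (D (coord Y j \<otimes>\<^bsub>A\<^esub> f)) = 0" using coord_mult zero by simp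
    then show ?case unfolding coord_ring_simps .
  qed
  then show ?thesis
    using derivation_carrier[OF D] carr[OF f] by (intro laurent_of_eq_0_imp) auto
qed

text \<open>
  The kernel of the canonical derivation: in characteristic zero, an expansion with vanishing
  derivative has no \<open>z\<close> in it.
\<close>

lemma poly_functions_y_iff:
  assumes f: "f \<in> carrier A"
  shows "f \<in> poly_functions_on Y {2..m} \<longleftrightarrow> delta f = \<zero>\<^bsub>A\<^esub>"
proof
  assume "f \<in> poly_functions_on Y {2..m}"
  then show "delta f = \<zero>\<^bsub>A\<^esub>"
    by (rule derivation_zero_on_subalgebra[OF derivation_delta, rotated 2]) (auto simp: delta_y)
next
  assume "delta f = \<zero>\<^bsub>A\<^esub>"
  then have z: "zderiv kap (laurent_of f) = 0" using laurent_of_delta[OF f] by simp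
  have deg0: "expo u 0 = 0" if "coef (laurent_of f) u \<noteq> 0" for u
    by (rule zderiv_eq_0_imp[OF z that])
  have small: "expo u 0 < int (degree P)" if "coef (laurent_of f) u \<noteq> 0" for u
    using deg0[OF that] degree_ge_2 by simp
  let ?K = "Poly_Mapping.keys (laurent_of f)"
  let ?g = "\<lambda>u. \<lambda>x\<in>Y. coef (laurent_of f) u * (\<Prod>j\<in>{2..m}. x j ^ nat (expo u j))"
  have "f = (\<lambda>x\<in>Y. \<Sum>u\<in>?K. coef (laurent_of f) u * basis_fun u x)"
    by (rule small_degree_normal_form[OF f small])
  also have "\<dots> = (\<lambda>x\<in>Y. \<Sum>u\<in>?K. ?g u x)"
    by (intro restrict_ext sum.cong) (auto simp: basis_fun_def deg0 in_keys_iff)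
  also have "\<dots> \<in> poly_functions_on Y {2..m}"
    by (intro poly_functions_on_sum poly_functions_on_monomial)
  finally show "f \<in> poly_functions_on Y {2..m}" .
qed

text \<open>
  Both sides are derivations of \<open>A\<close> with values in the Laurent polynomials, and they agree on \<open>z\<close>
  and on the \<open>y\<^sub>j\<close> with \<open>j \<ge> 2\<close>. As \<open>y\<^sub>1\<close> is a quotient of functions of these variables, they
  also agree on \<open>y\<^sub>1\<close>.
\<close>

lemma derivation_eq_multiple_of_zderiv:
  assumes D: "derivation A D" and y: "\<And>j. j \<in> {2..m} \<Longrightarrow> D (coord Y j) = \<zero>\<^bsub>A\<^esub>"
    and f: "f \<in> carrier A"
  shows "laurent_of (D f) * lmon kap 1 = laurent_of (D (coord Y 0)) * zderiv kap (laurent_of f)"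
proof -
  let ?G = "laurent_of (D (coord Y 0))" and ?J = "{0..m} - {1}"
  define T where "T f = laurent_of (D f) * lmon kap 1 - ?G * zderiv kap (laurent_of f)" for f
  have T_const: "T (\<lambda>x\<in>Y. c) = 0" for c
    unfolding T_def laurent_of_derivation_const[OF D] laurent_of_const by simp
  have T_add: "T (f \<oplus>\<^bsub>A\<^esub> g) = T f + T g" if "f \<in> carrier A" "g \<in> carrier A" for f g
    using that by (simp add: T_def laurent_of_derivation_add[OF D] zderiv_add algebra_simps)
  have T_mult: "T (f \<otimes>\<^bsub>A\<^esub> g) = T f * laurent_of g + laurent_of f * T g"
    if "f \<in> carrier A" "g \<in> carrier A" for f g
    using that by (simp add: T_def laurent_of_derivation_mult[OF D] zderiv_mult algebra_simps)
  have T_coord: "T (coord Y j) = 0" if "j \<in> ?J" for j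
  proof (cases "j = 0")
    case True
    then show ?thesis by (simp add: T_def zderiv_gen_0)
  next
    case False
    then have "j \<in> {2..m}" using that by auto
    then show ?thesis by (simp add: T_def zderiv_gen_ge_2 y)
  qed
  have T_J: "T f = 0" if "f \<in> poly_functions_on Y ?J" for f
  proof -
    have fin: "finite ?J" by simp
    have carr: "g \<in> carrier A" if "g \<in> poly_functions_on Y ?J" for g
      using that by (rule carrier_poly_functions[rotated]) auto
    from that fin show ?thesis
    proof (induction f rule: poly_functions_on_induct)
      case (const c)
      show ?case by (rule T_const)
    next
      case (add f g)
      then have "T (f \<oplus>\<^bsub>A\<^esub> g) = 0" using T_add[OF carr carr, of f g] by simp
      then show ?case unfolding coord_ring_simps .
    next
      case (coord_mult j f)
      then have "T (coord Y j \<otimes>\<^bsub>A\<^esub> f) = 0"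
        using T_mult[of "coord Y j" f] carr[of f] T_coord[of j] by simp
      then show ?case unfolding coord_ring_simps .
    qed
  qed
  have T_y1: "T (coord Y 1) = 0"
  proof -
    have M: "(\<lambda>x\<in>Y. monomial_M x) \<in> poly_functions_on Y ?J"
    proof (rule subsetD[OF poly_functions_on_mono monomial_in_poly_functions_y])
      show "{2..m} \<subseteq> ?J" by auto
    qed simp
    have "poly_function ?J (\<lambda>x::nat \<Rightarrow> 'k. poly P (x 0))"
      by (induction P) (auto intro!: poly_function_add poly_function_const poly_function_coord_mult)
    then have Pz: "(\<lambda>x\<in>Y. poly P (x 0)) \<in> poly_functions_on Y ?J"
      unfolding poly_functions_on_def by blast
    have "coord Y 1 \<otimes>\<^bsub>A\<^esub> (\<lambda>x\<in>Y. monomial_M x) = (\<lambda>x\<in>Y. poly P (x 0))"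
    proof (rule ext)
      fix x show "(coord Y 1 \<otimes>\<^bsub>A\<^esub> (\<lambda>x\<in>Y. monomial_M x)) x = (\<lambda>x\<in>Y. poly P (x 0)) x"
        using Y_eq[of x] by (auto simp: coord_ring_simps coord_def)
    qed
    then have "T (coord Y 1) * lmon kap 1 + laurent_of (coord Y 1) * T (\<lambda>x\<in>Y. monomial_M x) = 0"
      using T_mult[OF carrier_coord[OF m_ge_1] carrier_M] T_J[OF Pz] laurent_of_M by simp
    then have "T (coord Y 1) * lmon kap 1 = 0" using T_J[OF M] by simp
    then show ?thesis by (metis mult_eq_0_iff lookup_single_eq lookup_zero zero_neq_one)
  qed
  from f have "T f = 0"
  proof (induction f rule: carrier_induct)
    case (const c)
    show ?case by (rule T_const)
  next
    case (add f g)
    then show ?case using T_add by simp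
  next
    case (coord_mult j f)
    have "T (coord Y j) = 0" using T_y1 T_coord[of j] coord_mult(1) by (cases "j = 1") auto
    then show ?case using T_mult[of "coord Y j" f] coord_mult by simp
  qed
  then show ?thesis by (simp add: T_def)
qed

text \<open>
  As \<open>D\<close> lowers the degree in \<open>z\<close>, it kills \<open>y\<^sub>2, \<dots>, y\<^sub>m\<close>, the function \<open>D z\<close> is free of \<open>z\<close>, and
  \<open>D y\<^sub>1 = P'(z) * D z / M\<close> has degree less than \<open>d\<close> in \<open>z\<close>. By the normal form, the last function is a
  polynomial in \<open>z, y\<^sub>2, \<dots>, y\<^sub>m\<close>. Its top coefficient in \<open>z\<close> is a nonzero multiple of \<open>D z / M\<close>, which
  is therefore a polynomial in \<open>y\<^sub>2, \<dots>, y\<^sub>m\<close>.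
\<close>

theorem lnd_eq_multiple_of_delta:
  assumes D: "lnd A D"
  shows "\<exists>h\<in>poly_functions_on Y {2..m}. \<forall>f\<in>carrier A. D f = h \<otimes>\<^bsub>A\<^esub> delta f"
proof -
  have der: "derivation A D" using D by (simp add: lnd_def)
  have y: "D (coord Y j) = \<zero>\<^bsub>A\<^esub>" if j: "j \<in> {2..m}" for j
  proof (rule laurent_of_eq_0_imp)
    show Dj: "D (coord Y j) \<in> carrier A" by (rule derivation_carrier[OF der]) (use j in auto)
    have "coef (laurent_of (D (coord Y j))) w = 0" for w
    proof (rule ccontr)
      assume "coef (laurent_of (D (coord Y j))) w \<noteq> 0"
      then have "expo w 0 < expo (gen_expo j) 0" "0 \<le> expo w 0"
        using lnd_lowers_degree[OF D, of j w] expo_nonneg[OF Dj, of w] j by auto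
      then show False using j by (simp add: gen_expo_def lookup_single)
    qed
    then show "laurent_of (D (coord Y j)) = 0" by (simp add: poly_mapping_eqI)
  qed
  define G where "G = laurent_of (D (coord Y 0))"
  define W where "W = laurent_of (D (coord Y 1))"
  have Dz: "D (coord Y 0) \<in> carrier A" by (rule derivation_carrier[OF der]) simp
  have Dy1: "D (coord Y 1) \<in> carrier A"
    by (rule derivation_carrier[OF der carrier_coord[OF m_ge_1]])
  have G0: "expo c 0 = 0" if "coef G c \<noteq> 0" for c
    using lnd_lowers_degree[OF D, of 0 c] expo_nonneg[OF Dz, of c] that
    by (simp add: G_def gen_expo_def)
  have W_small: "expo w 0 < int (degree P)" if "coef W w \<noteq> 0" for w
    using lnd_lowers_degree[OF D m_ge_1, of w] that
    by (simp add: W_def gen_expo_def lookup_minus expo_kap)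
  have W_basis: "w \<in> basis_expos" if "coef W w \<noteq> 0" for w
    using small_degree_normal_form(2)[OF Dy1] W_small that by (auto simp: W_def in_keys_iff)
  have rel: "W * lmon kap 1 = G * zderiv kap (gen 1)"
    using derivation_eq_multiple_of_zderiv[OF der y carrier_coord[OF m_ge_1]] m_ge_1
    by (simp add: W_def G_def)
  \<comment> \<open>Comparing the coefficients of the top power of \<open>z\<close> shows that \<open>M\<close> divides \<open>D z\<close>.\<close>
  have div: "(\<forall>j\<in>{2..m}. int (k j) \<le> expo c j) \<and> Poly_Mapping.keys c \<subseteq> {2..m}" if c: "coef G c \<noteq> 0" for c
  proof -
    let ?top = "Poly_Mapping.single 0 (int (degree P) - 1) :: exponent"
    let ?w = "c + ?top - kap"
    have "coef (G * zderiv kap (gen 1)) (c + ?top)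
        = (\<Sum>i\<le>degree P. of_nat i * coeff P i * coef G (c + ?top - Poly_Mapping.single 0 (int i - 1)))"
      unfolding mult.commute[of G] zderiv_gen_1 sum_distrib_right lookup_sum coef_mono_mult ..
    also have "\<dots> = (\<Sum>i\<le>degree P. if i = degree P then of_nat i * coeff P i * coef G c else 0)"
    proof (rule sum.cong)
      fix i assume "i \<in> {..degree P}"
      show "of_nat i * coeff P i * coef G (c + ?top - Poly_Mapping.single 0 (int i - 1))
          = (if i = degree P then of_nat i * coeff P i * coef G c else 0)"
      proof (cases "i = degree P")
        case False
        then have "expo (c + ?top - Poly_Mapping.single 0 (int i - 1)) 0 \<noteq> 0"
          using G0[OF c] by (simp add: lookup_add lookup_minus)
        then have "coef G (c + ?top - Poly_Mapping.single 0 (int i - 1)) = 0" using G0 by blast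
        then show ?thesis using False by simp
      qed simp
    qed simp
    also have "\<dots> = of_nat (degree P) * lead_coeff P * coef G c" by simp
    finally have "coef (W * lmon kap 1) (c + ?top) \<noteq> 0"
      unfolding rel using c lead_coeff_nonzero degree_ge_2 by auto
    then have "coef W ?w \<noteq> 0" by (simp add: mult.commute[of W] coef_mono_mult)
    then have w: "?w \<in> basis_expos" by (rule W_basis)
    have w0: "expo ?w 0 = int (degree P) - 1"
      using G0[OF c] by (simp add: lookup_add lookup_minus expo_kap)
    then have "expo ?w 0 div int (degree P) = 0" using degree_ge_2 by simp
    then have "\<forall>j\<in>{2..m}. 0 \<le> expo ?w j" using w by (simp add: basis_expos_def)
    moreover have "expo ?w j = expo c j - int (k j)" if "j \<in> {2..m}" for j
      using that by (simp add: lookup_add lookup_minus expo_kap lookup_single)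
    ultimately have 1: "\<forall>j\<in>{2..m}. int (k j) \<le> expo c j" by simp
    have "Poly_Mapping.keys c \<subseteq> {2..m}"
    proof
      fix i assume i: "i \<in> Poly_Mapping.keys c"
      then have "i \<noteq> 0" using G0[OF c] by (metis in_keys_iff)
      show "i \<in> {2..m}"
      proof (rule ccontr)
        assume "i \<notin> {2..m}"
        then have "expo ?w i \<noteq> 0" using i \<open>i \<noteq> 0\<close>
          by (auto simp: lookup_add lookup_minus expo_kap lookup_single in_keys_iff)
        then have "i \<in> {0..m} - {1}" using w by (auto simp: basis_expos_def in_keys_iff)
        then show False using \<open>i \<notin> {2..m}\<close> \<open>i \<noteq> 0\<close> by auto
      qed
    qed
    then show ?thesis using 1 by blast
  qed
  define g where "g c = (\<lambda>x\<in>Y. \<Prod>j\<in>{2..m}. x j ^ nat (expo c j - int (k j)))" for c :: exponent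
  define h where "h = (\<lambda>x\<in>Y. \<Sum>c\<in>Poly_Mapping.keys G. (coef G c \<odot>\<^bsub>A\<^esub> g c) x)"
  have g: "g c \<in> poly_functions_on Y {2..m}" for c unfolding g_def by (rule monomial_in_poly_functions_y)
  have gA: "g c \<in> carrier A" for c by (rule carrier_poly_functions[OF _ g]) auto
  have "coef G c \<odot>\<^bsub>A\<^esub> g c \<in> poly_functions_on Y {2..m}" for c
    unfolding smult_eq_mult coord_ring_simps(2)
    by (rule poly_functions_on_mult[OF _ poly_functions_on_const g]) simp
  then have h: "h \<in> poly_functions_on Y {2..m}"
    unfolding h_def by (rule poly_functions_on_sum)
  have "laurent_of h = (\<Sum>c\<in>Poly_Mapping.keys G. lmon 0 (coef G c) * laurent_of (g c))"
    unfolding h_def by (subst laurent_of_sum) (simp_all add: gA)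
  also have "\<dots> = (\<Sum>c\<in>Poly_Mapping.keys G. lmon (c - kap) (coef G c))"
  proof (rule sum.cong)
    fix c assume "c \<in> Poly_Mapping.keys G"
    then have c: "coef G c \<noteq> 0" by (simp add: in_keys_iff)
    have "(\<Sum>j\<in>{2..m}. Poly_Mapping.single j (int (nat (expo c j - int (k j))))) = c - kap"
    proof (rule poly_mapping_eqI)
      fix i
      have "expo c i = 0" if "i \<notin> {2..m}"
        using div[OF c] that by (metis in_keys_iff subsetD)
      then show "expo (\<Sum>j\<in>{2..m}. Poly_Mapping.single j (int (nat (expo c j - int (k j))))) i
          = expo (c - kap) i"
        using div[OF c] by (auto simp: lookup_sum lookup_single when_def lookup_minus expo_kap)
    qed
    then show "lmon 0 (coef G c) * laurent_of (g c) = lmon (c - kap) (coef G c)"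
      unfolding g_def laurent_of_monomial by (simp add: mult_single)
  qed simp
  finally have "laurent_of h * lmon kap 1 = (\<Sum>c\<in>Poly_Mapping.keys G. lmon c (coef G c))"
    by (simp add: sum_distrib_right mult_single)
  then have hG: "laurent_of h * lmon kap 1 = G"
    using laurent_eq_sum_mono[of G] by simp
  show ?thesis
  proof (rule bexI[OF _ h], intro ballI)
    fix f assume f: "f \<in> carrier A"
    have hA: "h \<in> carrier A" by (rule carrier_poly_functions[OF _ h]) auto
    have "laurent_of (D f) * lmon kap 1 = laurent_of (h \<otimes>\<^bsub>A\<^esub> delta f) * lmon kap 1"
      using derivation_eq_multiple_of_zderiv[OF der y f] hA f
      by (simp add: G_def[symmetric] hG[symmetric] delta_carrier laurent_of_delta mult_ac)
    moreover have "lmon kap (1::'k) \<noteq> 0" by (metis lookup_single_eq lookup_zero zero_neq_one)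
    ultimately have "laurent_of (D f) = laurent_of (h \<otimes>\<^bsub>A\<^esub> delta f)" by simp
    then show "D f = h \<otimes>\<^bsub>A\<^esub> delta f"
      using f hA der by (intro laurent_of_inject) (simp_all add: derivation_carrier delta_carrier)
  qed
qed

theorem makar_limanov_eq: "makar_limanov A = poly_functions_on Y {2..m}"
proof (intro equalityI subsetI)
  fix f assume "f \<in> makar_limanov A"
  then have "f \<in> carrier A" "delta f = \<zero>\<^bsub>A\<^esub>"
    using lnd_delta by (auto simp: makar_limanov_def)
  then show "f \<in> poly_functions_on Y {2..m}" using poly_functions_y_iff by blast
next
  fix f assume f: "f \<in> poly_functions_on Y {2..m}"
  have fA: "f \<in> carrier A" by (rule carrier_poly_functions[OF _ f]) auto
  have "D f = \<zero>\<^bsub>A\<^esub>" if D: "lnd A D" for D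
  proof -
    obtain h where "h \<in> poly_functions_on Y {2..m}" "D f = h \<otimes>\<^bsub>A\<^esub> delta f"
      using lnd_eq_multiple_of_delta[OF D] fA by blast
    then show ?thesis
      using poly_functions_y_iff[OF fA] f by (auto simp: coord_ring_simps fun_eq_iff)
  qed
  then show "f \<in> makar_limanov A" using fA by (simp add: makar_limanov_def)
qed

section \<open>Automorphisms of the coordinate ring\<close>

lemma algebra_autsD:
  assumes "\<psi> \<in> algebra_auts A"
  shows "f \<in> carrier A \<Longrightarrow> \<psi> f \<in> carrier A"
    and "f \<in> carrier A \<Longrightarrow> g \<in> carrier A \<Longrightarrow> \<psi> (f \<otimes>\<^bsub>A\<^esub> g) = \<psi> f \<otimes>\<^bsub>A\<^esub> \<psi> g"
    and "f \<in> carrier A \<Longrightarrow> g \<in> carrier A \<Longrightarrow> \<psi> (f \<oplus>\<^bsub>A\<^esub> g) = \<psi> f \<oplus>\<^bsub>A\<^esub> \<psi> g"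
    and "f \<in> carrier A \<Longrightarrow> \<psi> (c \<odot>\<^bsub>A\<^esub> f) = c \<odot>\<^bsub>A\<^esub> \<psi> f"
    and "\<psi> \<one>\<^bsub>A\<^esub> = \<one>\<^bsub>A\<^esub>"
    and "bij_betw \<psi> (carrier A) (carrier A)"
  using assms unfolding algebra_auts_def ring_iso_def ring_hom_def by auto

lemma algebra_auts_const:
  assumes "\<psi> \<in> algebra_auts A"
  shows "\<psi> (\<lambda>x\<in>Y. c) = (\<lambda>x\<in>Y. c)"
proof -
  have eq: "(\<lambda>x\<in>Y. c) = c \<odot>\<^bsub>A\<^esub> \<one>\<^bsub>A\<^esub>" by (auto simp: coord_ring_simps)
  have "\<one>\<^bsub>A\<^esub> \<in> carrier A" using carrier_const[of 1] by (simp add: coord_ring_simps)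
  then show ?thesis unfolding eq using algebra_autsD(4,5)[OF assms] by simp
qed

definition aut_inv :: "(((nat \<Rightarrow> 'k) \<Rightarrow> 'k) \<Rightarrow> ((nat \<Rightarrow> 'k) \<Rightarrow> 'k)) \<Rightarrow> ((nat \<Rightarrow> 'k) \<Rightarrow> 'k) \<Rightarrow> ((nat \<Rightarrow> 'k) \<Rightarrow> 'k)"
  where "aut_inv \<psi> = inv_into (carrier A) \<psi>"

lemma
  assumes "\<psi> \<in> algebra_auts A" and "f \<in> carrier A"
  shows aut_inv_left: "aut_inv \<psi> (\<psi> f) = f" and aut_inv_right: "\<psi> (aut_inv \<psi> f) = f"
    and aut_inv_carrier: "aut_inv \<psi> f \<in> carrier A"
proof -
  have inj: "inj_on \<psi> (carrier A)" and img: "f \<in> \<psi> ` carrier A"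
    using algebra_autsD(6)[OF assms(1)] assms(2) by (auto simp: bij_betw_def)
  show "aut_inv \<psi> (\<psi> f) = f" "\<psi> (aut_inv \<psi> f) = f" "aut_inv \<psi> f \<in> carrier A"
    unfolding aut_inv_def
    using inv_into_f_f[OF inj assms(2)] f_inv_into_f[OF img] inv_into_into[OF img] by auto
qed

lemma algebra_auts_inject:
  assumes "\<psi> \<in> algebra_auts A" "f \<in> carrier A" "g \<in> carrier A" "\<psi> f = \<psi> g"
  shows "f = g"
  using assms aut_inv_left by metis

lemma aut_inv_algebra_auts:
  assumes \<psi>: "\<psi> \<in> algebra_auts A"
  shows "aut_inv \<psi> \<in> algebra_auts A"
proof -
  note c = aut_inv_carrier[OF \<psi>] and r = aut_inv_right[OF \<psi>]
  have one: "\<one>\<^bsub>A\<^esub> \<in> carrier A" using carrier_const[of 1] by (simp add: coord_ring_simps)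
  have "aut_inv \<psi> (f \<otimes>\<^bsub>A\<^esub> g) = aut_inv \<psi> f \<otimes>\<^bsub>A\<^esub> aut_inv \<psi> g"
    if "f \<in> carrier A" "g \<in> carrier A" for f g
    by (rule algebra_auts_inject[OF \<psi>]) (simp_all add: c r that algebra_autsD(2)[OF \<psi>])
  moreover have "aut_inv \<psi> (f \<oplus>\<^bsub>A\<^esub> g) = aut_inv \<psi> f \<oplus>\<^bsub>A\<^esub> aut_inv \<psi> g"
    if "f \<in> carrier A" "g \<in> carrier A" for f g
    by (rule algebra_auts_inject[OF \<psi>]) (simp_all add: c r that algebra_autsD(3)[OF \<psi>])
  moreover have "aut_inv \<psi> (a \<odot>\<^bsub>A\<^esub> f) = a \<odot>\<^bsub>A\<^esub> aut_inv \<psi> f" if "f \<in> carrier A" for a f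
    by (rule algebra_auts_inject[OF \<psi>]) (simp_all add: c r that algebra_autsD(4)[OF \<psi>])
  moreover have "aut_inv \<psi> \<one>\<^bsub>A\<^esub> = \<one>\<^bsub>A\<^esub>"
    by (rule algebra_auts_inject[OF \<psi>]) (simp_all add: c r one algebra_autsD(5)[OF \<psi>])
  moreover have "bij_betw (aut_inv \<psi>) (carrier A) (carrier A)"
    unfolding aut_inv_def by (rule bij_betw_inv_into[OF algebra_autsD(6)[OF \<psi>]])
  ultimately show ?thesis
    unfolding algebra_auts_def ring_iso_def ring_hom_def using c by auto
qed

lemma algebra_auts_zero:
  assumes "\<psi> \<in> algebra_auts A"
  shows "\<psi> \<zero>\<^bsub>A\<^esub> = \<zero>\<^bsub>A\<^esub>"
  using algebra_auts_const[OF assms, of 0] by (simp only: coord_ring_simps)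

lemma lnd_conjugate:
  assumes \<psi>: "\<psi> \<in> algebra_auts A" and D: "lnd A D"
  shows "lnd A (\<lambda>f. aut_inv \<psi> (D (\<psi> f)))"
proof -
  let ?\<theta> = "aut_inv \<psi>"
  have \<theta>: "?\<theta> \<in> algebra_auts A" by (rule aut_inv_algebra_auts[OF \<psi>])
  have der: "derivation A D" using D by (simp add: lnd_def)
  note c = algebra_autsD(1)[OF \<psi>] algebra_autsD(1)[OF \<theta>] derivation_carrier[OF der]
  have D_rules: "D (f \<oplus>\<^bsub>A\<^esub> g) = D f \<oplus>\<^bsub>A\<^esub> D g" "D (a \<odot>\<^bsub>A\<^esub> f) = a \<odot>\<^bsub>A\<^esub> D f"
    "D (f \<otimes>\<^bsub>A\<^esub> g) = (D f \<otimes>\<^bsub>A\<^esub> g) \<oplus>\<^bsub>A\<^esub> (f \<otimes>\<^bsub>A\<^esub> D g)"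
    if "f \<in> carrier A" "g \<in> carrier A" for f g a
    using der that unfolding derivation_def by blast+
  have "derivation A (\<lambda>f. ?\<theta> (D (\<psi> f)))"
    unfolding derivation_def
  proof (intro conjI ballI allI)
    show "(\<lambda>f. ?\<theta> (D (\<psi> f))) \<in> carrier A \<rightarrow> carrier A" using c by auto
  next
    fix f g assume "f \<in> carrier A" "g \<in> carrier A"
    then show "?\<theta> (D (\<psi> (f \<oplus>\<^bsub>A\<^esub> g))) = ?\<theta> (D (\<psi> f)) \<oplus>\<^bsub>A\<^esub> ?\<theta> (D (\<psi> g))"
      by (simp add: c D_rules(1) algebra_autsD(3)[OF \<psi>] algebra_autsD(3)[OF \<theta>])
  next
    fix a f assume "f \<in> carrier A"
    then show "?\<theta> (D (\<psi> (a \<odot>\<^bsub>A\<^esub> f))) = a \<odot>\<^bsub>A\<^esub> ?\<theta> (D (\<psi> f))"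
      by (simp add: c D_rules(2)[OF _ carrier_zero] algebra_autsD(4)[OF \<psi>] algebra_autsD(4)[OF \<theta>])
  next
    fix f g assume "f \<in> carrier A" "g \<in> carrier A"
    then show "?\<theta> (D (\<psi> (f \<otimes>\<^bsub>A\<^esub> g)))
        = (?\<theta> (D (\<psi> f)) \<otimes>\<^bsub>A\<^esub> g) \<oplus>\<^bsub>A\<^esub> (f \<otimes>\<^bsub>A\<^esub> ?\<theta> (D (\<psi> g)))"
      by (simp add: c D_rules(3) algebra_autsD(2)[OF \<psi>] algebra_autsD(2,3)[OF \<theta>] aut_inv_left[OF \<psi>])
  qed
  moreover have "\<exists>n. ((\<lambda>f. ?\<theta> (D (\<psi> f))) ^^ n) f = \<zero>\<^bsub>A\<^esub>" if f: "f \<in> carrier A" for f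
  proof -
    obtain n where n: "(D ^^ n) (\<psi> f) = \<zero>\<^bsub>A\<^esub>" using D c(1)[OF f] unfolding lnd_def by blast
    have "(D ^^ i) (\<psi> f) \<in> carrier A \<and> ((\<lambda>f. ?\<theta> (D (\<psi> f))) ^^ i) f = ?\<theta> ((D ^^ i) (\<psi> f))" for i
      by (induction i) (auto simp: f c aut_inv_left[OF \<psi>] aut_inv_right[OF \<psi>])
    then show ?thesis using n algebra_auts_zero[OF \<theta>] by metis
  qed
  ultimately show ?thesis by (simp add: lnd_def)
qed

text \<open>
  The conjugate of the canonical derivation is locally nilpotent and hence kills the Makar-Limanov
  invariant.
\<close>

lemma aut_preserves_poly_functions_y:
  assumes \<psi>: "\<psi> \<in> algebra_auts A" and f: "f \<in> poly_functions_on Y {2..m}"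
  shows "\<psi> f \<in> poly_functions_on Y {2..m}"
proof -
  have fA: "f \<in> carrier A" by (rule carrier_poly_functions[OF _ f]) auto
  have "aut_inv \<psi> (delta (\<psi> f)) = \<zero>\<^bsub>A\<^esub>"
    using f lnd_conjugate[OF \<psi> lnd_delta] fA unfolding makar_limanov_eq[symmetric] makar_limanov_def by blast
  then have "delta (\<psi> f) = \<psi> \<zero>\<^bsub>A\<^esub>"
    using aut_inv_right[OF \<psi>] fA by (metis algebra_autsD(1)[OF \<psi>] delta_carrier)
  then show ?thesis
    using fA by (simp add: poly_functions_y_iff algebra_autsD(1)[OF \<psi>] algebra_auts_zero[OF \<psi>])
qed

lemma poly_functions_y_expo:
  assumes f: "f \<in> poly_functions_on Y {2..m}" and u: "coef (laurent_of f) u \<noteq> 0"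
  shows "Poly_Mapping.keys u \<subseteq> {2..m}" and "0 \<le> expo u j"
proof -
  have fA: "f \<in> carrier A" by (rule carrier_poly_functions[OF _ f]) auto
  then have "zderiv kap (laurent_of f) = 0"
    using poly_functions_y_iff[OF fA] f laurent_of_delta[OF fA] by simp
  then have deg0: "expo w 0 = 0" if "coef (laurent_of f) w \<noteq> 0" for w
    using that by (rule zderiv_eq_0_imp)
  then have "expo w 0 < int (degree P)" if "coef (laurent_of f) w \<noteq> 0" for w
    using that degree_ge_2 by simp
  then have b: "u \<in> basis_expos"
    using small_degree_normal_form(2)[OF fA] u by (auto simp: in_keys_iff)
  show keys: "Poly_Mapping.keys u \<subseteq> {2..m}"
  proof
    fix i assume i: "i \<in> Poly_Mapping.keys u"
    then have "i \<noteq> 0" using deg0[OF u] by (metis in_keys_iff)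
    moreover have "i \<in> {0..m} - {1}" using b i by (auto simp: basis_expos_def)
    ultimately show "i \<in> {2..m}" by auto
  qed
  show "0 \<le> expo u j"
  proof (cases "j \<in> Poly_Mapping.keys u")
    case True
    then show ?thesis using b keys deg0[OF u] by (auto simp: basis_expos_def)
  next
    case False
    then show ?thesis by (simp add: in_keys_iff)
  qed
qed

text \<open>
  If the second derivative of \<open>f\<close> vanishes then \<open>f\<close> is linear in \<open>z\<close>. As the degree of \<open>P\<close> is at
  least \<open>2\<close>, the coefficient of \<open>z\<close> is then a polynomial in the other variables, so \<open>M\<close> divides
  \<open>delta f\<close>: the ideal of all \<open>delta f\<close> that are killed by \<open>delta\<close> is generated by \<open>M\<close>.
\<close>

lemma delta_delta_eq_0_imp:
  assumes f: "f \<in> carrier A" and dd: "delta (delta f) = \<zero>\<^bsub>A\<^esub>"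
  shows "\<exists>s\<in>carrier A. delta f = (\<lambda>x\<in>Y. monomial_M x) \<otimes>\<^bsub>A\<^esub> s"
proof -
  let ?p = "laurent_of f"
  have z: "zderiv kap (zderiv kap ?p) = 0"
    using dd f by (metis delta_carrier laurent_of_delta laurent_of_zero)
  have le1: "expo u 0 = 0 \<or> expo u 0 = 1" if u: "coef ?p u \<noteq> 0" for u
  proof (rule ccontr)
    assume not: "\<not> ?thesis"
    let ?w = "u + kap - unit_expo 0"
    have "coef (zderiv kap ?p) ?w \<noteq> 0" using u not by (simp add: coef_zderiv)
    then have "expo ?w 0 = 0" using z by (rule zderiv_eq_0_imp[rotated])
    then show False using not by (simp add: lookup_add lookup_minus expo_kap)
  qed
  then have "expo u 0 < int (degree P)" if "coef ?p u \<noteq> 0" for u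
    using that degree_ge_2 by force
  then have keys: "Poly_Mapping.keys ?p \<subseteq> basis_expos"
    by (rule small_degree_normal_form(2)[OF f])
  define K where "K = {u \<in> Poly_Mapping.keys ?p. expo u 0 = 1}"
  define g where "g u = (\<lambda>x\<in>Y. \<Prod>j\<in>{2..m}. x j ^ nat (expo u j))" for u :: exponent
  define s where "s = (\<lambda>x\<in>Y. \<Sum>u\<in>K. (coef ?p u \<odot>\<^bsub>A\<^esub> g u) x)"
  have g: "g u \<in> carrier A" for u
    unfolding g_def by (rule carrier_poly_functions[OF _ monomial_in_poly_functions_y]) auto
  have s: "s \<in> carrier A"
    unfolding s_def coord_ring_simps(1)
    by (rule poly_functions_on_sum) (use g carrier_smult in \<open>auto simp: coord_ring_simps(1)\<close>)
  have Lg: "laurent_of (g u) = lmon (u - unit_expo 0) 1" if u: "u \<in> K" for u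
  proof -
    have u0: "expo u 0 = 1" and "u \<in> basis_expos" using u keys by (auto simp: K_def)
    then have b: "\<forall>j\<in>{2..m}. 0 \<le> expo u j" "Poly_Mapping.keys u \<subseteq> {0..m} - {1}"
      using degree_ge_2 by (auto simp: basis_expos_def)
    have "(\<Sum>j\<in>{2..m}. Poly_Mapping.single j (int (nat (expo u j)))) = u - unit_expo 0"
    proof (rule poly_mapping_eqI)
      fix i
      have "expo u i = 0" if "i \<noteq> 0" "i \<notin> {2..m}"
      proof -
        have "i \<notin> {0..m} - {1}" using that by (cases "i = 1") auto
        then show ?thesis using b(2) by (metis in_keys_iff subsetD)
      qed
      then show "expo (\<Sum>j\<in>{2..m}. Poly_Mapping.single j (int (nat (expo u j)))) i = expo (u - unit_expo 0) i"
        using b(1) u0 by (auto simp: lookup_sum lookup_single when_def lookup_minus)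
    qed
    then show ?thesis unfolding g_def laurent_of_monomial by simp
  qed
  have "laurent_of s = (\<Sum>u\<in>K. lmon (u - unit_expo 0) (coef ?p u))"
    unfolding s_def by (subst laurent_of_sum) (auto simp: g Lg mult_single)
  then have "lmon kap 1 * laurent_of s = (\<Sum>u\<in>K. lmon (u + kap - unit_expo 0) (coef ?p u))"
    by (simp add: sum_distrib_left mult_single algebra_simps)
  also have "\<dots> = (\<Sum>u\<in>Poly_Mapping.keys ?p. lmon (u + kap - unit_expo 0) (of_int (expo u 0) * coef ?p u))"
  proof (rule sum.mono_neutral_cong_left)
    show "\<forall>u\<in>Poly_Mapping.keys ?p - K. lmon (u + kap - unit_expo 0) (of_int (expo u 0) * coef ?p u) = 0"
    proof
      fix u assume "u \<in> Poly_Mapping.keys ?p - K"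
      then have "expo u 0 = 0" using le1[of u] by (auto simp: K_def in_keys_iff)
      then show "lmon (u + kap - unit_expo 0) (of_int (expo u 0) * coef ?p u) = 0" by simp
    qed
  qed (auto simp: K_def)
  also have "\<dots> = laurent_of (delta f)" by (simp add: laurent_of_delta[OF f] zderiv_def)
  finally have "delta f = (\<lambda>x\<in>Y. monomial_M x) \<otimes>\<^bsub>A\<^esub> s"
    by (intro laurent_of_inject) (simp_all add: f s delta_carrier carrier_M laurent_of_M)
  then show ?thesis using s by blast
qed

text \<open>
  The derivation \<open>\<psi>\<^sup>-\<^sup>1 delta \<psi>\<close> is \<open>h delta\<close> for some \<open>h\<close> in the kernel. For the preimage \<open>f\<close> of \<open>z\<close>, this
  gives \<open>\<psi>\<^sup>-\<^sup>1 M = h * delta f\<close>, and \<open>delta f\<close> is again in the kernel, so it is divisible by \<open>M\<close>.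
  Applying \<open>\<psi>\<close> shows that \<open>\<psi> M\<close> divides \<open>M\<close>.
\<close>

lemma aut_M_divides_M:
  assumes \<psi>: "\<psi> \<in> algebra_auts A"
  shows "\<exists>r\<in>carrier A. (\<lambda>x\<in>Y. monomial_M x) = \<psi> (\<lambda>x\<in>Y. monomial_M x) \<otimes>\<^bsub>A\<^esub> r"
proof -
  let ?\<theta> = "aut_inv \<psi>" and ?M = "\<lambda>x\<in>Y. monomial_M x"
  have \<theta>: "?\<theta> \<in> algebra_auts A" by (rule aut_inv_algebra_auts[OF \<psi>])
  obtain h where h: "h \<in> poly_functions_on Y {2..m}"
    and conj: "\<And>f. f \<in> carrier A \<Longrightarrow> ?\<theta> (delta (\<psi> f)) = h \<otimes>\<^bsub>A\<^esub> delta f"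
    using lnd_eq_multiple_of_delta[OF lnd_conjugate[OF \<psi> lnd_delta]] by blast
  have hA: "h \<in> carrier A" by (rule carrier_poly_functions[OF _ h]) auto
  define f where "f = ?\<theta> (coord Y 0)"
  have f: "f \<in> carrier A" unfolding f_def by (rule aut_inv_carrier[OF \<psi>]) simp
  have \<theta>M: "?\<theta> ?M = h \<otimes>\<^bsub>A\<^esub> delta f"
    using conj[OF f] by (simp add: f_def aut_inv_right[OF \<psi>] delta_z)
  have "?M \<noteq> \<zero>\<^bsub>A\<^esub>"
  proof
    assume "?M = \<zero>\<^bsub>A\<^esub>"
    then have "laurent_of ?M = 0" by (simp only: laurent_of_zero)
    then show False unfolding laurent_of_M using lmon_nonzero[of "1 :: 'k" kap] by simp
  qed
  then have "?\<theta> ?M \<noteq> ?\<theta> \<zero>\<^bsub>A\<^esub>"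
    using algebra_auts_inject[OF \<theta> carrier_M carrier_zero] by blast
  then have "h \<otimes>\<^bsub>A\<^esub> delta f \<noteq> \<zero>\<^bsub>A\<^esub>"
    unfolding \<theta>M algebra_auts_zero[OF \<theta>] .
  then have h_nz: "laurent_of h \<noteq> 0"
    using laurent_of_eq_0_imp[of "h \<otimes>\<^bsub>A\<^esub> delta f"] hA f by (auto simp: delta_carrier)
  have "?\<theta> ?M \<in> poly_functions_on Y {2..m}"
    by (rule aut_preserves_poly_functions_y[OF \<theta> monomial_in_poly_functions_y])
  then have "delta (h \<otimes>\<^bsub>A\<^esub> delta f) = \<zero>\<^bsub>A\<^esub>"
    unfolding \<theta>M using hA f by (subst poly_functions_y_iff[symmetric]) (simp_all add: delta_carrier)
  then have "laurent_of (delta h) * laurent_of (delta f) + laurent_of h * laurent_of (delta (delta f)) = 0"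
    using laurent_of_derivation_mult[OF derivation_delta hA delta_carrier[OF f]] by simp
  moreover have "delta h = \<zero>\<^bsub>A\<^esub>" using h poly_functions_y_iff[OF hA] by simp
  ultimately have "laurent_of (delta (delta f)) = 0" using h_nz by simp
  then have "delta (delta f) = \<zero>\<^bsub>A\<^esub>" by (intro laurent_of_eq_0_imp delta_carrier f)
  then obtain s where s: "s \<in> carrier A" "delta f = ?M \<otimes>\<^bsub>A\<^esub> s"
    using delta_delta_eq_0_imp[OF f] by blast
  have "?M = \<psi> (h \<otimes>\<^bsub>A\<^esub> (?M \<otimes>\<^bsub>A\<^esub> s))"
    using \<theta>M aut_inv_right[OF \<psi> carrier_M] by (simp only: s(2))
  also have "h \<otimes>\<^bsub>A\<^esub> (?M \<otimes>\<^bsub>A\<^esub> s) = ?M \<otimes>\<^bsub>A\<^esub> (h \<otimes>\<^bsub>A\<^esub> s)"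
    by (auto simp: coord_ring_simps mult_ac)
  also have "\<psi> \<dots> = \<psi> ?M \<otimes>\<^bsub>A\<^esub> \<psi> (h \<otimes>\<^bsub>A\<^esub> s)"
    using hA s carrier_M by (intro algebra_autsD(2)[OF \<psi>]) auto
  finally have "?M = \<psi> ?M \<otimes>\<^bsub>A\<^esub> \<psi> (h \<otimes>\<^bsub>A\<^esub> s)" .
  then show ?thesis
    by (rule bexI[where x = "\<psi> (h \<otimes>\<^bsub>A\<^esub> s)"]) (intro algebra_autsD(1)[OF \<psi>] carrier_mult hA s(1))
qed

definition tdeg :: "exponent \<Rightarrow> int" where
  "tdeg u = (\<Sum>j\<in>{2..m}. expo u j)"

lemma tdeg_add: "tdeg (u + v) = tdeg u + tdeg v"
  by (simp add: tdeg_def lookup_add sum.distrib)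

lemma tdeg_0 [simp]: "tdeg 0 = 0"
  by (simp add: tdeg_def)

lemma tdeg_unit_expo: "j \<in> {2..m} \<Longrightarrow> tdeg (unit_expo j) = 1"
  by (simp add: tdeg_def lookup_single when_def)

lemma gen_eq_lmon: "j \<in> {2..m} \<Longrightarrow> gen j = lmon (unit_expo j) 1"
  by (simp add: gen_def)

text \<open>
  Every \<open>y\<^sub>j\<close> divides \<open>M\<close>, so its image divides \<open>\<psi> M\<close> and thereby \<open>M\<close>. Divisors of monomials are
  monomials up to a scalar, and the degree is positive since automorphisms take constants to
  constants.
\<close>

lemma aut_coord_monomial:
  assumes \<psi>: "\<psi> \<in> algebra_auts A" and j: "j \<in> {2..m}"
  shows "\<exists>v a. a \<noteq> 0 \<and> laurent_of (\<psi> (coord Y j)) = lmon v a \<and>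
    Poly_Mapping.keys v \<subseteq> {2..m} \<and> (\<forall>i. 0 \<le> expo v i) \<and> 1 \<le> tdeg v"
proof -
  let ?M = "\<lambda>x\<in>Y. monomial_M x"
  have yA: "coord Y j \<in> carrier A" using j by simp
  obtain r where r: "r \<in> carrier A" "?M = \<psi> ?M \<otimes>\<^bsub>A\<^esub> r"
    using aut_M_divides_M[OF \<psi>] by blast
  \<comment> \<open>The exponents of the cofactor of \<open>y\<^sub>j\<close> in \<open>M\<close>.\<close>
  define b where "b = k(j := k j - 1)"
  define g where "g = (\<lambda>x\<in>Y. \<Prod>i\<in>{2..m}. x i ^ b i)"
  have g: "g \<in> carrier A" unfolding g_def by (rule carrier_poly_functions[OF _ monomial_in_poly_functions_y]) auto
  have k: "k = b(j := Suc (b j))" using k_ge_2[OF j] by (auto simp: b_def)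
  have M: "?M = coord Y j \<otimes>\<^bsub>A\<^esub> g"
  proof (rule ext)
    fix x
    show "?M x = (coord Y j \<otimes>\<^bsub>A\<^esub> g) x"
      using prod_power_Suc[of "{2..m}" j x b] j k by (auto simp: coord_ring_simps coord_def g_def)
  qed
  have "laurent_of ?M = laurent_of (\<psi> (coord Y j)) * (laurent_of (\<psi> g) * laurent_of r)"
    by (subst r(2), subst M)
      (use yA g r(1) in \<open>simp add: algebra_autsD(1,2)[OF \<psi>] mult.assoc\<close>)
  then have "laurent_of (\<psi> (coord Y j)) * (laurent_of (\<psi> g) * laurent_of r) = lmon kap 1"
    unfolding laurent_of_M ..
  then obtain v a where va: "a \<noteq> 0" "laurent_of (\<psi> (coord Y j)) = lmon v a"
    using mono_eq_mult_imp_mono[OF _ one_neq_zero] by blast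
  have "\<psi> (coord Y j) \<in> poly_functions_on Y {2..m}"
    by (rule aut_preserves_poly_functions_y[OF \<psi>]) (use j in \<open>auto intro: poly_functions_on_coord\<close>)
  then have v: "Poly_Mapping.keys v \<subseteq> {2..m}" "0 \<le> expo v i" for i
    using poly_functions_y_expo[of "\<psi> (coord Y j)" v] va by auto
  have "v \<noteq> 0"
  proof
    assume "v = 0"
    then have "laurent_of (\<psi> (coord Y j)) = laurent_of (\<psi> (\<lambda>x\<in>Y. a))"
      by (simp only: va(2) algebra_auts_const[OF \<psi>] laurent_of_const)
    then have "\<psi> (coord Y j) = \<psi> (\<lambda>x\<in>Y. a)"
      by (intro laurent_of_inject algebra_autsD(1)[OF \<psi>] yA carrier_const)
    then have "coord Y j = (\<lambda>x\<in>Y. a)" by (rule algebra_auts_inject[OF \<psi> yA carrier_const])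
    then have "lmon (unit_expo j) 1 = lmon 0 a"
      using laurent_of_coord[of j] gen_eq_lmon[OF j] j laurent_of_const[of a] by simp
    then have "coef (lmon (unit_expo j) (1::'k)) (unit_expo j) = coef (lmon 0 a) (unit_expo j)" by simp
    moreover have "unit_expo j \<noteq> 0" by (metis lookup_single_eq lookup_zero zero_neq_one)
    ultimately show False by (simp add: lookup_single)
  qed
  then obtain i where "expo v i \<noteq> 0" by (metis poly_mapping_eqI lookup_zero)
  then have i: "i \<in> {2..m}" "1 \<le> expo v i" using v(1) v(2)[of i] subsetD[of _ _ i] by (metis in_keys_iff, linarith)
  have "expo v i \<le> tdeg v"
    unfolding tdeg_def by (rule member_le_sum) (use i v(2) in auto)
  then show ?thesis using va v i by (intro exI[of _ v] exI[of _ a]) auto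
qed

text \<open>
  An automorphism does not decrease the degree of a monomial: every variable goes to a monomial of
  degree at least \<open>1\<close>.
\<close>

lemma aut_monomial:
  assumes \<psi>: "\<psi> \<in> algebra_auts A"
  shows "\<exists>w a. laurent_of (\<psi> (\<lambda>x\<in>Y. \<Prod>j\<in>{2..m}. x j ^ b j)) = lmon w a \<and> int (\<Sum>j\<in>{2..m}. b j) \<le> tdeg w"
proof -
  define Q where "Q f n \<longleftrightarrow> f \<in> carrier A \<and> (\<exists>w a. laurent_of (\<psi> f) = lmon w a \<and> int n \<le> tdeg w)"
    for f :: "(nat \<Rightarrow> 'k) \<Rightarrow> 'k" and n
  have Q_mult: "Q (f \<otimes>\<^bsub>A\<^esub> g) (n + n')" if f: "Q f n" and g: "Q g n'" for f g n n'
  proof -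
    obtain w a where w: "laurent_of (\<psi> f) = lmon w a" "int n \<le> tdeg w" and fA: "f \<in> carrier A"
      using f unfolding Q_def by blast
    obtain v c where v: "laurent_of (\<psi> g) = lmon v c" "int n' \<le> tdeg v" and gA: "g \<in> carrier A"
      using g unfolding Q_def by blast
    have "laurent_of (\<psi> (f \<otimes>\<^bsub>A\<^esub> g)) = lmon (w + v) (a * c)"
      using fA gA w v by (simp add: algebra_autsD(1,2)[OF \<psi>] mult_single)
    moreover have "int (n + n') \<le> tdeg (w + v)" using w v by (simp add: tdeg_add)
    ultimately show ?thesis using fA gA unfolding Q_def by auto
  qed
  have Q_1: "Q (\<lambda>x\<in>Y. 1) 0"
    unfolding Q_def algebra_auts_const[OF \<psi>] laurent_of_const
    by (intro conjI carrier_const exI[of _ 0] exI[of _ 1]) simp_all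
  have Q_pow: "Q (\<lambda>x\<in>Y. x j ^ n) n" if j: "j \<in> {2..m}" for j n
  proof (induction n)
    case 0
    show ?case using Q_1 by (simp only: power_0)
  next
    case (Suc n)
    have "Q (coord Y j) 1"
      using aut_coord_monomial[OF \<psi> j] j unfolding Q_def by fastforce
    then have "Q (coord Y j \<otimes>\<^bsub>A\<^esub> (\<lambda>x\<in>Y. x j ^ n)) (1 + n)" using Suc by (rule Q_mult)
    moreover have "coord Y j \<otimes>\<^bsub>A\<^esub> (\<lambda>x\<in>Y. x j ^ n) = (\<lambda>x\<in>Y. x j ^ Suc n)"
      by (auto simp: coord_ring_simps coord_def)
    ultimately show ?case by (simp only: plus_1_eq_Suc)
  qed
  have "Q (\<lambda>x\<in>Y. \<Prod>j\<in>J. x j ^ b j) (\<Sum>j\<in>J. b j)" if "finite J" "J \<subseteq> {2..m}" for J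
    using that
  proof (induction J rule: finite_induct)
    case empty
    show ?case using Q_1 by (simp only: prod.empty sum.empty)
  next
    case (insert j J)
    have "Q ((\<lambda>x\<in>Y. x j ^ b j) \<otimes>\<^bsub>A\<^esub> (\<lambda>x\<in>Y. \<Prod>j\<in>J. x j ^ b j)) (b j + (\<Sum>j\<in>J. b j))"
      by (rule Q_mult[OF Q_pow insert.IH]) (use insert.prems in auto)
    moreover have "(\<lambda>x\<in>Y. x j ^ b j) \<otimes>\<^bsub>A\<^esub> (\<lambda>x\<in>Y. \<Prod>j\<in>J. x j ^ b j) = (\<lambda>x\<in>Y. \<Prod>j\<in>insert j J. x j ^ b j)"
      using insert.hyps by (auto simp: coord_ring_simps)
    ultimately show ?case unfolding sum.insert[OF insert.hyps] by (simp only:)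
  qed
  from this[of "{2..m}"] show ?thesis unfolding Q_def by blast
qed

text \<open>
  Both \<open>\<psi>\<close> and its inverse do not decrease the degree of monomials, and the composition preserves the
  degree \<open>1\<close> of \<open>y\<^sub>j\<close>. So \<open>\<psi> y\<^sub>j\<close> has degree \<open>1\<close>, that is, it is a multiple of a variable.
\<close>

theorem aut_coord_y:
  assumes \<psi>: "\<psi> \<in> algebra_auts A" and j: "j \<in> {2..m}"
  shows "\<exists>c. c \<noteq> 0 \<and> (\<exists>p\<in>{2..m}. \<psi> (coord Y j) = c \<odot>\<^bsub>A\<^esub> coord Y p)"
proof -
  let ?\<theta> = "aut_inv \<psi>"
  have \<theta>: "?\<theta> \<in> algebra_auts A" by (rule aut_inv_algebra_auts[OF \<psi>])
  have yA: "coord Y j \<in> carrier A" using j by simp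
  obtain v a where a: "a \<noteq> 0" and L: "laurent_of (\<psi> (coord Y j)) = lmon v a"
    and v: "Poly_Mapping.keys v \<subseteq> {2..m}" "\<And>i. 0 \<le> expo v i" "1 \<le> tdeg v"
    using aut_coord_monomial[OF \<psi> j] by blast
  define b where "b i = nat (expo v i)" for i
  let ?g = "\<lambda>x\<in>Y. \<Prod>i\<in>{2..m}. x i ^ b i"
  have gA: "?g \<in> carrier A" by (rule carrier_poly_functions[OF _ monomial_in_poly_functions_y]) auto
  have v_eq: "(\<Sum>i\<in>{2..m}. Poly_Mapping.single i (int (b i))) = v"
  proof (rule poly_mapping_eqI)
    fix i
    have "expo v i = 0" if "i \<notin> {2..m}" using v(1) that by (metis in_keys_iff subsetD)
    then show "expo (\<Sum>i\<in>{2..m}. Poly_Mapping.single i (int (b i))) i = expo v i"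
      using v(2)[of i] by (auto simp: b_def lookup_sum lookup_single when_def)
  qed
  have "laurent_of (\<psi> (coord Y j)) = laurent_of (a \<odot>\<^bsub>A\<^esub> ?g)"
    unfolding L laurent_of_smult[OF gA] laurent_of_monomial v_eq by (simp add: mult_single)
  then have \<psi>y: "\<psi> (coord Y j) = a \<odot>\<^bsub>A\<^esub> ?g"
    by (intro laurent_of_inject algebra_autsD(1)[OF \<psi>] yA carrier_smult gA)
  \<comment> \<open>The inverse automorphism maps a monomial to one of at least the same degree.\<close>
  obtain w c where w: "laurent_of (?\<theta> ?g) = lmon w c" "int (\<Sum>i\<in>{2..m}. b i) \<le> tdeg w"
    using aut_monomial[OF \<theta>, of b] by blast
  have "coord Y j = a \<odot>\<^bsub>A\<^esub> ?\<theta> ?g"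
    using aut_inv_left[OF \<psi> yA] algebra_autsD(4)[OF \<theta> gA] by (simp only: \<psi>y)
  then have "laurent_of (coord Y j) = lmon 0 a * lmon w c"
    by (simp only: laurent_of_smult[OF algebra_autsD(1)[OF \<theta> gA]] w(1))
  then have eq: "lmon (unit_expo j) 1 = lmon w (a * c)"
    using gen_eq_lmon[OF j] j by (simp add: mult_single)
  have "unit_expo j = w"
  proof (rule ccontr)
    assume "unit_expo j \<noteq> w"
    then have "coef (lmon w (a * c)) (unit_expo j) = 0" by (simp add: lookup_single)
    then show False unfolding eq[symmetric] by simp
  qed
  then have "int (\<Sum>i\<in>{2..m}. b i) \<le> 1" using w(2) tdeg_unit_expo[OF j] by simp
  moreover have "tdeg v = int (\<Sum>i\<in>{2..m}. b i)" unfolding tdeg_def by (simp add: b_def v(2))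
  ultimately have "(\<Sum>i\<in>{2..m}. b i) = 1" using v(3) by linarith
  then obtain p where p: "p \<in> {2..m}" "b p = 1" "\<forall>i\<in>{2..m}. p \<noteq> i \<longrightarrow> b i = 0"
    using iffD1[OF sum_eq_1_iff[OF finite_atLeastAtMost]] by blast
  have "?g = coord Y p"
    unfolding coord_def
  proof (rule restrict_ext)
    fix x :: "nat \<Rightarrow> 'k"
    have "(\<Prod>i\<in>{2..m}. x i ^ b i) = (\<Prod>i\<in>{2..m}. if i = p then x p else 1)"
      by (rule prod.cong) (use p in auto)
    then show "(\<Prod>i\<in>{2..m}. x i ^ b i) = x p" using p(1) by simp
  qed
  then have "\<psi> (coord Y j) = a \<odot>\<^bsub>A\<^esub> coord Y p" using \<psi>y by (simp only:)
  then show ?thesis using a p(1) by blast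
qed

end

section \<open>Actions of the multiplicative group\<close>

text \<open>
  The length of the cycle of \<open>j\<close> is at most the number of elements, so it divides the factorial.
\<close>

lemma funpow_fact_eq_self:
  fixes p :: "'a \<Rightarrow> 'a"
  assumes fin: "finite S" and p: "p ` S \<subseteq> S" "inj_on p S" and j: "j \<in> S" and n: "card S \<le> n"
  shows "(p ^^ fact n) j = j"
proof -
  have in_S: "(p ^^ i) x \<in> S" if "x \<in> S" for i x
    using that p(1) by (induction i) auto
  have inj: "x = y" if "(p ^^ i) x = (p ^^ i) y" "x \<in> S" "y \<in> S" for i x y
    using that(1)
  proof (induction i)
    case (Suc i)
    then have "(p ^^ i) x = (p ^^ i) y"
      using inj_onD[OF p(2)] in_S that(2,3) by simp
    then show ?case by (rule Suc.IH)
  qed simp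
  have "\<not> inj_on (\<lambda>i. (p ^^ i) j) {0..card S}"
  proof
    assume "inj_on (\<lambda>i. (p ^^ i) j) {0..card S}"
    then have "card {0..card S} \<le> card S"
      by (rule card_inj_on_le) (use in_S j fin in auto)
    then show False by simp
  qed
  then obtain a b where "a < b" "b \<le> card S" "(p ^^ a) j = (p ^^ b) j"
    unfolding inj_on_def by (metis atLeastAtMost_iff linorder_neqE_nat)
  moreover have "(p ^^ b) j = (p ^^ a) ((p ^^ (b - a)) j)"
    using \<open>a < b\<close> by (simp flip: funpow_add[unfolded comp_def, THEN fun_cong])
  ultimately have per: "(p ^^ (b - a)) j = j" using inj in_S j by metis
  have "(p ^^ ((b - a) * i)) j = j" for i
    by (induction i) (simp_all add: funpow_add per)
  moreover have "b - a dvd fact n"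
    using \<open>a < b\<close> \<open>b \<le> card S\<close> n by (intro dvd_fact) auto
  ultimately show ?thesis by (metis dvdE)
qed

lemma pullback_compose:
  "\<tau> \<in> Y \<rightarrow> Y \<Longrightarrow> pullback Y (compose Y \<sigma> \<tau>) f = pullback Y \<tau> (pullback Y \<sigma> f)"
  unfolding pullback_def compose_def by (rule restrict_ext) auto

context danielewski
begin

lemma pullback_carrier:
  assumes \<phi>: "endomorphism m Y \<phi>" and f: "f \<in> carrier A"
  shows "pullback Y \<phi> f \<in> carrier A"
  using f
proof (rule carrier_induct)
  have im: "\<phi> x \<in> Y" if "x \<in> Y" for x using \<phi> that unfolding endomorphism_def by auto
  fix c
  have "pullback Y \<phi> (\<lambda>x\<in>Y. c) = (\<lambda>x\<in>Y. c)"
    unfolding pullback_def compose_def by (rule restrict_ext) (simp add: im)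
  then show "pullback Y \<phi> (\<lambda>x\<in>Y. c) \<in> carrier A" using carrier_const by (simp only:)
next
  have im: "\<phi> x \<in> Y" if "x \<in> Y" for x using \<phi> that unfolding endomorphism_def by auto
  fix f g assume *: "pullback Y \<phi> f \<in> carrier A" "pullback Y \<phi> g \<in> carrier A"
  have "pullback Y \<phi> (f \<oplus>\<^bsub>A\<^esub> g) = pullback Y \<phi> f \<oplus>\<^bsub>A\<^esub> pullback Y \<phi> g"
    unfolding pullback_def compose_def coord_ring_simps by (rule restrict_ext) (simp add: im)
  then show "pullback Y \<phi> (f \<oplus>\<^bsub>A\<^esub> g) \<in> carrier A" using * by (simp only: carrier_add)
next
  have im: "\<phi> x \<in> Y" if "x \<in> Y" for x using \<phi> that unfolding endomorphism_def by auto
  fix j f assume j: "j \<le> m" and *: "pullback Y \<phi> f \<in> carrier A"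
  have "(\<lambda>x\<in>Y. \<phi> x j) \<in> carrier A" using \<phi> j unfolding endomorphism_def by auto
  moreover have "pullback Y \<phi> (coord Y j \<otimes>\<^bsub>A\<^esub> f) = (\<lambda>x\<in>Y. \<phi> x j) \<otimes>\<^bsub>A\<^esub> pullback Y \<phi> f"
    unfolding pullback_def compose_def coord_ring_simps by (rule restrict_ext) (simp add: im coord_def)
  ultimately show "pullback Y \<phi> (coord Y j \<otimes>\<^bsub>A\<^esub> f) \<in> carrier A" using * by (simp only: carrier_mult)
qed

text \<open>
  The pullback along the inverse automorphism of \<open>Y\<close> is the inverse.
\<close>

lemma pullback_algebra_auts:
  assumes \<phi>: "\<phi> \<in> carrier (aut_group m Y)"
  shows "pullback Y \<phi> \<in> algebra_auts A"
proof -
  let ?\<phi>' = "restrict (inv_into Y \<phi>) Y"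
  have bij: "bij_betw \<phi> Y Y" and e: "endomorphism m Y \<phi>" and e': "endomorphism m Y ?\<phi>'"
    using \<phi> by (auto simp: aut_group_def Bij_def)
  have im: "\<phi> x \<in> Y" if "x \<in> Y" for x using bij_betwE[OF bij] that by blast
  have im': "inv_into Y \<phi> x \<in> Y" if "x \<in> Y" for x
    using bij_betwE[OF bij_betw_inv_into[OF bij]] that by blast
  have ext: "f = restrict f Y" if "f \<in> carrier A" for f
    using that poly_functions_on_extensional by (simp add: coord_ring_simps)
  have l: "pullback Y ?\<phi>' (pullback Y \<phi> f) = f" if f: "f \<in> carrier A" for f
  proof -
    have "pullback Y ?\<phi>' (pullback Y \<phi> f) = restrict f Y"
      unfolding pullback_def compose_def
      by (rule restrict_ext) (simp add: im' bij_betw_inv_into_right[OF bij])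
    then show ?thesis using ext[OF f] by simp
  qed
  have r: "pullback Y \<phi> (pullback Y ?\<phi>' f) = f" if f: "f \<in> carrier A" for f
  proof -
    have "pullback Y \<phi> (pullback Y ?\<phi>' f) = restrict f Y"
      unfolding pullback_def compose_def
      by (rule restrict_ext) (simp add: im bij_betw_inv_into_left[OF bij])
    then show ?thesis using ext[OF f] by simp
  qed
  have "bij_betw (pullback Y \<phi>) (carrier A) (carrier A)"
    by (rule bij_betw_byWitness[where f' = "pullback Y ?\<phi>'"])
      (use l r pullback_carrier[OF e] pullback_carrier[OF e'] in auto)
  moreover have "pullback Y \<phi> (f \<otimes>\<^bsub>A\<^esub> g) = pullback Y \<phi> f \<otimes>\<^bsub>A\<^esub> pullback Y \<phi> g" for f g
    unfolding pullback_def compose_def coord_ring_simps by (rule restrict_ext) (simp add: im)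
  moreover have "pullback Y \<phi> (f \<oplus>\<^bsub>A\<^esub> g) = pullback Y \<phi> f \<oplus>\<^bsub>A\<^esub> pullback Y \<phi> g" for f g
    unfolding pullback_def compose_def coord_ring_simps by (rule restrict_ext) (simp add: im)
  moreover have "pullback Y \<phi> (c \<odot>\<^bsub>A\<^esub> f) = c \<odot>\<^bsub>A\<^esub> pullback Y \<phi> f" for c f
    unfolding pullback_def compose_def coord_ring_simps by (rule restrict_ext) (simp add: im)
  moreover have "pullback Y \<phi> \<one>\<^bsub>A\<^esub> = \<one>\<^bsub>A\<^esub>"
    unfolding pullback_def compose_def coord_ring_simps by (rule restrict_ext) (simp add: im)
  ultimately show ?thesis
    unfolding algebra_auts_def ring_iso_def ring_hom_def using pullback_carrier[OF e] by simp
qed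

lemma smult_coord_eq_imp:
  assumes "i \<in> {2..m}" "j \<in> {2..m}" "c \<noteq> 0" and eq: "c \<odot>\<^bsub>A\<^esub> coord Y i = b \<odot>\<^bsub>A\<^esub> coord Y j"
  shows "i = j"
proof -
  have "laurent_of (c \<odot>\<^bsub>A\<^esub> coord Y i) = lmon (unit_expo i) c" "laurent_of (b \<odot>\<^bsub>A\<^esub> coord Y j) = lmon (unit_expo j) b"
    using assms(1,2) by (simp_all add: gen_eq_lmon mult_single)
  then have "coef (lmon (unit_expo i) c) (unit_expo i) = coef (lmon (unit_expo j) b) (unit_expo i)"
    using eq by simp
  then have "unit_expo i = unit_expo j" using assms(3) by (auto simp: lookup_single when_def split: if_splits)
  then have "expo (unit_expo i) i = expo (unit_expo j) i" by simp
  then show ?thesis by (auto simp: lookup_single when_def split: if_splits)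
qed

text \<open>
  The multiplicative group is divisible, so it has no nontrivial homomorphism to a finite group of
  permutations. Concretely, an element is a power of exponent \<open>fact m\<close> of another one; that one
  permutes the lines spanned by the \<open>y\<^sub>j\<close>, and this power of the permutation is the identity.
\<close>

theorem Gm_subgroup_coord_y:
  assumes \<Lambda>: "Gm_subgroup m Y \<Lambda>" and \<phi>: "\<phi> \<in> \<Lambda>" and j: "j \<in> {2..m}"
    and roots: "\<And>t :: 'k. \<exists>s. s ^ fact m = t"
  shows "\<exists>c. c \<noteq> 0 \<and> pullback Y \<phi> (coord Y j) = c \<odot>\<^bsub>A\<^esub> coord Y j"
proof -
  obtain \<alpha> :: "'k \<Rightarrow> _" where \<alpha>: "\<alpha> \<in> iso Gm ((aut_group m Y)\<lparr>carrier := \<Lambda>\<rparr>)" and sub: "subgroup \<Lambda> (aut_group m Y)"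
    using \<Lambda> unfolding Gm_subgroup_def by blast
  have bij: "bij_betw \<alpha> (carrier Gm) \<Lambda>" using \<alpha> by (simp add: iso_def)
  have \<alpha>_in: "\<alpha> t \<in> carrier (aut_group m Y)" if "t \<noteq> 0" for t
    using bij_betwE[OF bij] subgroup.subset[OF sub] that by (auto simp: Gm_def)
  have Bij: "\<alpha> t \<in> Bij Y" if "t \<noteq> 0" for t
    using \<alpha>_in[OF that] by (simp add: aut_group_def)
  have mult: "\<alpha> (s * t) = compose Y (\<alpha> s) (\<alpha> t)" if "s \<noteq> 0" "t \<noteq> 0" for s t
  proof -
    have "\<alpha> (s \<otimes>\<^bsub>Gm\<^esub> t) = \<alpha> s \<otimes>\<^bsub>(aut_group m Y)\<lparr>carrier := \<Lambda>\<rparr>\<^esub> \<alpha> t"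
      using \<alpha> that by (intro hom_mult[of \<alpha> Gm]) (auto simp: iso_def Gm_def)
    then show ?thesis using Bij that by (simp add: Gm_def aut_group_def BijGroup_def)
  qed
  obtain t where t: "t \<noteq> 0" "\<phi> = \<alpha> t"
    using bij \<phi> by (auto simp: bij_betw_def Gm_def)
  obtain s where s: "s ^ fact m = t" using roots by blast
  have s_nz: "s \<noteq> 0" using s t(1) by (auto simp: power_0_left)
  have aut: "pullback Y (\<alpha> u) \<in> algebra_auts A" if "u \<noteq> 0" for u
    by (rule pullback_algebra_auts[OF \<alpha>_in[OF that]])
  have "\<forall>i\<in>{2..m}. \<exists>p. \<exists>c. p \<in> {2..m} \<and> c \<noteq> 0 \<and> pullback Y (\<alpha> s) (coord Y i) = c \<odot>\<^bsub>A\<^esub> coord Y p"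
    using aut_coord_y[OF aut[OF s_nz]] by blast
  then obtain p where "\<forall>i\<in>{2..m}. \<exists>c. p i \<in> {2..m} \<and> c \<noteq> 0 \<and> pullback Y (\<alpha> s) (coord Y i) = c \<odot>\<^bsub>A\<^esub> coord Y (p i)"
    by (rule bchoice[THEN exE])
  then obtain c where p: "p i \<in> {2..m}" and c: "c i \<noteq> 0"
    and pc: "pullback Y (\<alpha> s) (coord Y i) = c i \<odot>\<^bsub>A\<^esub> coord Y (p i)" if "i \<in> {2..m}" for i
    by metis
  have inj: "inj_on p {2..m}"
  proof (rule inj_onI)
    fix i l assume i: "i \<in> {2..m}" and l: "l \<in> {2..m}" and eq: "p i = p l"
    have iA: "coord Y i \<in> carrier A" and lA: "coord Y l \<in> carrier A" using i l by auto
    have "pullback Y (\<alpha> s) (c l \<odot>\<^bsub>A\<^esub> coord Y i) = pullback Y (\<alpha> s) (c i \<odot>\<^bsub>A\<^esub> coord Y l)"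
      unfolding algebra_autsD(4)[OF aut[OF s_nz] iA] algebra_autsD(4)[OF aut[OF s_nz] lA]
        pc[OF i] pc[OF l] eq
      by (auto simp: coord_ring_simps)
    then have "c l \<odot>\<^bsub>A\<^esub> coord Y i = c i \<odot>\<^bsub>A\<^esub> coord Y l"
      by (rule algebra_auts_inject[OF aut[OF s_nz] carrier_smult[OF iA] carrier_smult[OF lA]])
    then show "i = l" by (rule smult_coord_eq_imp[OF i l c[OF l]])
  qed
  have iter: "\<forall>i\<in>{2..m}. \<exists>b. b \<noteq> 0 \<and> pullback Y (\<alpha> (s ^ Suc n)) (coord Y i) = b \<odot>\<^bsub>A\<^esub> coord Y ((p ^^ Suc n) i)" for n
  proof (induction n)
    case 0
    show ?case
    proof
      fix i assume i: "i \<in> {2..m}"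
      show "\<exists>b. b \<noteq> 0 \<and> pullback Y (\<alpha> (s ^ Suc 0)) (coord Y i) = b \<odot>\<^bsub>A\<^esub> coord Y ((p ^^ Suc 0) i)"
        using c[OF i] pc[OF i] by (intro exI[of _ "c i"]) simp
    qed
  next
    case (Suc n)
    show ?case
    proof
      fix i assume i: "i \<in> {2..m}"
      obtain b where b: "b \<noteq> 0"
        "pullback Y (\<alpha> (s ^ Suc n)) (coord Y (p i)) = b \<odot>\<^bsub>A\<^esub> coord Y ((p ^^ Suc n) (p i))"
        using Suc p[OF i] by blast
      have piA: "coord Y (p i) \<in> carrier A" using p[OF i] by simp
      have nz: "s ^ Suc n \<noteq> 0" using s_nz by simp
      have "pullback Y (\<alpha> (s ^ Suc (Suc n))) (coord Y i)
          = pullback Y (\<alpha> (s ^ Suc n)) (pullback Y (\<alpha> s) (coord Y i))"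
        unfolding power_Suc[of s "Suc n"] mult[OF s_nz nz]
        by (rule pullback_compose[OF Bij_imp_funcset[OF Bij[OF nz]]])
      also have "\<dots> = c i \<odot>\<^bsub>A\<^esub> (b \<odot>\<^bsub>A\<^esub> coord Y ((p ^^ Suc n) (p i)))"
        unfolding pc[OF i] algebra_autsD(4)[OF aut[OF nz] piA] b(2) ..
      also have "\<dots> = (c i * b) \<odot>\<^bsub>A\<^esub> coord Y ((p ^^ Suc (Suc n)) i)"
        unfolding funpow_Suc_right[of "Suc n"] by (auto simp: coord_ring_simps)
      finally show "\<exists>b. b \<noteq> 0 \<and> pullback Y (\<alpha> (s ^ Suc (Suc n))) (coord Y i) = b \<odot>\<^bsub>A\<^esub> coord Y ((p ^^ Suc (Suc n)) i)"
        using b(1) c[OF i] by (intro exI[of _ "c i * b"]) simp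
    qed
  qed
  obtain n where n: "fact m = Suc n" by (metis fact_nonzero not0_implies_Suc)
  have "(p ^^ fact m) j = j"
    by (rule funpow_fact_eq_self[of "{2..m}"]) (use p inj j in auto)
  then show ?thesis using bspec[OF iter[of n] j] unfolding n[symmetric] s t(2) by simp
qed

end

theorem lemma6p2:
  fixes m :: nat and k :: "nat \<Rightarrow> nat"
    and P :: "'k::{alg_closed_field, field_char_0} poly"
    and Y :: "(nat \<Rightarrow> 'k) set"
    and A :: "('k, (nat \<Rightarrow> 'k) \<Rightarrow> 'k) module"
  assumes "m \<ge> 1"
    and "\<And>j. j \<in> {2..m} \<Longrightarrow> k j \<ge> 2"
    and "degree P \<ge> 2"
    and "Y = hypersurface m k P"
    and "A = coord_ring m Y"
  shows "makar_limanov A = poly_functions_on Y {2..m}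
    \<and> (\<exists>\<delta>. canonical_lnd m k P \<delta> \<and>
          (\<forall>D. lnd A D \<longrightarrow>
            (\<exists>h\<in>poly_functions_on Y {2..m}. \<forall>f\<in>carrier A. D f = h \<otimes>\<^bsub>A\<^esub> \<delta> f)))
    \<and> (\<forall>\<Lambda>. Gm_subgroup m Y \<Lambda> \<longrightarrow>
          (\<forall>\<phi>\<in>\<Lambda>. \<forall>j\<in>{2..m}. \<exists>c. c \<noteq> 0 \<and>
            pullback Y \<phi> (coord Y j) = c \<odot>\<^bsub>A\<^esub> coord Y j))
    \<and> (\<forall>\<psi>\<in>algebra_auts A. \<forall>j\<in>{2..m}. \<exists>c. c \<noteq> 0 \<and>
          (\<exists>p\<in>{2..m}. \<psi> (coord Y j) = c \<odot>\<^bsub>A\<^esub> coord Y p))"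
proof -
  interpret danielewski m k P
    by unfold_locales (use assms(1-3) in auto)
  have roots: "\<exists>s. s ^ fact m = t" for t :: 'k
    by (rule nth_root_exists) simp
  show ?thesis
    unfolding assms(5) unfolding assms(4)
    using makar_limanov_eq canonical_lnd_delta lnd_eq_multiple_of_delta
      Gm_subgroup_coord_y[OF _ _ _ roots] aut_coord_y
    by (intro conjI exI[of _ delta] allI impI ballI) auto
qed

end
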